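(* Let $X_\Sigma$ be a projective toric manifold with mirror torus fibration $\mu_Y:Y\to N_{\mathbb{R}}$, let $[a]\in H^2(X_\Sigma,\mathbb{Z})$, and let $\mathcal{L}_{[a]}$ be the holomorphic line bundle over $X_\Sigma$ corresponding to $[a]$. Then the SYZ mirror transformation $\mathcal{F}:h\mapsto L_h$ gives a bijective correspondence between $T_N$-invariant hermitian metrics (of class $C^2$) on $\mathcal{L}_{[a]}$ and Lagrangian sections of $\mu_Y:Y\to N_{\mathbb{R}}$ satisfying the growth condition $(\ast_{[a]})$.
   Context: Toric setting. $N\cong\mathbb{Z}^n$ is a lattice, $M=\mathrm{Hom}(N,\mathbb{Z})$, $\langle\cdot,\cdot\rangle$ the dual pairing, $N_{\mathbb{R}}=N\otimes\mathbb{R}$, $M_{\mathbb{R}}=M\otimes\mathbb{R}$, $T_N=N_{\mathbb{R}}/N$ (compact torus). $\Sigma$ is a smooth complete fan in $N_{\mathbb{R}}$ such that the toric $n$-fold $X_\Sigma$ is projective; $v_1,\dots,v_d\in N$ are the primitive generators of its 1-dimensional cones and $D_1,\dots,D_d\subset X_\Sigma$ the corresponding toric prime divisors. The open dense orbit is $U=X_\Sigma\setminus\bigcup_i D_i=N\otimes\mathbb{C}^*\cong(\mathbb{C}^* )^n$, with coordinates $w_j=e^{\xi_j+\sqrt{-1}u_j}$, where $\xi=(\xi_1,\dots,\xi_n)$ are linear coordinates on $N_{\mathbb{R}}$ (from a $\mathbb{Z}$-basis of $N$) and $u_j\in\mathbb{R}/2\pi\mathbb{Z}$; $T_N$ acts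 by rotating the $u_j$. Let $\iota:M\hookrightarrow\mathbb{Z}^d$, $\iota(u)=(\langle u,v_1\rangle,\dots,\langle u,v_d\rangle)$. The quotient $A(W)=\mathbb{Z}^d/\iota(M)$ is canonically identified with $H^2(X_\Sigma,\mathbb{Z})$; the class $[a]$ of $a=(a_1,\dots,a_d)\in\mathbb{Z}^d$ corresponds to the line bundle $\mathcal{L}_{[a]}\cong\mathcal{O}(\sum_i a_iD_i)$. Mirror. $Y=T^*N_{\mathbb{R}}/M=N_{\mathbb{R}}\times\sqrt{-1}(M_{\mathbb{R}}/M)$ with symplectic form $\omega_Y=\sum_j d\xi_j\wedge dy_j$ ($y_j$ the dual coordinates on the fibre), and $\mu_Y:Y\to N_{\mathbb{R}}$ is the projection. A section $L$ of $\mu_Y$ lifts to a section $\tilde L=\{(\xi,y(\xi)):\xi\in N_{\mathbb{R}}\}$ of $T^*N_{\mathbb{R}}$, and two lifts differ by a constant $u\in M$. $L$ is Lagrangian iff some lift is the graph $y=dg$ of an exact 1-form; $g$ (unique up to an additive constant) is called a potential of $\tilde L$. Potentials are always assumed to be of class $C^2$. Growth conditions. For $a\in\mathbb{Z}^d$, a Lagrangian section $\tilde L$ of $T^*N_{\mathbb{R}}\to N_{\mathbb{R}}$ with potential $g\in C^2(N_{\mathbb{R}})$ satisfies $(\ast_a)$ if for every $n$-dimensional cone $\sigma\in\Sigma$, with generators (after relabelling) $v_1,\dots,v_n$, writing $\xi(t)=t_1v_1+\dots+t_nv_n$ for $t\in\mathbb{R}^n$: (1) for $j=1,\dots,n$,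 the functions $2e^{-2t_j}(\langle dg(\xi(t)),v_j\rangle+a_j)$ and $e^{-2t_j}(v_j^T\mathrm{Hess}(g)v_j)(\xi(t))$ have the same limit as $t_j\to-\infty$; (2) for any $j,k,l\in\{1,\dots,n\}$, the function $(v_j^T\mathrm{Hess}(g)v_k)(\xi(t))$ has a limit as $t_l\to-\infty$; (3) for any distinct $j,k\in\{1,\dots,n\}$, the function $e^{-t_j-t_k}(v_j^T\mathrm{Hess}(g)v_k)(\xi(t))$ goes to zero when $t_j\to-\infty$ or $t_k\to-\infty$. (Here $a_j$ is the component of $a$ corresponding to $v_j$.) For $[a]\in A(W)$, a Lagrangian section $L$ of $\mu_Y$ satisfies $(\ast_{[a]})$ if some lift of $L$ to $T^*N_{\mathbb{R}}$ satisfies $(\ast_a)$ for some representative $a\in\mathbb{Z}^d$ of $[a]$. SYZ mirror transformation. Let $h$ be a $T_N$-invariant hermitian metric of class $C^2$ on $\mathcal{L}_{[a]}$. Choose a $T_N$-equivariant meromorphic section $s$ of $\mathcal{L}_{[a]}$ (so $\mathrm{div}(s)=\sum_i a_iD_i$ for some representative $a$ of $[a]$, and $s$ is a holomorphic frame over $U$), and set $g_h(\xi)=-\frac12\log h(s,s)$ evaluated at the point $(e^{\xi_j+\sqrt{-1}u_j})_j\in U$ (independent of $u$). Let $\tilde L_h=\{(\xi,dg_h(\xi)):\xi\in N_{\mathbb{R}}\}\subset T^*N_{\mathbb{R}}$ and let $L_h$ be the induced Lagrangian section of $\mu_Y:Y\to N_{\mathbb{R}}$; it does not depend on the choice of $s$.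 The SYZ mirror transformation is $\mathcal{F}:h\mapsto L_h$.
   Formalization: The bijection is for metrics up to positive constant factors, since L_h = L_{ch} for constant c>0; limits as t_j → −∞ in the growth condition are taken jointly at every boundary point in the coordinates e^{t_i}, since limits with the other t_i fixed do not suffice. *)

theory Defs
  imports "HOL-Analysis.Analysis"
begin

section \<open>Calculus\<close>

definition C1_map :: "('a::real_normed_vector \<Rightarrow> 'b::real_normed_vector) \<Rightarrow> bool" where
  "C1_map f \<longleftrightarrow> (\<exists>f' :: 'a \<Rightarrow> 'a \<Rightarrow>\<^sub>L 'b.
     (\<forall>x. (f has_derivative blinfun_apply (f' x)) (at x)) \<and> continuous_on UNIV f')"

definition C2_fun :: "('a::real_normed_vector \<Rightarrow> real) \<Rightarrow> bool" where
  "C2_fun f \<longleftrightarrow> (\<exists>f' :: 'a \<Rightarrow> 'a \<Rightarrow>\<^sub>L real.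
     (\<forall>x. (f has_derivative blinfun_apply (f' x)) (at x)) \<and> C1_map f')"

definition grad :: "(real^'n \<Rightarrow> real) \<Rightarrow> real^'n \<Rightarrow> real^'n::finite" where
  "grad g \<xi> = (\<chi> i. frechet_derivative g (at \<xi>) (axis i 1))"

definition hess :: "(real^'n \<Rightarrow> real) \<Rightarrow> real^'n \<Rightarrow> real^'n \<Rightarrow> real^'n::finite \<Rightarrow> real" where
  "hess g \<xi> v w = frechet_derivative (\<lambda>\<eta>. grad g \<eta> \<bullet> w) (at \<xi>) v"

definition holomorphic_fun_on :: "(complex^'n \<Rightarrow> complex) \<Rightarrow> (complex^'n::finite) set \<Rightarrow> bool" where
  "holomorphic_fun_on f S \<longleftrightarrow> (\<forall>z\<in>S. \<exists>D. (f has_derivative D) (at z) \<and>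
     (\<forall>c w. D (c *s w) = c * D w))"


section \<open>Lattice and fan\<close>

text \<open>A \<open>\<int>\<close>-basis of the lattice is fixed, so that both \<open>N\<close> and the dual lattice \<open>M\<close> are
  \<^typ>\<open>int^'n\<close>, and \<open>N\<^sub>\<real>\<close> and \<open>M\<^sub>\<real>\<close> are \<^typ>\<open>real^'n\<close>.\<close>

definition pairing :: "int^'n \<Rightarrow> int^'n::finite \<Rightarrow> int" where
  "pairing u v = (\<Sum>i\<in>UNIV. u $ i * v $ i)"

definition rvec :: "int^'n \<Rightarrow> real^'n::finite" where
  "rvec u = (\<chi> i. real_of_int (u $ i))"

definition lattice_cone :: "(int^'n::finite) set \<Rightarrow> (real^'n) set" where
  "lattice_cone S = convex_cone hull (rvec ` S)"

definition primitive :: "int^'n::finite \<Rightarrow> bool" where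
  "primitive u \<longleftrightarrow> (\<forall>k w. u = k *s w \<longrightarrow> \<bar>k\<bar> = 1)"

definition lattice_basis :: "('n \<Rightarrow> int^'n::finite) \<Rightarrow> bool" where
  "lattice_basis e \<longleftrightarrow> (\<forall>x. \<exists>!c :: 'n \<Rightarrow> int. x = (\<Sum>j\<in>UNIV. c j *s e j))"

definition fan :: "(real^'n::finite) set set \<Rightarrow> bool" where
  "fan \<Sigma> \<longleftrightarrow> finite \<Sigma> \<and> \<Sigma> \<noteq> {} \<and>
     (\<forall>\<sigma>\<in>\<Sigma>. (\<exists>S. finite S \<and> \<sigma> = lattice_cone S) \<and> \<sigma> \<inter> uminus ` \<sigma> = {0}) \<and>
     (\<forall>\<sigma>\<in>\<Sigma>. \<forall>\<tau>. \<tau> face_of \<sigma> \<and> \<tau> \<noteq> {} \<longrightarrow> \<tau> \<in> \<Sigma>) \<and>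
     (\<forall>\<sigma>\<in>\<Sigma>. \<forall>\<tau>\<in>\<Sigma>. (\<sigma> \<inter> \<tau>) face_of \<sigma> \<and> (\<sigma> \<inter> \<tau>) face_of \<tau>)"

definition smooth_fan :: "(real^'n::finite) set set \<Rightarrow> bool" where
  "smooth_fan \<Sigma> \<longleftrightarrow> fan \<Sigma> \<and>
     (\<forall>\<sigma>\<in>\<Sigma>. \<exists>e J. lattice_basis e \<and> \<sigma> = lattice_cone (e ` J))"

definition complete_fan :: "(real^'n::finite) set set \<Rightarrow> bool" where
  "complete_fan \<Sigma> \<longleftrightarrow> fan \<Sigma> \<and> \<Union>\<Sigma> = UNIV"

text \<open>\<open>v\<close> lists, without repetition, the primitive generators of the one-dimensional cones; the
  number \<open>d\<close> of rays is the cardinality of the index type.\<close>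

definition ray_generators :: "(real^'n::finite) set set \<Rightarrow> ('d::finite \<Rightarrow> int^'n) \<Rightarrow> bool" where
  "ray_generators \<Sigma> v \<longleftrightarrow> bij_betw v UNIV {u. primitive u \<and> lattice_cone {u} \<in> \<Sigma>}"

text \<open>An ordering \<open>b\<close> of the generators of an \<open>n\<close>-dimensional cone of the fan. (In a smooth fan,
  \<open>v i\<close> lies in a cone iff it generates one of its rays.)\<close>

definition ordered_max_cone ::
    "(real^'n::finite) set set \<Rightarrow> ('d::finite \<Rightarrow> int^'n) \<Rightarrow> ('n \<Rightarrow> 'd) \<Rightarrow> bool" where
  "ordered_max_cone \<Sigma> v b \<longleftrightarrow>
     (\<exists>\<sigma>\<in>\<Sigma>. dim \<sigma> = CARD('n) \<and> bij_betw b UNIV {i. rvec (v i) \<in> \<sigma>})"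

definition iota :: "('d::finite \<Rightarrow> int^'n::finite) \<Rightarrow> int^'n \<Rightarrow> int^'d" where
  "iota v u = (\<chi> i. pairing u (v i))"


section \<open>The toric manifold\<close>

text \<open>A point of the orbit \<open>O\<^sub>\<tau> = Hom (\<tau>\<^sup>\<bottom> \<inter> M, \<complex>\<^sup>*)\<close> is a pair \<open>(\<tau>, \<gamma>)\<close>, with \<open>\<gamma>\<close> extended by
  zero outside \<open>\<tau>\<^sup>\<bottom> \<inter> M\<close>. For \<open>\<tau> \<subseteq> \<sigma>\<close> it is the point of
  \<open>U\<^sub>\<sigma> = Hom (\<sigma>\<^sup>\<or> \<inter> M, \<complex>)\<close> (homomorphisms of semigroups) obtained by restricting \<open>\<gamma>\<close>; two
  charts are glued along the common orbits.\<close>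

type_synonym 'n tpoint = "(real^'n) set \<times> (int^'n \<Rightarrow> complex)"

definition perp :: "(real^'n) set \<Rightarrow> (int^'n::finite) set" where
  "perp \<tau> = {u. \<forall>x\<in>\<tau>. rvec u \<bullet> x = 0}"

definition torus_orbit :: "(real^'n::finite) set \<Rightarrow> 'n tpoint set" where
  "torus_orbit \<tau> = {\<tau>} \<times> {\<gamma>. (\<forall>u. \<gamma> u \<noteq> 0 \<longleftrightarrow> u \<in> perp \<tau>) \<and>
     (\<forall>u\<in>perp \<tau>. \<forall>u'\<in>perp \<tau>. \<gamma> (u + u') = \<gamma> u * \<gamma> u')}"

definition toric_variety :: "(real^'n::finite) set set \<Rightarrow> 'n tpoint set" where
  "toric_variety \<Sigma> = (\<Union>\<tau>\<in>\<Sigma>. torus_orbit \<tau>)"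

text \<open>The inverse of the coordinate chart \<open>U\<^sub>\<sigma> \<cong> \<complex>\<^sup>n\<close>, \<open>x \<mapsto> (x (m\<^sub>1), \<dots>, x (m\<^sub>n))\<close>, where
  \<open>m\<^sub>1, \<dots>, m\<^sub>n\<close> is the basis dual to the generators \<open>v (b j)\<close> of \<open>\<sigma>\<close>; the divisor \<open>D\<close> of the
  ray \<open>v (b j)\<close> is \<open>z\<^sub>j = 0\<close>. Note that \<open>0 powi 0 = 1\<close>. The complex structure of the toric variety
  is the one for which these parametrisations are biholomorphic onto open subsets.\<close>

definition chart_point ::
    "('d::finite \<Rightarrow> int^'n::finite) \<Rightarrow> ('n \<Rightarrow> 'd) \<Rightarrow> complex^'n \<Rightarrow> 'n tpoint" where
  "chart_point v b z =
     (let \<tau> = lattice_cone {v (b j) |j. z $ j = 0}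
      in (\<tau>, \<lambda>u. if u \<in> perp \<tau> then \<Prod>j\<in>UNIV. (z $ j) powi (pairing u (v (b j))) else 0))"

text \<open>The point of the open orbit \<open>U\<close> with coordinates \<open>w\<^sub>j = exp (\<xi>\<^sub>j + \<i> \<theta>\<^sub>j)\<close>.\<close>

definition open_orbit_point :: "real^'n \<Rightarrow> real^'n \<Rightarrow> 'n::finite tpoint" where
  "open_orbit_point \<xi> \<theta> = ({0}, \<lambda>u. exp (Complex (rvec u \<bullet> \<xi>) (rvec u \<bullet> \<theta>)))"

text \<open>The element of \<open>T\<^sub>N\<close> with angles \<open>\<theta>\<close> acts by \<open>w\<^sub>j \<mapsto> exp (\<i> \<theta>\<^sub>j) w\<^sub>j\<close>.\<close>

definition torus_act :: "real^'n \<Rightarrow> 'n tpoint \<Rightarrow> 'n::finite tpoint" where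
  "torus_act \<theta> x = (fst x, \<lambda>u. cis (rvec u \<bullet> \<theta>) * snd x u)"

text \<open>Projectivity: a holomorphic embedding into some \<open>\<complex>P\<^sup>N\<close>. A point of \<open>\<complex>P\<^sup>N\<close> is the set of all
  its homogeneous coordinate vectors. As the toric variety of a complete fan is compact, an
  injective holomorphic immersion is an embedding.\<close>

definition proj_point :: "nat \<Rightarrow> (nat \<Rightarrow> complex) \<Rightarrow> (nat \<Rightarrow> complex) set" where
  "proj_point N F = {G. \<exists>c. c \<noteq> 0 \<and> (\<forall>i. G i = (if i \<le> N then c * F i else 0))}"

definition projective_toric ::
    "(real^'n::finite) set set \<Rightarrow> ('d::finite \<Rightarrow> int^'n) \<Rightarrow> bool" where
  "projective_toric \<Sigma> v \<longleftrightarrow> (\<exists>N \<Phi>. inj_on \<Phi> (toric_variety \<Sigma>) \<and>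
     (\<forall>b. ordered_max_cone \<Sigma> v b \<longrightarrow>
       (\<forall>z\<^sub>0. \<exists>W. \<exists>F :: nat \<Rightarrow> complex^'n \<Rightarrow> complex. open W \<and> z\<^sub>0 \<in> W \<and>
          (\<forall>i\<le>N. holomorphic_fun_on (F i) W) \<and>
          (\<forall>z\<in>W. (\<exists>i\<le>N. F i z \<noteq> 0) \<and> \<Phi> (chart_point v b z) = proj_point N (\<lambda>i. F i z)) \<and>
          (\<forall>w. (\<exists>c. \<forall>i\<le>N. frechet_derivative (F i) (at z\<^sub>0) w = c * F i z\<^sub>0) \<longrightarrow> w = 0))))"


section \<open>The line bundle of a toric divisor\<close>

text \<open>Near a point of \<open>O\<^sub>\<tau>\<close> the sheaf \<open>\<O>(\<Sum>\<^sub>i a\<^sub>i D\<^sub>i)\<close> is generated by any rational function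
  \<open>\<chi>\<^sup>m\<close> with \<open>m\<close> in the following set.\<close>

definition local_generators ::
    "('d::finite \<Rightarrow> int^'n::finite) \<Rightarrow> int^'d \<Rightarrow> (real^'n) set \<Rightarrow> (int^'n) set" where
  "local_generators v a \<tau> = {m. \<forall>i. rvec (v i) \<in> \<tau> \<longrightarrow> pairing m (v i) = - (a $ i)}"

text \<open>A vector \<open>e\<close> of the fibre of \<open>\<O>(\<Sum>\<^sub>i a\<^sub>i D\<^sub>i)\<close> over \<open>x = (\<tau>, \<gamma>)\<close> is given by all its
  coordinates: \<open>e m\<close> is the coordinate in the local frame \<open>\<chi>\<^sup>m\<close>. As \<open>\<chi>\<^bsup>m + u\<^esup> = \<chi>\<^sup>u \<chi>\<^sup>m\<close> and \<open>\<chi>\<^sup>u\<close>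
  has the value \<open>\<gamma> u\<close> at \<open>x\<close>, one has \<open>e m = \<gamma> u * e (m + u)\<close>. The vector space operations
  are pointwise.\<close>

definition fibre ::
    "('d::finite \<Rightarrow> int^'n::finite) \<Rightarrow> int^'d \<Rightarrow> 'n tpoint \<Rightarrow> (int^'n \<Rightarrow> complex) set" where
  "fibre v a x = {e. (\<forall>m. m \<notin> local_generators v a (fst x) \<longrightarrow> e m = 0) \<and>
     (\<forall>m\<in>local_generators v a (fst x). \<forall>u\<in>perp (fst x). e m = snd x u * e (m + u))}"

text \<open>The frame \<open>\<chi>\<^bsup>m\<^sub>\<sigma>\<^esup>\<close> over \<open>U\<^sub>\<sigma>\<close>, at \<open>chart_point v b z\<close>, where \<open>m\<^sub>\<sigma>\<close> is the element of \<open>M\<close> with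
  \<open>\<langle>m\<^sub>\<sigma>, v (b j)\<rangle> = - a\<^bsub>b j\<^esub>\<close> for all \<open>j\<close>: its coordinate in the frame \<open>\<chi>\<^sup>m\<close> is the value of
  \<open>\<chi>\<^bsup>m\<^sub>\<sigma> - m\<^esup>\<close>.\<close>

definition chart_frame ::
    "('d::finite \<Rightarrow> int^'n::finite) \<Rightarrow> int^'d \<Rightarrow> ('n \<Rightarrow> 'd) \<Rightarrow> complex^'n \<Rightarrow> int^'n \<Rightarrow> complex" where
  "chart_frame v a b z = (\<lambda>m.
     if m \<in> local_generators v a (fst (chart_point v b z))
     then \<Prod>j\<in>UNIV. (z $ j) powi (- (a $ b j) - pairing m (v (b j))) else 0)"

text \<open>The lift of the \<open>T\<^sub>N\<close>-action to the line bundle which fixes the section \<open>1\<close> of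
  \<open>\<O>(\<Sum>\<^sub>i a\<^sub>i D\<^sub>i)\<close>. Any other lift differs from it by a (unitary) character of \<open>T\<^sub>N\<close>.\<close>

definition torus_act_fibre ::
    "real^'n::finite \<Rightarrow> (int^'n \<Rightarrow> complex) \<Rightarrow> int^'n \<Rightarrow> complex" where
  "torus_act_fibre \<theta> e = (\<lambda>m. cis (- (rvec m \<bullet> \<theta>)) * e m)"


section \<open>Invariant hermitian metrics\<close>

text \<open>A hermitian metric is a family \<open>h x\<close> of hermitian inner products on the fibres, extended by
  zero to arguments which are not vectors of the fibre (so that equality of metrics is equality
  of functions).\<close>

type_synonym 'n bundle_metric =
  "'n tpoint \<Rightarrow> (int^'n \<Rightarrow> complex) \<Rightarrow> (int^'n \<Rightarrow> complex) \<Rightarrow> complex"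

definition hermitian_metric_C2 ::
    "(real^'n::finite) set set \<Rightarrow> ('d::finite \<Rightarrow> int^'n) \<Rightarrow> int^'d \<Rightarrow> 'n bundle_metric \<Rightarrow> bool" where
  "hermitian_metric_C2 \<Sigma> v a h \<longleftrightarrow>
     (\<forall>x e e'. \<not> (x \<in> toric_variety \<Sigma> \<and> e \<in> fibre v a x \<and> e' \<in> fibre v a x) \<longrightarrow> h x e e' = 0) \<and>
     (\<forall>x\<in>toric_variety \<Sigma>. \<forall>e\<in>fibre v a x. \<forall>e'\<in>fibre v a x.
        (\<forall>e''\<in>fibre v a x. h x (\<lambda>m. e m + e'' m) e' = h x e e' + h x e'' e') \<and>
        (\<forall>c. h x (\<lambda>m. c * e m) e' = c * h x e e') \<and>
        h x e' e = cnj (h x e e') \<and>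
        (e \<noteq> (\<lambda>m. 0) \<longrightarrow> 0 < Re (h x e e))) \<and>
     (\<forall>b. ordered_max_cone \<Sigma> v b \<longrightarrow>
        C2_fun (\<lambda>z. Re (h (chart_point v b z) (chart_frame v a b z) (chart_frame v a b z))))"

definition torus_invariant ::
    "(real^'n::finite) set set \<Rightarrow> ('d::finite \<Rightarrow> int^'n) \<Rightarrow> int^'d \<Rightarrow> 'n bundle_metric \<Rightarrow> bool" where
  "torus_invariant \<Sigma> v a h \<longleftrightarrow>
     (\<forall>\<theta>. \<forall>x\<in>toric_variety \<Sigma>. \<forall>e\<in>fibre v a x. \<forall>e'\<in>fibre v a x.
        h (torus_act \<theta> x) (torus_act_fibre \<theta> e) (torus_act_fibre \<theta> e') = h x e e')"

definition invariant_metrics ::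
    "(real^'n::finite) set set \<Rightarrow> ('d::finite \<Rightarrow> int^'n) \<Rightarrow> int^'d \<Rightarrow> 'n bundle_metric set" where
  "invariant_metrics \<Sigma> v a = {h. hermitian_metric_C2 \<Sigma> v a h \<and> torus_invariant \<Sigma> v a h}"

text \<open>A potential is determined by its Lagrangian section only up to an additive constant, so proportional
  metrics have the same mirror; the correspondence is one of metrics up to positive constants.\<close>

definition metric_scaling ::
    "(real^'n::finite) set set \<Rightarrow> ('d::finite \<Rightarrow> int^'n) \<Rightarrow> int^'d \<Rightarrow>
     ('n bundle_metric \<times> 'n bundle_metric) set" where
  "metric_scaling \<Sigma> v a = {(h, h'). h \<in> invariant_metrics \<Sigma> v a \<and> h' \<in> invariant_metrics \<Sigma> v a \<and>
     (\<exists>c::real. 0 < c \<and> h' = (\<lambda>x e e'. of_real c * h x e e'))}"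


section \<open>The mirror\<close>

text \<open>An element of \<open>M\<^sub>\<real> / M\<close> is a coset of the lattice.\<close>

definition lattice_coset :: "real^'n \<Rightarrow> (real^'n::finite) set" where
  "lattice_coset y = {y + rvec u |u. True}"

definition mirror_Y :: "((real^'n) \<times> (real^'n::finite) set) set" where
  "mirror_Y = UNIV \<times> range lattice_coset"

definition mu_Y :: "(real^'n) \<times> (real^'n) set \<Rightarrow> real^'n::finite" where
  "mu_Y = fst"

text \<open>The form \<open>\<Sum>\<^sub>j d\<xi>\<^sub>j \<and> dy\<^sub>j\<close> on tangent vectors of \<open>T\<^sup>*N\<^sub>\<real>\<close>, to which \<open>Y\<close> is locally isomorphic.\<close>

definition omega_Y :: "(real^'n) \<times> (real^'n) \<Rightarrow> (real^'n) \<times> (real^'n::finite) \<Rightarrow> real" where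
  "omega_Y p q = fst p \<bullet> snd q - fst q \<bullet> snd p"

definition mu_section :: "(real^'n \<Rightarrow> (real^'n) \<times> (real^'n::finite) set) \<Rightarrow> bool" where
  "mu_section L \<longleftrightarrow> (\<forall>\<xi>. L \<xi> \<in> mirror_Y \<and> mu_Y (L \<xi>) = \<xi>)"

definition induced_section ::
    "(real^'n \<Rightarrow> real^'n) \<Rightarrow> real^'n \<Rightarrow> (real^'n) \<times> (real^'n::finite) set" where
  "induced_section y = (\<lambda>\<xi>. (\<xi>, lattice_coset (y \<xi>)))"

text \<open>As \<open>N\<^sub>\<real>\<close> is simply connected, every \<open>C\<^sup>1\<close> section of \<open>Y\<close> has a \<open>C\<^sup>1\<close> lift to \<open>T\<^sup>*N\<^sub>\<real>\<close>. The
  tangent space of the graph of \<open>y\<close> at \<open>\<xi>\<close> consists of the vectors \<open>(p, dy(p))\<close>.\<close>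

definition lagrangian_section :: "(real^'n \<Rightarrow> (real^'n) \<times> (real^'n::finite) set) \<Rightarrow> bool" where
  "lagrangian_section L \<longleftrightarrow> mu_section L \<and>
     (\<exists>y. C1_map y \<and> L = induced_section y \<and>
       (\<forall>\<xi> p q. omega_Y (p, frechet_derivative y (at \<xi>) p) (q, frechet_derivative y (at \<xi>) q) = 0))"


section \<open>Growth conditions\<close>

text \<open>Limits ``as \<open>t\<^sub>j \<rightarrow> -\<infinity>\<close>'' are limits at the boundary divisor: in the coordinates
  \<open>r = (exp t\<^sub>1, \<dots>, exp t\<^sub>n)\<close>, the limit is taken as \<open>r\<close> tends to a point \<open>p \<in> [0, \<infinity>)\<^sup>n\<close> with
  \<open>p\<^sub>j = 0\<close>, for every such \<open>p\<close> (with other coordinates of \<open>p\<close> possibly zero too). This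
  contains the limit along each line on which only \<open>t\<^sub>j\<close> varies. The limits along these lines alone
  would not even give a continuous metric: a sum of bumps of height 1 around points
  \<open>t = (-k, 1/k)\<close>, with disjoint supports in the second coordinate, vanishes eventually on each of
  them.\<close>

definition boundary_filter :: "real^'n \<Rightarrow> (real^'n::finite) filter" where
  "boundary_filter p = filtercomap (\<lambda>t. \<chi> i. exp (t $ i)) (nhds p)"

definition cone_point ::
    "('d::finite \<Rightarrow> int^'n::finite) \<Rightarrow> ('n \<Rightarrow> 'd) \<Rightarrow> real^'n \<Rightarrow> real^'n" where
  "cone_point v b t = (\<Sum>j\<in>UNIV. (t $ j) *\<^sub>R rvec (v (b j)))"

definition growth_condition ::
    "(real^'n::finite) set set \<Rightarrow> ('d::finite \<Rightarrow> int^'n) \<Rightarrow> int^'d \<Rightarrow> (real^'n \<Rightarrow> real) \<Rightarrow> bool" where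
  "growth_condition \<Sigma> v a g \<longleftrightarrow> (\<forall>b. ordered_max_cone \<Sigma> v b \<longrightarrow>
     (let w = (\<lambda>j. rvec (v (b j)));
          H = (\<lambda>j k t. hess g (cone_point v b t) (w j) (w k))
      in
       (\<forall>j p. (\<forall>i. 0 \<le> p $ i) \<and> p $ j = 0 \<longrightarrow>
          (\<exists>c. ((\<lambda>t. 2 * exp (- 2 * t $ j) * (grad g (cone_point v b t) \<bullet> w j + of_int (a $ b j)))
                  \<longlongrightarrow> c) (boundary_filter p) \<and>
               ((\<lambda>t. exp (- 2 * t $ j) * H j j t) \<longlongrightarrow> c) (boundary_filter p))) \<and>
       (\<forall>j k l p. (\<forall>i. 0 \<le> p $ i) \<and> p $ l = 0 \<longrightarrow>
          (\<exists>c. (H j k \<longlongrightarrow> c) (boundary_filter p))) \<and>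
       (\<forall>j k p. j \<noteq> k \<and> (\<forall>i. 0 \<le> p $ i) \<and> (p $ j = 0 \<or> p $ k = 0) \<longrightarrow>
          ((\<lambda>t. exp (- t $ j - t $ k) * H j k t) \<longlongrightarrow> 0) (boundary_filter p))))"

definition growth_condition_class ::
    "(real^'n::finite) set set \<Rightarrow> ('d::finite \<Rightarrow> int^'n) \<Rightarrow> int^'d \<Rightarrow>
     (real^'n \<Rightarrow> (real^'n) \<times> (real^'n) set) \<Rightarrow> bool" where
  "growth_condition_class \<Sigma> v a L \<longleftrightarrow>
     (\<exists>u g. C2_fun g \<and> L = induced_section (grad g) \<and> growth_condition \<Sigma> v (a + iota v u) g)"

definition lagrangian_sections_growth ::
    "(real^'n::finite) set set \<Rightarrow> ('d::finite \<Rightarrow> int^'n) \<Rightarrow> int^'d \<Rightarrow>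
     (real^'n \<Rightarrow> (real^'n) \<times> (real^'n) set) set" where
  "lagrangian_sections_growth \<Sigma> v a = {L. lagrangian_section L \<and> growth_condition_class \<Sigma> v a L}"


section \<open>The SYZ mirror transformation\<close>

text \<open>Equivariance is with respect to some lift of the action to the line bundle, that is, up to a
  character \<open>u \<in> M\<close> of \<open>T\<^sub>N\<close>. The polar divisor of an equivariant meromorphic section is invariant
  under the complexified torus, so such a section is holomorphic over the open orbit; its values
  outside the open orbit are irrelevant. The local expression of \<open>s\<close> in a chart is a holomorphic
  function divided by a power of \<open>z\<^sub>1 \<cdots> z\<^sub>n\<close>.\<close>

definition equivariant_meromorphic_section ::
    "(real^'n::finite) set set \<Rightarrow> ('d::finite \<Rightarrow> int^'n) \<Rightarrow> int^'d \<Rightarrow>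
     ('n tpoint \<Rightarrow> int^'n \<Rightarrow> complex) \<Rightarrow> bool" where
  "equivariant_meromorphic_section \<Sigma> v a s \<longleftrightarrow>
     (\<forall>x\<in>torus_orbit {0}. s x \<in> fibre v a x) \<and>
     (\<exists>x\<in>torus_orbit {0}. s x \<noteq> (\<lambda>m. 0)) \<and>
     (\<forall>b. ordered_max_cone \<Sigma> v b \<longrightarrow>
        (\<exists>F k. holomorphic_fun_on F UNIV \<and>
           (\<forall>z. (\<forall>j. z $ j \<noteq> 0) \<longrightarrow> s (chart_point v b z) =
              (\<lambda>m. F z / (\<Prod>j\<in>UNIV. z $ j) ^ k * chart_frame v a b z m)))) \<and>
     (\<exists>u. \<forall>\<theta>. \<forall>x\<in>torus_orbit {0}.
        s (torus_act \<theta> x) = (\<lambda>m. cis (rvec u \<bullet> \<theta>) * torus_act_fibre \<theta> (s x) m))"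

text \<open>For an invariant metric the following does not depend on the angles \<open>\<theta>\<close> of the point at
  which \<open>h(s, s)\<close> is evaluated.\<close>

definition syz_potential ::
    "'n bundle_metric \<Rightarrow> ('n tpoint \<Rightarrow> int^'n \<Rightarrow> complex) \<Rightarrow> real^'n::finite \<Rightarrow> real" where
  "syz_potential h s \<xi> =
     (let x = open_orbit_point \<xi> 0 in - (1 / 2) * ln (Re (h x (s x) (s x))))"

text \<open>The section \<open>L\<^sub>h\<close> is the same for all choices of \<open>s\<close>.\<close>

definition syz_transform ::
    "(real^'n::finite) set set \<Rightarrow> ('d::finite \<Rightarrow> int^'n) \<Rightarrow> int^'d \<Rightarrow>
     'n bundle_metric \<Rightarrow> real^'n \<Rightarrow> (real^'n) \<times> (real^'n) set" where
  "syz_transform \<Sigma> v a h = (THE L. \<exists>s. equivariant_meromorphic_section \<Sigma> v a s \<and>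
     L = induced_section (grad (syz_potential h s)))"

end

theory Submission
  imports Defs
begin

text \<open>In a chart \<open>U\<^sub>\<sigma> \<cong> \<complex>\<^sup>n\<close> an invariant metric is a positive function of the moduli \<open>r\<^sub>j = exp t\<^sub>j\<close>;
  let \<open>F (r)\<close> be \<open>- 1/2\<close> times its logarithm, and \<open>G (t) = F (exp t)\<close>, which is the potential up to the
  linear function \<open>\<Sum>\<^sub>j a\<^sub>j t\<^sub>j\<close>. If the metric is of class \<open>C\<^sup>2\<close>, then \<open>F\<close> is of class \<open>C\<^sup>2\<close> and even in each
  variable, and the growth conditions for \<open>G\<close> say that \<open>F\<^sub>j / r\<^sub>j\<close> and \<open>F\<^sub>j\<^sub>j\<close> have the same limit on \<open>r\<^sub>j = 0\<close>
  and that \<open>F\<^sub>j\<^sub>k\<close> vanishes on \<open>r\<^sub>j r\<^sub>k = 0\<close>. Conversely, the growth conditions bound the derivatives of \<open>G\<close>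
  in the coordinates \<open>r\<close>, so that \<open>G\<close>, its gradient and its Hessian extend continuously to the boundary
  divisors; the resulting function of \<open>z\<close> is of class \<open>C\<^sup>2\<close> because the hyperplanes \<open>z\<^sub>j = 0\<close> are removable
  for continuous functions whose derivatives extend continuously.

  An equivariant meromorphic section is a constant times a character times the section \<open>1\<close>, since after
  division by the character it is a holomorphic function which is constant along the compact torus.
  Two metrics with the same mirror have potentials whose gradients differ by a continuous function
  with values in \<open>M\<close>, that is, by a constant, and the growth conditions force it to be zero.\<close>

text \<open>With r_j = exp t_j the chain rule gives G_j = r_j F_j and G_kj = r_k r_j F_kj, plus r_j
  F_j if k = j. So exp (- 2 t_j) G_j is F_j / r_j, while exp (- 2 t_j) G_jj is F_jj + F_j / r_j. The
  factor 2 in the growth condition makes the two limits agree exactly when F_jj - F_j / r_j tends to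
  0. This difference, together with F_kj for distinct k and j, forms the matrix K around which the
  converse is built. The obstacle there is that |z_j| is not differentiable at z_j = 0; but the
  gradient of F (|z|) is (F_j / r_j) z_j, and its derivative involves only F_j / r_j and the K_kj
  times bounded unit vectors. A second obstacle is global: a potential must define one metric on the
  whole variety. The metric is therefore defined without charts, and each chart is compared with
  this definition, never with another chart. Since metrics are counted up to positive constants,
  bijectivity amounts to two facts: the image consists of all sections with the growth condition,
  and two metrics have the same mirror iff they are proportional.\<close>

section \<open>Functions of class \<open>C\<^sup>1\<close> and \<open>C\<^sup>2\<close>\<close>

text \<open>On a Euclidean space continuity of the derivative in every fixed direction already gives
  continuity in the operator norm, because finitely many basis vectors control that norm. Later
  derivatives can therefore be plain functions.\<close>

lemma C1_map_iff:
  fixes f :: "'a::euclidean_space \<Rightarrow> 'b::real_normed_vector"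
  shows "C1_map f \<longleftrightarrow>
    (\<exists>D. (\<forall>x. (f has_derivative D x) (at x)) \<and> (\<forall>w. continuous_on UNIV (\<lambda>x. D x w)))"
proof
  assume "C1_map f"
  then obtain f' :: "'a \<Rightarrow> 'a \<Rightarrow>\<^sub>L 'b"
    where f': "\<And>x. (f has_derivative blinfun_apply (f' x)) (at x)" "continuous_on UNIV f'"
    unfolding C1_map_def by blast
  have "continuous_on UNIV (\<lambda>x. blinfun_apply (f' x) w)" for w
    by (intro continuous_intros f')
  then show "\<exists>D. (\<forall>x. (f has_derivative D x) (at x)) \<and> (\<forall>w. continuous_on UNIV (\<lambda>x. D x w))"
    using f'(1) by (intro exI[of _ "\<lambda>x. blinfun_apply (f' x)"]) simp
next
  assume "\<exists>D. (\<forall>x. (f has_derivative D x) (at x)) \<and> (\<forall>w. continuous_on UNIV (\<lambda>x. D x w))"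
  then obtain D where D: "\<And>x. (f has_derivative D x) (at x)" "\<And>w. continuous_on UNIV (\<lambda>x. D x w)"
    by blast
  have eq: "blinfun_apply (Blinfun (D x)) = D x" for x
    using D(1)[of x] by (simp add: bounded_linear_Blinfun_apply has_derivative_bounded_linear)
  have "continuous_on UNIV (\<lambda>x. Blinfun (D x))"
    by (rule continuous_on_blinfun_componentwise) (simp add: eq D)
  with D eq show "C1_map f"
    unfolding C1_map_def by (intro exI[of _ "\<lambda>x. Blinfun (D x)"]) simp
qed

lemma C1_mapI:
  fixes f :: "'a::euclidean_space \<Rightarrow> 'b::real_normed_vector"
  assumes "\<And>x. (f has_derivative D x) (at x)" "\<And>w. continuous_on UNIV (\<lambda>x. D x w)"
  shows "C1_map f"
  using assms unfolding C1_map_iff by blast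

lemma C1_map_continuous_on: "C1_map f \<Longrightarrow> continuous_on S f"
  unfolding C1_map_def
  by (auto intro!: continuous_at_imp_continuous_on intro: has_derivative_continuous)

lemma C1_map_compose:
  assumes "C1_map f" "C1_map g"
  shows "C1_map (\<lambda>x. f (g x))"
proof -
  obtain f' where f': "\<And>x. (f has_derivative blinfun_apply (f' x)) (at x)" "continuous_on UNIV f'"
    using assms unfolding C1_map_def by blast
  obtain g' where g': "\<And>x. (g has_derivative blinfun_apply (g' x)) (at x)" "continuous_on UNIV g'"
    using assms unfolding C1_map_def by blast
  have "((\<lambda>x. f (g x)) has_derivative blinfun_apply (f' (g x) o\<^sub>L g' x)) (at x)" for x
    using has_derivative_compose[OF g'(1) f'(1)] by (simp add: blinfun_compose.rep_eq o_def)
  moreover have "continuous_on UNIV (\<lambda>x. f' (g x) o\<^sub>L g' x)"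
    using continuous_on_compose2[OF f'(2) C1_map_continuous_on[OF assms(2)]] g'(2)
    by (intro continuous_intros) auto
  ultimately show ?thesis
    unfolding C1_map_def by (intro exI[of _ "\<lambda>x. f' (g x) o\<^sub>L g' x"]) simp
qed

lemma C1_map_bounded_linear:
  assumes "bounded_linear f"
  shows "C1_map f"
  unfolding C1_map_def
  by (rule exI[of _ "\<lambda>x. Blinfun f"])
     (simp add: bounded_linear_Blinfun_apply assms bounded_linear_imp_has_derivative)

lemma C1_map_compose_bounded_linear:
  assumes "bounded_linear L" "C1_map f"
  shows "C1_map (\<lambda>x. L (f x))"
  using C1_map_compose[OF C1_map_bounded_linear] assms by blast

lemma C1_map_vec_lambda:
  fixes f :: "'n::finite \<Rightarrow> 'a::euclidean_space \<Rightarrow> 'b::euclidean_space"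
  assumes "\<And>j. C1_map (f j)"
  shows "C1_map (\<lambda>x. \<chi> j. f j x)"
proof -
  obtain D where D: "\<And>j x. (f j has_derivative D j x) (at x)" "\<And>j w. continuous_on UNIV (\<lambda>x. D j x w)"
    using assms unfolding C1_map_iff by metis
  show ?thesis
  proof (rule C1_mapI)
    show "((\<lambda>x. \<chi> j. f j x) has_derivative (\<lambda>w. \<chi> j. D j x w)) (at x)" for x
      using D(1) by (subst has_derivative_componentwise_within)
        (auto simp: Basis_vec_def inner_axis intro!: has_derivative_inner_left)
    show "continuous_on UNIV (\<lambda>x. \<chi> j. D j x w)" for w
      by (intro continuous_intros D)
  qed
qed

text \<open>The Riesz representation replaces the derivative by a gradient vector, so that the
  second derivative is the derivative of a vector-valued map.\<close>

lemma C2_fun_iff: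
  fixes f :: "'a::euclidean_space \<Rightarrow> real"
  shows "C2_fun f \<longleftrightarrow> (\<exists>G. (\<forall>x. (f has_derivative (\<lambda>w. G x \<bullet> w)) (at x)) \<and> C1_map G)"
proof
  assume "C2_fun f"
  then obtain f' :: "'a \<Rightarrow> 'a \<Rightarrow>\<^sub>L real"
    where f': "\<And>x. (f has_derivative blinfun_apply (f' x)) (at x)" "C1_map f'"
    unfolding C2_fun_def by blast
  \<comment> \<open>The map from a functional to its gradient vector; being bounded linear, it
    preserves \<open>C1_map\<close>.\<close>
  define L where "L = (\<lambda>l :: 'a \<Rightarrow>\<^sub>L real. \<Sum>i\<in>Basis. blinfun_apply l i *\<^sub>R i)"
  have "bounded_linear L"
    unfolding L_def by (intro bounded_linear_intros)
  then have "C1_map (\<lambda>x. L (f' x))"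
    by (rule C1_map_compose_bounded_linear) (rule f')
  moreover have "blinfun_apply (f' x) = (\<lambda>w. L (f' x) \<bullet> w)" for x
  proof
    fix w
    have "blinfun_apply (f' x) w = blinfun_apply (f' x) (\<Sum>i\<in>Basis. (w \<bullet> i) *\<^sub>R i)"
      by (simp add: euclidean_representation)
    also have "\<dots> = L (f' x) \<bullet> w"
      by (simp add: L_def blinfun.sum_right blinfun.scaleR_right inner_sum_left inner_commute[of w])
        (simp add: mult.commute)
    finally show "blinfun_apply (f' x) w = L (f' x) \<bullet> w" .
  qed
  ultimately show "\<exists>G. (\<forall>x. (f has_derivative (\<lambda>w. G x \<bullet> w)) (at x)) \<and> C1_map G"
    using f' by (intro exI[of _ "\<lambda>x. L (f' x)"]) simp
next
  assume "\<exists>G. (\<forall>x. (f has_derivative (\<lambda>w. G x \<bullet> w)) (at x)) \<and> C1_map G"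
  then obtain G where G: "\<And>x. (f has_derivative (\<lambda>w. G x \<bullet> w)) (at x)" "C1_map G"
    by blast
  have "C1_map (\<lambda>x. blinfun_inner_right (G x))"
    by (rule C1_map_compose_bounded_linear[OF bounded_linear_blinfun_inner_right G(2)])
  then show "C2_fun f"
    unfolding C2_fun_def using G(1)
    by (intro exI[of _ "\<lambda>x. blinfun_inner_right (G x)"]) simp
qed

lemma C2_fun_continuous_on: "C2_fun f \<Longrightarrow> continuous_on S f"
  unfolding C2_fun_def
  by (auto intro!: continuous_at_imp_continuous_on intro: has_derivative_continuous)

lemma C2_fun_compose_linear:
  fixes f :: "'b::euclidean_space \<Rightarrow> real" and L :: "'a::euclidean_space \<Rightarrow> 'b"
  assumes "C2_fun f" "linear L"
  shows "C2_fun (\<lambda>x. f (L x))"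
proof -
  obtain G where G: "\<And>x. (f has_derivative (\<lambda>w. G x \<bullet> w)) (at x)" "C1_map G"
    using assms C2_fun_iff by blast
  have L: "bounded_linear L" "bounded_linear (adjoint L)"
    using assms(2) adjoint_linear linear_conv_bounded_linear by blast+
  have "((\<lambda>x. f (L x)) has_derivative (\<lambda>w. G (L x) \<bullet> L w)) (at x)" for x
    by (rule has_derivative_compose[OF bounded_linear_imp_has_derivative[OF L(1)] G(1)])
  then have "((\<lambda>x. f (L x)) has_derivative (\<lambda>w. adjoint L (G (L x)) \<bullet> w)) (at x)" for x
    by (simp add: adjoint_clauses[OF assms(2)])
  moreover have "C1_map (\<lambda>x. adjoint L (G (L x)))"
    using L G(2) C1_map_compose_bounded_linear[OF L(2) C1_map_compose[OF G(2) C1_map_bounded_linear[OF L(1)]]]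
    by blast
  ultimately show ?thesis
    unfolding C2_fun_iff by (intro exI[of _ "\<lambda>x. adjoint L (G (L x))"]) simp
qed

section \<open>Products, sums and compositions\<close>

lemma C1_map_scaleR:
  fixes f :: "'a::euclidean_space \<Rightarrow> real" and g :: "'a \<Rightarrow> 'b::real_normed_vector"
  assumes "C1_map f" "C1_map g"
  shows "C1_map (\<lambda>x. f x *\<^sub>R g x)"
proof -
  obtain D E where D: "\<And>x. (f has_derivative D x) (at x)" "\<And>w. continuous_on UNIV (\<lambda>x. D x w)"
    and E: "\<And>x. (g has_derivative E x) (at x)" "\<And>w. continuous_on UNIV (\<lambda>x. E x w)"
    using assms unfolding C1_map_iff by blast
  show ?thesis
    by (rule C1_mapI[where D = "\<lambda>x w. f x *\<^sub>R E x w + D x w *\<^sub>R g x"])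
       (auto intro!: derivative_eq_intros continuous_intros D E C1_map_continuous_on[OF assms(1)]
          C1_map_continuous_on[OF assms(2)])
qed

lemma C1_map_add:
  fixes f :: "'a::euclidean_space \<Rightarrow> 'b::real_normed_vector"
  assumes "C1_map f" "C1_map g"
  shows "C1_map (\<lambda>x. f x + g x)"
proof -
  obtain D E where D: "\<And>x. (f has_derivative D x) (at x)" "\<And>w. continuous_on UNIV (\<lambda>x. D x w)"
    and E: "\<And>x. (g has_derivative E x) (at x)" "\<And>w. continuous_on UNIV (\<lambda>x. E x w)"
    using assms unfolding C1_map_iff by blast
  show ?thesis
    by (rule C1_mapI[where D = "\<lambda>x w. D x w + E x w"])
       (auto intro!: derivative_eq_intros continuous_intros D E)
qed

lemma C1_map_const: "C1_map (\<lambda>x. c)"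
  unfolding C1_map_def by (rule exI[of _ "\<lambda>x. 0"]) (simp add: zero_blinfun.rep_eq)

lemma C2_fun_add:
  fixes f :: "'a::euclidean_space \<Rightarrow> real"
  assumes "C2_fun f" "C2_fun g"
  shows "C2_fun (\<lambda>x. f x + g x)"
proof -
  obtain F G where F: "\<And>x. (f has_derivative (\<lambda>w. F x \<bullet> w)) (at x)" "C1_map F"
    and G: "\<And>x. (g has_derivative (\<lambda>w. G x \<bullet> w)) (at x)" "C1_map G"
    using assms C2_fun_iff by metis
  have "((\<lambda>x. f x + g x) has_derivative (\<lambda>w. (F x + G x) \<bullet> w)) (at x)" for x
    by (auto intro!: derivative_eq_intros F G simp: inner_add_left)
  then show ?thesis
    unfolding C2_fun_iff using C1_map_add[OF F(2) G(2)] by (intro exI[of _ "\<lambda>x. F x + G x"]) simp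
qed

lemma C2_fun_inner_const:
  fixes c :: "'a::euclidean_space"
  shows "C2_fun (\<lambda>x. c \<bullet> x)"
  unfolding C2_fun_iff
  by (intro exI[of _ "\<lambda>x. c"] conjI allI C1_map_const) (auto intro!: derivative_eq_intros)

text \<open>The derivatives of \<open>\<phi>\<close> are required only at values of f, which admits
  the logarithm of a positive function.\<close>

lemma C2_fun_real_compose:
  fixes f :: "'a::euclidean_space \<Rightarrow> real"
  assumes f: "C2_fun f"
    and d: "\<And>x. (\<phi> has_real_derivative \<phi>' (f x)) (at (f x))"
           "\<And>x. (\<phi>' has_real_derivative \<phi>'' (f x)) (at (f x))"
    and c: "continuous_on UNIV (\<lambda>x. \<phi>'' (f x))"
  shows "C2_fun (\<lambda>x. \<phi> (f x))"
proof -
  obtain F where F: "\<And>x. (f has_derivative (\<lambda>w. F x \<bullet> w)) (at x)" "C1_map F"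
    using f C2_fun_iff by metis
  have "((\<lambda>x. \<phi> (f x)) has_derivative (\<lambda>w. (\<phi>' (f x) *\<^sub>R F x) \<bullet> w)) (at x)" for x
    using has_derivative_compose[OF F(1) d(1)[unfolded has_field_derivative_def]] by simp
  moreover have "C1_map (\<lambda>x. \<phi>' (f x))"
  proof (rule C1_mapI)
    show "((\<lambda>x. \<phi>' (f x)) has_derivative (\<lambda>w. \<phi>'' (f x) * (F x \<bullet> w))) (at x)" for x
      using has_derivative_compose[OF F(1) d(2)[unfolded has_field_derivative_def]] by simp
    show "continuous_on UNIV (\<lambda>x. \<phi>'' (f x) * (F x \<bullet> w))" for w
      by (intro continuous_intros c C1_map_continuous_on[OF F(2)])
  qed
  then have "C1_map (\<lambda>x. \<phi>' (f x) *\<^sub>R F x)"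
    by (rule C1_map_scaleR[OF _ F(2)])
  ultimately show ?thesis
    unfolding C2_fun_iff by (intro exI[of _ "\<lambda>x. \<phi>' (f x) *\<^sub>R F x"] conjI allI)
qed

lemma C2_fun_ln:
  fixes f :: "'a::euclidean_space \<Rightarrow> real"
  assumes "C2_fun f" "\<And>x. 0 < f x"
  shows "C2_fun (\<lambda>x. ln (f x))"
  using assms(2)
  by (intro C2_fun_real_compose[OF assms(1), where \<phi>' = inverse and \<phi>'' = "\<lambda>y. - (inverse y * inverse y)"])
     (auto intro!: derivative_eq_intros continuous_intros C2_fun_continuous_on[OF assms(1)]
        simp: less_imp_neq[THEN not_sym] field_simps)

lemma C2_fun_exp:
  fixes f :: "'a::euclidean_space \<Rightarrow> real"
  assumes "C2_fun f"
  shows "C2_fun (\<lambda>x. exp (f x))"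
  by (intro C2_fun_real_compose[OF assms, where \<phi>' = exp and \<phi>'' = exp])
     (auto intro!: derivative_eq_intros continuous_intros C2_fun_continuous_on[OF assms])

lemma C2_fun_scale:
  fixes f :: "'a::euclidean_space \<Rightarrow> real"
  assumes "C2_fun f"
  shows "C2_fun (\<lambda>x. c * f x)"
  by (intro C2_fun_real_compose[OF assms, where \<phi>' = "\<lambda>_. c" and \<phi>'' = "\<lambda>_. 0"])
     (auto intro!: derivative_eq_intros continuous_intros)

subsection \<open>Gradient and Hessian\<close>

lemma grad_eqI:
  assumes "(g has_derivative (\<lambda>w. G \<bullet> w)) (at \<xi>)"
  shows "grad g \<xi> = G"
  by (simp add: grad_def vec_eq_iff frechet_derivative_at[OF assms, symmetric] inner_axis)

lemma hess_eqI:
  assumes "((\<lambda>\<eta>. grad g \<eta> \<bullet> w) has_derivative D) (at \<xi>)"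
  shows "hess g \<xi> v w = D v"
  by (simp add: hess_def frechet_derivative_at[OF assms, symmetric])


lemma
  assumes "C2_fun g"
  shows C2_fun_has_grad: "(g has_derivative (\<lambda>w. grad g \<xi> \<bullet> w)) (at \<xi>)"
    and C2_fun_C1_grad: "C1_map (grad g)"
proof -
  obtain G where G: "\<And>x. (g has_derivative (\<lambda>w. G x \<bullet> w)) (at x)" "C1_map G"
    using assms C2_fun_iff[of g] by auto
  have "grad g = G"
    using grad_eqI[OF G(1)] by auto
  with G show "(g has_derivative (\<lambda>w. grad g \<xi> \<bullet> w)) (at \<xi>)" "C1_map (grad g)"
    by simp_all
qed

lemma C2_fun_grad_has_derivative:
  assumes "C2_fun g"
  obtains D where "\<And>\<xi>. (grad g has_derivative D \<xi>) (at \<xi>)"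
    "\<And>v. continuous_on UNIV (\<lambda>\<xi>. D \<xi> v)" "\<And>\<xi> v w. hess g \<xi> v w = D \<xi> v \<bullet> w"
proof -
  obtain D where D: "\<And>\<xi>. (grad g has_derivative D \<xi>) (at \<xi>)" "\<And>v. continuous_on UNIV (\<lambda>\<xi>. D \<xi> v)"
    using C2_fun_C1_grad[OF assms] C1_map_iff by metis
  moreover have "hess g \<xi> v w = D \<xi> v \<bullet> w" for \<xi> v w
    by (rule hess_eqI) (intro has_derivative_inner_left D)
  ultimately show ?thesis ..
qed

lemma C2_fun_has_hess:
  assumes "C2_fun g"
  shows "((\<lambda>\<eta>. grad g \<eta> \<bullet> w) has_derivative (\<lambda>v. hess g \<xi> v w)) (at \<xi>)"
proof -
  obtain D where D: "\<And>\<xi>. (grad g has_derivative D \<xi>) (at \<xi>)" "\<And>\<xi> v w. hess g \<xi> v w = D \<xi> v \<bullet> w"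
    using C2_fun_grad_has_derivative[OF assms] by metis
  show ?thesis
    unfolding D(2) by (intro has_derivative_inner_left D(1))
qed

lemma C2_fun_continuous_hess:
  assumes "C2_fun g"
  shows "continuous_on S (\<lambda>\<xi>. hess g \<xi> v w)"
proof -
  obtain D where D: "\<And>v. continuous_on UNIV (\<lambda>\<xi>. D \<xi> v)" "\<And>\<xi> v w. hess g \<xi> v w = D \<xi> v \<bullet> w"
    using C2_fun_grad_has_derivative[OF assms] by metis
  show ?thesis
    unfolding D(2) by (intro continuous_intros continuous_on_subset[OF D(1)]) simp
qed

text \<open>Two applications of the mean value theorem write the second difference
  \<open>g (x + s v + s w) - g (x + s v) - g (x + s w) + g x\<close> as \<open>s\<^sup>2\<close> times the mixed second derivative
  at a nearby point, in either order of the directions.\<close>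

lemma hess_second_difference:
  assumes "C2_fun g" "0 < s"
  obtains \<sigma> \<tau> where "0 < \<sigma>" "\<sigma> < s" "0 < \<tau>" "\<tau> < s"
    "g (x + s *\<^sub>R v + s *\<^sub>R w) - g (x + s *\<^sub>R v) - g (x + s *\<^sub>R w) + g x
       = s * s * hess g (x + \<sigma> *\<^sub>R v + \<tau> *\<^sub>R w) w v"
proof -
  define \<phi> where "\<phi> \<sigma> = g (x + \<sigma> *\<^sub>R v + s *\<^sub>R w) - g (x + \<sigma> *\<^sub>R v)" for \<sigma>
  define \<psi> where "\<psi> \<sigma> \<tau> = grad g (x + \<sigma> *\<^sub>R v + \<tau> *\<^sub>R w) \<bullet> v" for \<sigma> \<tau>
  have g: "((\<lambda>\<sigma>. g (x + \<sigma> *\<^sub>R v + c)) has_real_derivative grad g (x + \<sigma> *\<^sub>R v + c) \<bullet> v) (at \<sigma>)" for \<sigma> c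
  proof -
    have "((\<lambda>\<sigma>. x + \<sigma> *\<^sub>R v + c) has_derivative (\<lambda>h. h *\<^sub>R v)) (at \<sigma>)"
      by (auto intro!: derivative_eq_intros)
    from has_derivative_compose[OF this C2_fun_has_grad[OF assms(1)]]
    show ?thesis
      by (simp add: has_field_derivative_def mult.commute[of _ "_ \<bullet> _"])
  qed
  have "(\<phi> has_real_derivative \<psi> \<sigma> s - \<psi> \<sigma> 0) (at \<sigma>)" for \<sigma>
    unfolding \<phi>_def \<psi>_def using g[of "s *\<^sub>R w" \<sigma>] g[of 0 \<sigma>] by (auto intro!: derivative_eq_intros)
  then obtain \<sigma> where \<sigma>: "0 < \<sigma>" "\<sigma> < s" "\<phi> s - \<phi> 0 = s * (\<psi> \<sigma> s - \<psi> \<sigma> 0)"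
    using MVT2[of 0 s \<phi> "\<lambda>\<sigma>. \<psi> \<sigma> s - \<psi> \<sigma> 0"] \<open>0 < s\<close> by auto
  have "(\<psi> \<sigma> has_real_derivative hess g (x + \<sigma> *\<^sub>R v + \<tau> *\<^sub>R w) w v) (at \<tau>)" for \<tau>
  proof -
    have "((\<lambda>\<tau>. x + \<sigma> *\<^sub>R v + \<tau> *\<^sub>R w) has_derivative (\<lambda>h. h *\<^sub>R w)) (at \<tau>)"
      by (auto intro!: derivative_eq_intros)
    from has_derivative_compose[OF this C2_fun_has_hess[OF assms(1)]]
    have "(\<psi> \<sigma> has_derivative (\<lambda>h. hess g (x + \<sigma> *\<^sub>R v + \<tau> *\<^sub>R w) (h *\<^sub>R w) v)) (at \<tau>)"
      unfolding \<psi>_def .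
    moreover have "hess g y (h *\<^sub>R w) v = h * hess g y w v" for y h
      using C2_fun_has_hess[OF assms(1), of v y, THEN has_derivative_linear]
      by (simp add: linear_cmul[where f = "\<lambda>u. hess g y u v"])
    ultimately show ?thesis
      by (simp add: has_field_derivative_def mult.commute[of _ "hess _ _ _ _"])
  qed
  then obtain \<tau> where "0 < \<tau>" "\<tau> < s" "\<psi> \<sigma> s - \<psi> \<sigma> 0 = s * hess g (x + \<sigma> *\<^sub>R v + \<tau> *\<^sub>R w) w v"
    using MVT2[of 0 s "\<psi> \<sigma>" "\<lambda>\<tau>. hess g (x + \<sigma> *\<^sub>R v + \<tau> *\<^sub>R w) w v"] \<open>0 < s\<close> by auto
  with \<sigma> show ?thesis
    by (intro that[of \<sigma> \<tau>]) (auto simp: \<phi>_def)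
qed

text \<open>Schwarz's theorem. The second difference is symmetric in the two directions, so for
  every step size the two intermediate Hessian values coincide; the intermediate points tend to x
  and the Hessian is continuous.\<close>

lemma hess_commute:
  assumes "C2_fun g"
  shows "hess g x v w = hess g x w v"
proof -
  have lim: "((\<lambda>n. hess g (X n) v w) \<longlonglongrightarrow> hess g x v w)" if "X \<longlonglongrightarrow> x" for X v w
    using continuous_on_tendsto_compose[OF C2_fun_continuous_hess[OF assms, of UNIV] that] by simp
  define s where "s n = inverse (real (Suc n))" for n
  have s: "0 < s n" for n by (simp add: s_def)
  have s0: "s \<longlonglongrightarrow> 0"
    unfolding s_def by (rule LIMSEQ_inverse_real_of_nat)
  have "\<exists>\<sigma> \<tau> \<sigma>' \<tau>'. 0 < \<sigma> \<and> \<sigma> < s n \<and> 0 < \<tau> \<and> \<tau> < s n \<and> 0 < \<sigma>' \<and> \<sigma>' < s n \<and> 0 < \<tau>' \<and> \<tau>' < s n \<and>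
     hess g (x + \<sigma> *\<^sub>R v + \<tau> *\<^sub>R w) w v = hess g (x + \<sigma>' *\<^sub>R w + \<tau>' *\<^sub>R v) v w" for n
  proof -
    obtain \<sigma> \<tau> where 1: "0 < \<sigma>" "\<sigma> < s n" "0 < \<tau>" "\<tau> < s n"
    "g (x + s n *\<^sub>R v + s n *\<^sub>R w) - g (x + s n *\<^sub>R v) - g (x + s n *\<^sub>R w) + g x
       = s n * s n * hess g (x + \<sigma> *\<^sub>R v + \<tau> *\<^sub>R w) w v"
      using hess_second_difference[OF assms s] by blast
    obtain \<sigma>' \<tau>' where 2: "0 < \<sigma>'" "\<sigma>' < s n" "0 < \<tau>'" "\<tau>' < s n"
    "g (x + s n *\<^sub>R w + s n *\<^sub>R v) - g (x + s n *\<^sub>R w) - g (x + s n *\<^sub>R v) + g x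
       = s n * s n * hess g (x + \<sigma>' *\<^sub>R w + \<tau>' *\<^sub>R v) v w"
      using hess_second_difference[OF assms s] by blast
    have "s n * s n * hess g (x + \<sigma> *\<^sub>R v + \<tau> *\<^sub>R w) w v = s n * s n * hess g (x + \<sigma>' *\<^sub>R w + \<tau>' *\<^sub>R v) v w"
      using 1(5) 2(5) by (simp add: algebra_simps)
    then have "hess g (x + \<sigma> *\<^sub>R v + \<tau> *\<^sub>R w) w v = hess g (x + \<sigma>' *\<^sub>R w + \<tau>' *\<^sub>R v) v w"
      using s[of n] by simp
    with 1 2 show ?thesis by blast
  qed
  then obtain \<sigma> \<tau> \<sigma>' \<tau>' where *: "\<And>n. 0 < \<sigma> n \<and> \<sigma> n < s n" "\<And>n. 0 < \<tau> n \<and> \<tau> n < s n"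
     "\<And>n. 0 < \<sigma>' n \<and> \<sigma>' n < s n" "\<And>n. 0 < \<tau>' n \<and> \<tau>' n < s n"
     "\<And>n. hess g (x + \<sigma> n *\<^sub>R v + \<tau> n *\<^sub>R w) w v = hess g (x + \<sigma>' n *\<^sub>R w + \<tau>' n *\<^sub>R v) v w"
    by metis
  have z: "r \<longlonglongrightarrow> 0" if "\<And>n. 0 < r n \<and> r n < s n" for r :: "nat \<Rightarrow> real"
    by (rule tendsto_sandwich[OF _ _ tendsto_const s0]) (use that in \<open>auto intro!: always_eventually less_imp_le\<close>)
  have "(\<lambda>n. x + \<sigma> n *\<^sub>R v + \<tau> n *\<^sub>R w) \<longlonglongrightarrow> x + 0 *\<^sub>R v + 0 *\<^sub>R w"
    by (intro tendsto_intros z * )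
  moreover have "(\<lambda>n. x + \<sigma>' n *\<^sub>R w + \<tau>' n *\<^sub>R v) \<longlonglongrightarrow> x + 0 *\<^sub>R w + 0 *\<^sub>R v"
    by (intro tendsto_intros z * )
  ultimately have "(\<lambda>n. hess g (x + \<sigma> n *\<^sub>R v + \<tau> n *\<^sub>R w) w v) \<longlonglongrightarrow> hess g x w v"
    "(\<lambda>n. hess g (x + \<sigma>' n *\<^sub>R w + \<tau>' n *\<^sub>R v) v w) \<longlonglongrightarrow> hess g x v w"
    using lim by auto
  then show ?thesis
    using LIMSEQ_unique by (simp add: *(5))
qed

section \<open>Gradient and Hessian under linear changes of variables and linear corrections\<close>

lemma grad_compose_linear:
  fixes L :: "real^'m::finite \<Rightarrow> real^'n::finite"
  assumes "C2_fun g" "linear L"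
  shows "grad (\<lambda>x. g (L x)) x \<bullet> v = grad g (L x) \<bullet> L v"
proof -
  have "((\<lambda>x. g (L x)) has_derivative (\<lambda>w. grad g (L x) \<bullet> L w)) (at x)"
    by (rule has_derivative_compose[OF bounded_linear_imp_has_derivative C2_fun_has_grad[OF assms(1)]])
       (rule linear_conv_bounded_linear[THEN iffD1, OF assms(2)])
  moreover have "((\<lambda>x. g (L x)) has_derivative (\<lambda>w. grad (\<lambda>x. g (L x)) x \<bullet> w)) (at x)"
    by (rule C2_fun_has_grad[OF C2_fun_compose_linear[OF assms]])
  ultimately have "(\<lambda>w. grad g (L x) \<bullet> L w) = (\<lambda>w. grad (\<lambda>x. g (L x)) x \<bullet> w)"
    by (rule has_derivative_unique)
  from fun_cong[OF this] show ?thesis by simp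
qed

lemma hess_compose_linear:
  fixes L :: "real^'m::finite \<Rightarrow> real^'n::finite"
  assumes "C2_fun g" "linear L"
  shows "hess (\<lambda>x. g (L x)) x v w = hess g (L x) (L v) (L w)"
proof (rule hess_eqI)
  show "((\<lambda>\<eta>. grad (\<lambda>x. g (L x)) \<eta> \<bullet> w) has_derivative (\<lambda>v. hess g (L x) (L v) (L w))) (at x)"
    unfolding grad_compose_linear[OF assms]
    by (rule has_derivative_compose[OF bounded_linear_imp_has_derivative C2_fun_has_hess[OF assms(1)]])
       (rule linear_conv_bounded_linear[THEN iffD1, OF assms(2)])
qed

lemma grad_add_inner:
  assumes "C2_fun g"
  shows "grad (\<lambda>x. g x + c \<bullet> x) \<xi> = grad g \<xi> + c"
  by (rule grad_eqI) (auto intro!: derivative_eq_intros C2_fun_has_grad assms simp: inner_add_left)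

lemma hess_add_inner:
  assumes "C2_fun g"
  shows "hess (\<lambda>x. g x + c \<bullet> x) \<xi> = hess g \<xi>"
proof (intro ext hess_eqI)
  show "((\<lambda>\<eta>. grad (\<lambda>x. g x + c \<bullet> x) \<eta> \<bullet> w) has_derivative (\<lambda>v. hess g \<xi> v w)) (at \<xi>)" for w
    using has_derivative_add_const[OF C2_fun_has_hess[OF assms, of w]]
    by (simp add: grad_add_inner[OF assms] inner_add_left)
qed

section \<open>Limits at the boundary of the positive orthant\<close>

definition vexp :: "real^'n \<Rightarrow> real^'n::finite" where
  "vexp t = (\<chi> i. exp (t $ i))"

definition vabs :: "complex^'n \<Rightarrow> real^'n::finite" where
  "vabs z = (\<chi> i. cmod (z $ i))"

definition vln :: "real^'n \<Rightarrow> real^'n::finite" where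
  "vln r = (\<chi> i. ln (r $ i))"

lemma vexp_nth [simp]: "vexp t $ i = exp (t $ i)"
  and vabs_nth [simp]: "vabs z $ i = cmod (z $ i)"
  and vln_nth [simp]: "vln r $ i = ln (r $ i)"
  by (simp_all add: vexp_def vabs_def vln_def)

lemma vln_vexp [simp]: "vln (vexp t) = t"
  by (simp add: vec_eq_iff)

lemma vexp_vln: "(\<And>i. 0 < r $ i) \<Longrightarrow> vexp (vln r) = r"
  by (simp add: vec_eq_iff)

lemma continuous_vabs [continuous_intros]: "continuous_on S vabs"
  unfolding vabs_def by (intro continuous_intros)

lemma boundary_filter_eq: "boundary_filter p = filtercomap vexp (nhds p)"
  by (simp add: boundary_filter_def vexp_def[abs_def])

lemma tendsto_vexp_boundary: "(vexp \<longlongrightarrow> p) (boundary_filter p)"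
  unfolding boundary_filter_eq by (rule filterlim_filtercomap)

lemma eventually_boundary_iff:
  "eventually P (boundary_filter p) \<longleftrightarrow> (\<exists>d>0. \<forall>t. dist (vexp t) p < d \<longrightarrow> P t)"
proof
  assume "eventually P (boundary_filter p)"
  then show "\<exists>d>0. \<forall>t. dist (vexp t) p < d \<longrightarrow> P t"
    unfolding boundary_filter_eq eventually_filtercomap eventually_nhds_metric by metis
next
  assume "\<exists>d>0. \<forall>t. dist (vexp t) p < d \<longrightarrow> P t"
  then obtain d where "0 < d" "\<forall>t. dist (vexp t) p < d \<longrightarrow> P t"
    by blast
  then show "eventually P (boundary_filter p)"
    unfolding boundary_filter_eq eventually_filtercomap eventually_nhds_metric
    by (intro exI[of _ "\<lambda>r. dist r p < d"]) auto
qed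

lemma tendsto_boundary_iff:
  fixes f :: "real^'n::finite \<Rightarrow> 'b::metric_space"
  shows "(f \<longlongrightarrow> c) (boundary_filter p) \<longleftrightarrow>
    (\<forall>e>0. \<exists>d>0. \<forall>t. dist (vexp t) p < d \<longrightarrow> dist (f t) c < e)"
  unfolding tendsto_iff eventually_boundary_iff ..

text \<open>The closed orthant is the closure of the open one, which is the range of
  \<open>vexp\<close>: adding a small s > 0 to all coordinates moves p inside. This makes the
  boundary filter nontrivial.\<close>

lemma positive_in_every_neighbourhood:
  fixes p :: "real^'n::finite"
  assumes "\<And>i. 0 \<le> p $ i" "0 < d"
  obtains t where "dist (vexp t) p < d"
proof -
  define r where "r s = (\<chi> i. p $ i + s)" for s :: real
  have "(r \<longlongrightarrow> (\<chi> i. p $ i + 0)) (at_right 0)"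
    unfolding r_def by (intro tendsto_intros)
  then have "\<forall>\<^sub>F s in at_right 0. dist (r s) p < d"
    using assms(2) by (simp add: tendsto_iff)
  moreover have "\<forall>\<^sub>F s in at_right (0::real). 0 < s"
    by (simp add: eventually_at_right_less)
  ultimately have "\<forall>\<^sub>F s in at_right 0. dist (r s) p < d \<and> 0 < s"
    by (rule eventually_conj)
  then obtain s where "dist (r s) p < d" "0 < s"
    using eventually_happens'[OF trivial_limit_at_right_real] by blast
  moreover have "vexp (vln (r s)) = r s"
    using assms(1) \<open>0 < s\<close> by (intro vexp_vln) (auto simp: r_def add_nonneg_pos)
  ultimately show ?thesis
    using that by metis
qed

lemma boundary_filter_neq_bot:
  fixes p :: "real^'n::finite"
  assumes "\<And>i. 0 \<le> p $ i"
  shows "boundary_filter p \<noteq> bot"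
proof
  assume "boundary_filter p = bot"
  then have "eventually (\<lambda>_. False) (boundary_filter p)" by simp
  then show False
    unfolding eventually_boundary_iff using positive_in_every_neighbourhood[OF assms] by metis
qed

text \<open>\<open>vln\<close> is a continuous inverse of \<open>vexp\<close> near an interior
  point, so ordinary limits in t carry over to the boundary filter there.\<close>

lemma boundary_filter_vexp: "boundary_filter (vexp t) \<le> nhds t"
proof -
  have "((\<lambda>s. vln (vexp s)) \<longlongrightarrow> vln (vexp t)) (boundary_filter (vexp t))"
    unfolding vln_def by (intro tendsto_intros tendsto_vexp_boundary) simp
  then show ?thesis
    by (simp add: filterlim_def filtermap_ident)
qed

lemma isCont_tendsto_boundary:
  assumes "isCont f t"
  shows "(f \<longlongrightarrow> f t) (boundary_filter (vexp t))"
  using assms boundary_filter_vexp unfolding isCont_def tendsto_at_iff_tendsto_nhds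
  by (rule tendsto_mono[rotated])

definition boundary_convergent :: "(real^'n::finite \<Rightarrow> real) \<Rightarrow> bool" where
  "boundary_convergent f \<longleftrightarrow> (\<forall>p. (\<forall>i. 0 \<le> p $ i) \<longrightarrow> (\<exists>c. (f \<longlongrightarrow> c) (boundary_filter p)))"

text \<open>For continuous f that is \<open>boundary_convergent\<close>, this is the continuous
  extension to the closed orthant of f written in the coordinates r = \<open>vexp\<close> t.\<close>

definition boundary_ext :: "(real^'n::finite \<Rightarrow> real) \<Rightarrow> real^'n \<Rightarrow> real" where
  "boundary_ext f p = Lim (boundary_filter p) f"

lemma boundary_ext_eqI:
  assumes "(f \<longlongrightarrow> c) (boundary_filter p)" "\<And>i. 0 \<le> p $ i"
  shows "boundary_ext f p = c"
  unfolding boundary_ext_def by (rule tendsto_Lim[OF boundary_filter_neq_bot[OF assms(2)] assms(1)])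

lemma boundary_ext_tendsto:
  assumes "boundary_convergent f" "\<And>i. 0 \<le> p $ i"
  shows "(f \<longlongrightarrow> boundary_ext f p) (boundary_filter p)"
  using assms boundary_ext_eqI unfolding boundary_convergent_def by metis

lemma boundary_ext_vexp:
  assumes "isCont f t"
  shows "boundary_ext f (vexp t) = f t"
  by (rule boundary_ext_eqI[OF isCont_tendsto_boundary[OF assms]]) simp

text \<open>For q near p there is a sample point t close to q and still near p, and f t lies within
  e / 2 of both limit values.\<close>

lemma continuous_on_boundary_ext:
  assumes f: "boundary_convergent f"
  shows "continuous_on {p. \<forall>i. 0 \<le> p $ i} (boundary_ext f)"
  unfolding continuous_on_iff
proof (intro ballI allI impI)
  fix p :: "real^'a" and e :: real
  assume p: "p \<in> {p. \<forall>i. 0 \<le> p $ i}" and e: "0 < e"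
  then obtain d where d: "0 < d" "\<And>t. dist (vexp t) p < d \<Longrightarrow> dist (f t) (boundary_ext f p) < e / 2"
    using boundary_ext_tendsto[OF f, of p] unfolding tendsto_boundary_iff
    by (metis half_gt_zero mem_Collect_eq)
  have "dist (boundary_ext f q) (boundary_ext f p) < e" if q: "\<And>i. 0 \<le> q $ i" "dist q p < d" for q
  proof -
    obtain d' where d': "0 < d'" "\<And>t. dist (vexp t) q < d' \<Longrightarrow> dist (f t) (boundary_ext f q) < e / 2"
      using boundary_ext_tendsto[OF f q(1)] e unfolding tendsto_boundary_iff by (metis half_gt_zero)
    obtain t where t: "dist (vexp t) q < min d' (d - dist q p)"
      using positive_in_every_neighbourhood[OF q(1), of "min d' (d - dist q p)"] d'(1) q(2) by auto
    have "dist (vexp t) p < d"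
      using t dist_triangle[of "vexp t" p q] by auto
    then have "dist (f t) (boundary_ext f p) < e / 2"
      by (rule d)
    moreover have "dist (f t) (boundary_ext f q) < e / 2"
      using t by (intro d') auto
    ultimately show ?thesis
      by (metis dist_commute dist_triangle_half_r)
  qed
  with d(1) show "\<exists>d>0. \<forall>q\<in>{p. \<forall>i. 0 \<le> p $ i}. dist q p < d \<longrightarrow>
      dist (boundary_ext f q) (boundary_ext f p) < e"
    by blast
qed

lemma continuous_on_boundary_ext_vabs:
  assumes "boundary_convergent f"
  shows "continuous_on UNIV (\<lambda>z. boundary_ext f (vabs z))"
  by (rule continuous_on_compose2[OF continuous_on_boundary_ext[OF assms] continuous_vabs]) auto

text \<open>In the coordinates \<open>r = vexp t\<close> the hypothesis bounds the partial derivatives of \<open>f\<close> near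
  \<open>p\<close>, so that \<open>f\<close> is Lipschitz there.\<close>

lemma boundary_limit_if_bounded_derivative:
  fixes f :: "real^'n::finite \<Rightarrow> real"
  assumes f: "\<And>t. (f has_derivative (\<lambda>h. \<Sum>k\<in>UNIV. D k t * h $ k)) (at t)"
    and p: "\<And>i. 0 \<le> p $ i"
    and B: "\<And>k. \<forall>\<^sub>F t in boundary_filter p. \<bar>exp (- t $ k) * D k t\<bar> \<le> B k"
  shows "\<exists>c. (f \<longlongrightarrow> c) (boundary_filter p)"
proof (cases "\<forall>i. 0 < p $ i")
  case True
  then have "vexp (vln p) = p"
    by (intro vexp_vln) auto
  moreover have "isCont f (vln p)"
    using f has_derivative_continuous by blast
  ultimately show ?thesis
    using isCont_tendsto_boundary by metis
next
  \<comment> \<open>Now p is not in the range of \<open>vexp\<close>, so the punctured limit at p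
    within S sees every point that the boundary filter sees.\<close>
  case False
  have "\<forall>\<^sub>F t in boundary_filter p. \<forall>k\<in>UNIV. \<bar>exp (- t $ k) * D k t\<bar> \<le> B k"
    using B by (intro eventually_ball_finite) auto
  then obtain d where d: "0 < d" "\<And>t k. dist (vexp t) p < d \<Longrightarrow> \<bar>exp (- t $ k) * D k t\<bar> \<le> B k"
    unfolding eventually_boundary_iff by auto
  define S where "S = ball p d \<inter> {r. \<forall>i. 0 < r $ i}"
  define F' where "F' r h = (\<Sum>k\<in>UNIV. D k (vln r) * (h $ k / r $ k))" for r h
  have F': "((\<lambda>r. f (vln r)) has_derivative F' r) (at r within S)" if "r \<in> S" for r
  proof -
    have "(vln has_derivative (\<lambda>h. \<chi> i. h $ i / r $ i)) (at r within S)"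
      unfolding vln_def using that
      by (subst has_derivative_componentwise_within)
        (auto simp: Basis_vec_def inner_axis S_def divide_inverse
          intro!: derivative_eq_intros bounded_linear_imp_has_derivative bounded_linear_vec_nth)
    from has_derivative_compose[OF this f]
    show ?thesis
      by (simp add: F'_def[abs_def])
  qed
  define C where "C = (\<Sum>k\<in>UNIV. B k)"
  have onorm: "onorm (F' r) \<le> C" if r: "r \<in> S" for r
  proof (rule onorm_le)
    fix h
    have r': "vexp (vln r) = r" and rd: "dist (vexp (vln r)) p < d"
      using r vexp_vln[of r] by (auto simp: S_def dist_commute)
    have "norm (F' r h) \<le> (\<Sum>k\<in>UNIV. \<bar>D k (vln r) * (h $ k / r $ k)\<bar>)"
      unfolding F'_def real_norm_def by (rule sum_abs)
    also have "\<dots> \<le> (\<Sum>k\<in>UNIV. B k * norm h)"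
    proof (rule sum_mono)
      fix k
      have "exp (- vln r $ k) = 1 / r $ k"
        using r' by (metis exp_minus inverse_eq_divide vexp_nth)
      then have "\<bar>D k (vln r) * (h $ k / r $ k)\<bar> = \<bar>exp (- vln r $ k) * D k (vln r)\<bar> * \<bar>h $ k\<bar>"
        by (simp add: abs_mult)
      also have "\<dots> \<le> B k * norm h"
        by (intro mult_mono d rd component_le_norm_cart) (auto intro: order_trans[OF abs_ge_zero d(2)[OF rd]])
      finally show "\<bar>D k (vln r) * (h $ k / r $ k)\<bar> \<le> B k * norm h" .
    qed
    finally show "norm (F' r h) \<le> C * norm h"
      by (simp add: C_def sum_distrib_right)
  qed
  have "{r :: real^'n. \<forall>i. 0 < r $ i} = (\<Inter>i. {r. axis i 1 \<bullet> r > 0})"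
    by (auto simp: inner_axis')
  then have conv: "convex S"
    unfolding S_def by (auto intro!: convex_Int convex_INT convex_halfspace_gt)
  have "dist (f (vln x)) (f (vln y)) \<le> \<bar>C\<bar> * dist x y" if "x \<in> S" "y \<in> S" for x y
  proof -
    have "norm (f (vln x) - f (vln y)) \<le> C * norm (x - y)"
      by (rule differentiable_bound[OF conv F' onorm that]) auto
    also have "\<dots> \<le> \<bar>C\<bar> * norm (x - y)"
      by (intro mult_right_mono) auto
    finally show ?thesis
      by (simp add: dist_norm)
  qed
  then have "\<bar>C\<bar>-lipschitz_on S (\<lambda>r. f (vln r))"
    by (intro lipschitz_onI) auto
  \<comment> \<open>Uniform continuity is what produces a limit at the closure point p; boundedness
    of f alone would not.\<close>
  then have uc: "uniformly_continuous_on S (\<lambda>r. f (vln r))"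
    by (rule lipschitz_on_uniformly_continuous)
  have "p \<in> closure S"
    unfolding closure_approachable
  proof (intro allI impI)
    fix e :: real assume "0 < e"
    then obtain t where "dist (vexp t) p < min d e"
      using positive_in_every_neighbourhood[OF p, of "min d e"] d(1) by auto
    then show "\<exists>y\<in>S. dist y p < e"
      by (intro bexI[of _ "vexp t"]) (auto simp: S_def dist_commute)
  qed
  then obtain l where l: "((\<lambda>r. f (vln r)) \<longlongrightarrow> l) (at p within S)"
    using uniformly_continuous_on_extension_at_closure[OF uc] by blast
  have "(f \<longlongrightarrow> l) (boundary_filter p)"
    unfolding tendsto_boundary_iff
  proof (intro allI impI)
    fix e :: real assume "0 < e"
    then obtain d' where d': "0 < d'" "\<And>r. r \<in> S \<Longrightarrow> 0 < dist r p \<Longrightarrow> dist r p < d' \<Longrightarrow> dist (f (vln r)) l < e"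
      using l unfolding tendsto_iff eventually_at zero_less_dist_iff by meson
    have "dist (f t) l < e" if t: "dist (vexp t) p < min d d'" for t
    proof -
      have "vexp t \<in> S" "vexp t \<noteq> p"
        using t False by (auto simp: S_def dist_commute)
      with t d'(2)[of "vexp t"] show ?thesis
        by (simp add: dist_pos_lt)
    qed
    then show "\<exists>d>0. \<forall>t. dist (vexp t) p < d \<longrightarrow> dist (f t) l < e"
      using d(1) d'(1) by (intro exI[of _ "min d d'"]) auto
  qed
  then show ?thesis ..
qed

section \<open>Derivatives across the coordinate hyperplanes\<close>

lemma approach_off_hyperplanes:
  fixes z :: "complex^'n::finite"
  obtains Y :: "real \<Rightarrow> complex^'n"
    where "(Y \<longlongrightarrow> z) (at_right 0)" "\<forall>s>0. \<forall>j. Y s $ j \<noteq> 0"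
proof -
  define Y where "Y s = (\<chi> j. if z $ j = 0 then complex_of_real s else z $ j)" for s :: real
  have "(Y \<longlongrightarrow> (\<chi> j. if z $ j = 0 then of_real 0 else z $ j)) (at_right 0)"
    unfolding Y_def by (intro tendsto_vec_lambda) (auto intro!: tendsto_eq_intros)
  moreover have "(\<chi> j. if z $ j = 0 then of_real 0 else z $ j) = z"
    by (simp add: vec_eq_iff)
  ultimately have "(Y \<longlongrightarrow> z) (at_right 0)"
    by simp
  then show ?thesis
    by (rule that) (simp add: Y_def)
qed

text \<open>Continuity of D keeps \<open>D z\<close> close to \<open>D z\<^sub>0\<close> near
  \<open>z\<^sub>0\<close>. Integrating the difference along segments from \<open>z\<^sub>0\<close>
  gives the required estimate, first for end points off the hyperplanes.\<close>

lemma has_derivative_across_hyperplanes: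
  fixes N :: "complex^'n::finite \<Rightarrow> 'b::euclidean_space"
  assumes N: "continuous_on UNIV N"
    and N': "\<And>z. (\<forall>j. z $ j \<noteq> 0) \<Longrightarrow> (N has_derivative D z) (at z)"
    and D: "\<And>z. linear (D z)" "\<And>w. continuous_on UNIV (\<lambda>z. D z w)"
  shows "(N has_derivative D z\<^sub>0) (at z\<^sub>0)"
proof -
  have bl: "bounded_linear (D z)" for z
    using D(1) linear_conv_bounded_linear by blast
  define L where "L z = Blinfun (D z)" for z
  have L: "blinfun_apply (L z) = D z" for z
    by (simp add: L_def bounded_linear_Blinfun_apply bl)
  have contL: "continuous_on UNIV L"
    by (rule continuous_on_blinfun_componentwise) (simp add: L D)
  show ?thesis
    unfolding has_derivative_at_alt
  proof (intro conjI bl allI impI)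
    fix e :: real assume "0 < e"
    then obtain d where d: "0 < d" "\<And>z. dist z z\<^sub>0 < d \<Longrightarrow> dist (L z) (L z\<^sub>0) < e"
      using contL unfolding continuous_on_iff by (metis UNIV_I)
    define M where "M z = N z - D z\<^sub>0 z" for z
    have contM: "continuous_on S M" for S
      unfolding M_def
      by (rule continuous_on_diff[OF continuous_on_subset[OF N] linear_continuous_on[OF bl]]) simp
    have generic: "norm (M y - M z\<^sub>0) \<le> e * norm (y - z\<^sub>0)" if y: "\<forall>j. y $ j \<noteq> 0" "dist y z\<^sub>0 < d" for y
    proof -
      define x where "x s = z\<^sub>0 + s *\<^sub>R (y - z\<^sub>0)" for s :: real
      define B where "B = (\<Union>j. {s. x s $ j = 0})"
      \<comment> \<open>An affine function of s that is nonzero at s = 1 has at most one zero, so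
        the segment to y meets each hyperplane at most once. The fundamental theorem of calculus
        tolerates finitely many exceptional points.\<close>
      have "finite {s. x s $ j = 0}" for j
      proof -
        have "s = t" if "x s $ j = 0" "x t $ j = 0" for s t
        proof -
          have "x s $ j - x t $ j = (s - t) *\<^sub>R (y - z\<^sub>0) $ j"
            by (simp add: x_def algebra_simps)
          moreover have "(y - z\<^sub>0) $ j \<noteq> 0"
            using that(1) y(1) by (auto simp: x_def)
          ultimately show ?thesis
            using that by simp
        qed
        then have "{s. x s $ j = 0} = {} \<or> (\<exists>s. {s. x s $ j = 0} = {s})"
          by blast
        then show ?thesis
          by (metis finite.emptyI finite.insertI)
      qed
      then have finB: "finite B"
        unfolding B_def by (intro finite_UN_I) auto
      define D' where "D' s = (D (x s) - D z\<^sub>0) (y - z\<^sub>0)" for s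
      have xd: "(x has_vector_derivative (y - z\<^sub>0)) (at s)" for s
        unfolding x_def by (auto intro!: derivative_eq_intros)
      have "((\<lambda>s. M (x s)) has_vector_derivative D' s) (at s)" if "s \<in> {0<..<1} - B" for s
      proof -
        have "(N has_derivative D (x s)) (at (x s))"
          using that by (intro N') (auto simp: B_def)
        then have "(M has_derivative (\<lambda>h. D (x s) h - D z\<^sub>0 h)) (at (x s))"
          unfolding M_def by (rule has_derivative_diff[OF _ bounded_linear_imp_has_derivative[OF bl]])
        from has_derivative_compose[OF xd[unfolded has_vector_derivative_def] this]
        show ?thesis
          unfolding has_vector_derivative_def D'_def
          by (simp add: linear_cmul[OF D(1)] linear_diff[OF D(1)] algebra_simps)
      qed
      moreover have "continuous_on {0..1} (\<lambda>s. M (x s))"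
        unfolding x_def by (rule continuous_on_compose2[OF contM[of UNIV]]) (auto intro!: continuous_intros)
      ultimately have "(D' has_integral (M (x 1) - M (x 0))) {0..1}"
        using finB by (intro fundamental_theorem_of_calculus_interior_strong) auto
      moreover have "norm (D' s) \<le> e * norm (y - z\<^sub>0)" if "s \<in> {0..1}" for s
      proof -
        have "dist (x s) z\<^sub>0 = s * dist y z\<^sub>0"
          using that by (simp add: x_def dist_norm)
        also have "\<dots> \<le> 1 * dist y z\<^sub>0"
          using that by (intro mult_right_mono) auto
        finally have "norm (L (x s) - L z\<^sub>0) \<le> e"
          using y(2) d(2)[of "x s"] by (simp add: dist_norm)
        then have "norm (blinfun_apply (L (x s) - L z\<^sub>0) (y - z\<^sub>0)) \<le> e * norm (y - z\<^sub>0)"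
          by (meson norm_blinfun mult_right_mono norm_ge_zero order_trans)
        then show ?thesis
          by (simp add: D'_def L blinfun.diff_left)
      qed
      ultimately have "norm (M (x 1) - M (x 0)) \<le> e * norm (y - z\<^sub>0) * measure lborel (cbox 0 (1::real))"
        using \<open>0 < e\<close> by (intro has_integral_bound[where f = D']) auto
      then show ?thesis
        by (simp add: x_def)
    qed
    \<comment> \<open>End points on the hyperplanes follow by continuity, approaching them from
      outside.\<close>
    have "norm (M y - M z\<^sub>0) \<le> e * norm (y - z\<^sub>0)" if y: "dist y z\<^sub>0 < d" for y
    proof -
      obtain Y :: "real \<Rightarrow> complex^'n" where Y: "(Y \<longlongrightarrow> y) (at_right 0)" and nz: "\<forall>s>0. \<forall>j. Y s $ j \<noteq> 0"
        using approach_off_hyperplanes[of y] .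
      have "((\<lambda>s. M (Y s)) \<longlongrightarrow> M y) (at_right 0)"
        using continuous_on_tendsto_compose[OF contM[of UNIV] Y] by simp
      then have lim1: "((\<lambda>s. norm (M (Y s) - M z\<^sub>0)) \<longlongrightarrow> norm (M y - M z\<^sub>0)) (at_right 0)"
        by (intro tendsto_intros)
      have lim2: "((\<lambda>s. e * norm (Y s - z\<^sub>0)) \<longlongrightarrow> e * norm (y - z\<^sub>0)) (at_right 0)"
        by (intro tendsto_intros Y)
      have "\<forall>\<^sub>F s in at_right 0. dist (Y s) z\<^sub>0 < d"
        using tendsto_dist[OF Y tendsto_const, of z\<^sub>0] y by (rule order_tendstoD)
      moreover have "\<forall>\<^sub>F s in at_right (0::real). 0 < s"
        by (simp add: eventually_at_right_less)
      ultimately have "\<forall>\<^sub>F s in at_right 0. norm (M (Y s) - M z\<^sub>0) \<le> e * norm (Y s - z\<^sub>0)"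
        by eventually_elim (rule generic, auto simp: nz)
      from tendsto_le[OF _ lim2 lim1 this] show ?thesis
        by simp
    qed
    then have "norm (N y - N z\<^sub>0 - D z\<^sub>0 (y - z\<^sub>0)) \<le> e * norm (y - z\<^sub>0)" if "norm (y - z\<^sub>0) < d" for y
      using that by (simp add: M_def dist_norm linear_diff[OF D(1)] algebra_simps)
    then show "\<exists>d>0. \<forall>y. norm (y - z\<^sub>0) < d \<longrightarrow> norm (N y - N z\<^sub>0 - D z\<^sub>0 (y - z\<^sub>0)) \<le> e * norm (y - z\<^sub>0)"
      using d(1) by blast
  qed
qed

section \<open>The local model of the growth conditions\<close>

text \<open>The growth condition in one chart, after the linear change of variables
  \<open>cone_point\<close> and after adding the linear function that absorbs the numbers a_j; see
  \<open>growth_condition_iff\<close>.\<close>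

definition boundary_growth :: "(real^'n::finite \<Rightarrow> real) \<Rightarrow> bool" where
  "boundary_growth G \<longleftrightarrow>
    (\<forall>j p. (\<forall>i. 0 \<le> p $ i) \<and> p $ j = 0 \<longrightarrow>
      (\<exists>c. ((\<lambda>t. 2 * exp (- 2 * t $ j) * (grad G t $ j)) \<longlongrightarrow> c) (boundary_filter p) \<and>
           ((\<lambda>t. exp (- 2 * t $ j) * hess G t (axis j 1) (axis j 1)) \<longlongrightarrow> c) (boundary_filter p))) \<and>
    (\<forall>j k l p. (\<forall>i. 0 \<le> p $ i) \<and> p $ l = 0 \<longrightarrow>
      (\<exists>c. ((\<lambda>t. hess G t (axis j 1) (axis k 1)) \<longlongrightarrow> c) (boundary_filter p))) \<and>
    (\<forall>j k p. j \<noteq> k \<and> (\<forall>i. 0 \<le> p $ i) \<and> (p $ j = 0 \<or> p $ k = 0) \<longrightarrow>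
      ((\<lambda>t. exp (- t $ j - t $ k) * hess G t (axis j 1) (axis k 1)) \<longlongrightarrow> 0) (boundary_filter p))"

lemma has_derivative_grad_sum:
  assumes "C2_fun G"
  shows "(G has_derivative (\<lambda>h. \<Sum>k\<in>UNIV. grad G t $ k * h $ k)) (at t)"
  using C2_fun_has_grad[OF assms] by (simp add: inner_vec_def)

lemma has_derivative_hess_sum:
  assumes "C2_fun G"
  shows "((\<lambda>t. grad G t $ j) has_derivative
    (\<lambda>h. \<Sum>k\<in>UNIV. hess G t (axis k 1) (axis j 1) * h $ k)) (at t)"
proof -
  have d: "((\<lambda>t. grad G t \<bullet> axis j 1) has_derivative (\<lambda>h. hess G t h (axis j 1))) (at t)"
    by (rule C2_fun_has_hess[OF assms])
  then have lin: "linear (\<lambda>h. hess G t h (axis j 1))"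
    by (rule has_derivative_linear)
  have "hess G t h (axis j 1) = (\<Sum>k\<in>UNIV. hess G t (axis k 1) (axis j 1) * h $ k)" for h
  proof -
    have "hess G t h (axis j 1) = hess G t (\<Sum>k\<in>UNIV. h $ k *\<^sub>R axis k 1) (axis j 1)"
      using basis_expansion[of h] by (simp add: scalar_mult_eq_scaleR)
    also have "\<dots> = (\<Sum>k\<in>UNIV. hess G t (axis k 1) (axis j 1) * h $ k)"
      using linear_sum[OF lin, of "\<lambda>k. h $ k *\<^sub>R axis k 1" UNIV]
      by (simp add: linear_cmul[OF lin] mult.commute)
    finally show ?thesis .
  qed
  then have "(\<lambda>h. hess G t h (axis j 1)) = (\<lambda>h. \<Sum>k\<in>UNIV. hess G t (axis k 1) (axis j 1) * h $ k)"
    by (rule ext)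
  moreover have "(\<lambda>t. grad G t \<bullet> axis j 1) = (\<lambda>t. grad G t $ j)"
    by (simp add: inner_axis)
  ultimately show ?thesis
    using d by (simp only:)
qed

text \<open>The weighted function is the partial derivative in r_k = exp t_k. Having a limit, it is
  bounded near p, as the Lipschitz argument demands.\<close>

lemma boundary_convergent_if_derivative:
  assumes f: "\<And>t. (f has_derivative (\<lambda>h. \<Sum>k\<in>UNIV. D k t * h $ k)) (at t)"
    and D: "\<And>k. boundary_convergent (\<lambda>t. exp (- t $ k) * D k t)"
  shows "boundary_convergent f"
  unfolding boundary_convergent_def
proof (intro allI impI)
  fix p :: "real^'a" assume p: "\<forall>i. 0 \<le> p $ i"
  have "\<exists>c. ((\<lambda>t. exp (- t $ k) * D k t) \<longlongrightarrow> c) (boundary_filter p)" for k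
    using D[of k] p unfolding boundary_convergent_def by blast
  then have "\<forall>k. \<exists>c. ((\<lambda>t. exp (- t $ k) * D k t) \<longlongrightarrow> c) (boundary_filter p)"
    by blast
  from choice[OF this] obtain c where c: "\<And>k. ((\<lambda>t. exp (- t $ k) * D k t) \<longlongrightarrow> c k) (boundary_filter p)"
    by blast
  have "\<forall>\<^sub>F t in boundary_filter p. \<bar>exp (- t $ k) * D k t\<bar> \<le> \<bar>c k\<bar> + 1" for k
    using order_tendstoD(2)[OF tendsto_rabs[OF c], of k "\<bar>c k\<bar> + 1"]
    by (auto elim: eventually_mono)
  with p show "\<exists>c. (f \<longlongrightarrow> c) (boundary_filter p)"
    using boundary_limit_if_bounded_derivative[OF f, of p "\<lambda>k. \<bar>c k\<bar> + 1"] by blast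
qed

lemma tendsto_exp_nth_boundary: "((\<lambda>t. exp (t $ k)) \<longlongrightarrow> p $ k) (boundary_filter p)"
  using tendsto_vec_nth[OF tendsto_vexp_boundary, of k p] by simp

lemma tendsto_exp_minus_nth_boundary:
  assumes "p $ k \<noteq> 0"
  shows "((\<lambda>t. exp (- t $ k)) \<longlongrightarrow> inverse (p $ k)) (boundary_filter p)"
  unfolding exp_minus by (intro tendsto_intros tendsto_exp_nth_boundary assms)

lemma exp_minus2_eq: "exp (- 2 * t $ j) = exp (- t $ j) * exp (- (t::real^'n) $ j)"
  by (simp flip: exp_add)

lemma boundary_limit_interior:
  fixes f :: "real^'n::finite \<Rightarrow> real"
  assumes "continuous_on UNIV f" "\<And>i. 0 < p $ i"
  shows "(f \<longlongrightarrow> f (vln p)) (boundary_filter p)"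
proof -
  have "isCont f (vln p)"
    using assms(1) by (simp add: continuous_on_eq_continuous_at)
  then show ?thesis
    using isCont_tendsto_boundary[where t = "vln p" and f = f] vexp_vln[OF assms(2)] by simp
qed

text \<open>In the coordinates r, A_j is F_j / r_j, and K_kj is F_kj minus, on the diagonal, F_j /
  r_j. Limits are obtained in turn for H_kj, exp (- t_k) H_kj, the gradient, A, G and K; convergence
  of the weighted derivatives yields that of the gradient and of G.\<close>

lemma boundary_growth_limits:
  fixes G :: "real^'n::finite \<Rightarrow> real"
  assumes G: "C2_fun G" and growth: "boundary_growth G"
  defines "H \<equiv> \<lambda>k j t. hess G t (axis k 1) (axis j 1)"
  defines "A \<equiv> \<lambda>j t. exp (- 2 * t $ j) * (grad G t $ j)"
  defines "K \<equiv> \<lambda>k j t. exp (- t $ k - t $ j) * H k j t - (if k = j then 2 * A j t else 0)"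
  shows "boundary_convergent G"
    and "boundary_convergent (A j)"
    and "boundary_convergent (K k j)"
    and "\<lbrakk>\<And>i. 0 \<le> p $ i; p $ k = 0 \<or> p $ j = 0\<rbrakk> \<Longrightarrow> (K k j \<longlongrightarrow> 0) (boundary_filter p)"
proof -
  have growth1: "\<exists>c. ((\<lambda>t. 2 * A j t) \<longlongrightarrow> c) (boundary_filter p) \<and>
      ((\<lambda>t. exp (- 2 * t $ j) * H j j t) \<longlongrightarrow> c) (boundary_filter p)"
    if "\<forall>i. 0 \<le> p $ i" "p $ j = 0" for j p
    using growth[unfolded boundary_growth_def, THEN conjunct1, rule_format, of p j] that
    by (simp add: A_def H_def mult.assoc)
  have growth2: "\<exists>c. (H k j \<longlongrightarrow> c) (boundary_filter p)" if "\<forall>i. 0 \<le> p $ i" "p $ l = 0" for k j l p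
    using growth[unfolded boundary_growth_def, THEN conjunct2, THEN conjunct1, rule_format, of p l k j] that
    by (simp add: H_def)
  have growth3: "((\<lambda>t. exp (- t $ k - t $ j) * H k j t) \<longlongrightarrow> 0) (boundary_filter p)"
    if "k \<noteq> j" "\<forall>i. 0 \<le> p $ i" "p $ k = 0 \<or> p $ j = 0" for k j p
    using growth[unfolded boundary_growth_def, THEN conjunct2, THEN conjunct2, rule_format, of k j p] that
    by (simp add: H_def)
  \<comment> \<open>The growth condition speaks of boundary points; at interior points continuity of
    the Hessian supplies the limit.\<close>
  have H: "\<exists>c. (H k j \<longlongrightarrow> c) (boundary_filter p)" if p: "\<forall>i. 0 \<le> p $ i" for k j p
  proof (cases "\<forall>i. 0 < p $ i")
    case True
    then show ?thesis
      using boundary_limit_interior[of "H k j" p] C2_fun_continuous_hess[OF G] unfolding H_def by blast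
  next
    case False
    with p growth2 show ?thesis
      by (metis order_le_less)
  qed
  have H': "boundary_convergent (\<lambda>t. exp (- t $ k) * H k j t)" for k j
    unfolding boundary_convergent_def
  proof (intro allI impI)
    fix p :: "real^'n" assume p: "\<forall>i. 0 \<le> p $ i"
    show "\<exists>c. ((\<lambda>t. exp (- t $ k) * H k j t) \<longlongrightarrow> c) (boundary_filter p)"
    proof (cases "p $ k = 0")
      \<comment> \<open>The Hessian with both exponential weights has a limit here; multiplying by
        exp (t_j), which tends to p_j, removes the surplus weight.\<close>
      case True
      have "\<exists>c. ((\<lambda>t. exp (- t $ k - t $ j) * H k j t) \<longlongrightarrow> c) (boundary_filter p)"
      proof (cases "k = j")
        case True
        with growth1[OF p] \<open>p $ k = 0\<close> show ?thesis by auto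
      next
        case False
        with growth3 p True show ?thesis by blast
      qed
      then obtain c where "((\<lambda>t. exp (- t $ k - t $ j) * H k j t) \<longlongrightarrow> c) (boundary_filter p)" ..
      from tendsto_mult[OF this tendsto_exp_nth_boundary[of j]]
      have "((\<lambda>t. exp (- t $ k) * H k j t) \<longlongrightarrow> c * p $ j) (boundary_filter p)"
        by (simp add: exp_diff)
      then show ?thesis ..
    next
      case False
      with H[OF p] tendsto_mult[OF tendsto_exp_minus_nth_boundary[OF False]] show ?thesis
        by blast
    qed
  qed
  have grad: "boundary_convergent (\<lambda>t. grad G t $ j)" for j
    by (rule boundary_convergent_if_derivative[OF has_derivative_hess_sum[OF G] H'[unfolded H_def]])
  have A: "boundary_convergent (A j)" for j
    unfolding boundary_convergent_def
  proof (intro allI impI)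
    fix p :: "real^'n" assume p: "\<forall>i. 0 \<le> p $ i"
    show "\<exists>c. (A j \<longlongrightarrow> c) (boundary_filter p)"
    proof (cases "p $ j = 0")
      case True
      then obtain c where "((\<lambda>t. 2 * A j t) \<longlongrightarrow> c) (boundary_filter p)"
        using growth1[OF p] by blast
      from tendsto_mult[OF tendsto_const[of "1/2"] this] show ?thesis
        by auto
    next
      case False
      obtain c where "((\<lambda>t. grad G t $ j) \<longlongrightarrow> c) (boundary_filter p)"
        using grad p unfolding boundary_convergent_def by blast
      from tendsto_mult[OF tendsto_mult[OF tendsto_exp_minus_nth_boundary[OF False]
          tendsto_exp_minus_nth_boundary[OF False]] this]
      show ?thesis
        unfolding A_def exp_minus2_eq by blast
    qed
  qed
  show "boundary_convergent (A j)" by (rule A)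
  show "boundary_convergent G"
  proof (rule boundary_convergent_if_derivative[OF has_derivative_grad_sum[OF G]])
    fix k
    show "boundary_convergent (\<lambda>t. exp (- t $ k) * grad G t $ k)"
      unfolding boundary_convergent_def
    proof (intro allI impI)
      fix p :: "real^'n" assume "\<forall>i. 0 \<le> p $ i"
      then obtain c where "(A k \<longlongrightarrow> c) (boundary_filter p)"
        using A unfolding boundary_convergent_def by blast
      from tendsto_mult[OF tendsto_exp_nth_boundary[of k] this]
      moreover have "exp (t $ k) * A k t = exp (- t $ k) * grad G t $ k" for t
        by (simp add: A_def mult.assoc[symmetric] flip: exp_add)
      ultimately have "((\<lambda>t. exp (- t $ k) * grad G t $ k) \<longlongrightarrow> p $ k * c) (boundary_filter p)"
        by simp
      then show "\<exists>c. ((\<lambda>t. exp (- t $ k) * grad G t $ k) \<longlongrightarrow> c) (boundary_filter p)" ..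
    qed
  qed
  have K0: "(K k j \<longlongrightarrow> 0) (boundary_filter p)"
    if p: "\<forall>i. 0 \<le> p $ i" "p $ k = 0 \<or> p $ j = 0" for p
  proof (cases "k = j")
    case True
    \<comment> \<open>On the diagonal the two expressions of the first growth condition share the
      limit c, and K_jj is their difference.\<close>
    with p obtain c where "((\<lambda>t. 2 * A j t) \<longlongrightarrow> c) (boundary_filter p)"
        "((\<lambda>t. exp (- 2 * t $ j) * H j j t) \<longlongrightarrow> c) (boundary_filter p)"
      using growth1[of p j] by auto
    from tendsto_diff[OF this(2,1)] show ?thesis
      using True by (simp add: K_def)
  next
    case False
    with growth3 p show ?thesis
      by (simp add: K_def)
  qed
  then show "(K k j \<longlongrightarrow> 0) (boundary_filter p)" if "\<And>i. 0 \<le> p $ i" "p $ k = 0 \<or> p $ j = 0" for p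
    using that by blast
  show "boundary_convergent (K k j)"
    unfolding boundary_convergent_def
  proof (intro allI impI)
    fix p :: "real^'n" assume p: "\<forall>i. 0 \<le> p $ i"
    show "\<exists>c. (K k j \<longlongrightarrow> c) (boundary_filter p)"
    proof (cases "p $ k = 0 \<or> p $ j = 0")
      case True
      with p K0 show ?thesis by blast
    next
      case False
      obtain c where c: "(H k j \<longlongrightarrow> c) (boundary_filter p)"
        using H[OF p] by blast
      obtain a where a: "(A j \<longlongrightarrow> a) (boundary_filter p)"
        using A p unfolding boundary_convergent_def by blast
      have "((\<lambda>t. exp (- t $ k) * exp (- t $ j) * H k j t - (if k = j then 2 * A j t else 0)) \<longlongrightarrow>
          inverse (p $ k) * inverse (p $ j) * c - (if k = j then 2 * a else 0)) (boundary_filter p)"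
        using False a by (intro tendsto_diff tendsto_mult tendsto_exp_minus_nth_boundary c) (auto intro!: tendsto_intros)
      then show ?thesis
        unfolding K_def by (auto simp flip: exp_add)
    qed
  qed
qed

text \<open>\<open>sgn\<close> jumps at 0 but is bounded, and it is multiplied by a continuous
  function that vanishes where either sign jumps.\<close>

lemma continuous_sgn_product:
  fixes \<kappa> :: "complex^'n::finite \<Rightarrow> real"
  assumes \<kappa>: "continuous_on UNIV \<kappa>" and \<kappa>0: "\<And>z. z $ k = 0 \<or> z $ j = 0 \<Longrightarrow> \<kappa> z = 0"
  shows "continuous_on UNIV (\<lambda>z. (\<kappa> z * (sgn (z $ k) \<bullet> c)) *\<^sub>R sgn (z $ j))"
  unfolding continuous_on_def
proof
  fix z :: "complex^'n"
  have lim: "(\<kappa> \<longlongrightarrow> \<kappa> z) (at z)"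
    using \<kappa> unfolding continuous_on_def by auto
  show "((\<lambda>z. (\<kappa> z * (sgn (z $ k) \<bullet> c)) *\<^sub>R sgn (z $ j)) \<longlongrightarrow> (\<kappa> z * (sgn (z $ k) \<bullet> c)) *\<^sub>R sgn (z $ j)) (at z)"
  proof (cases "z $ k = 0 \<or> z $ j = 0")
    case True
    then have "(\<kappa> \<longlongrightarrow> 0) (at z)"
      using lim \<kappa>0 by simp
    then have lim0: "((\<lambda>z. \<bar>\<kappa> z\<bar> * norm c) \<longlongrightarrow> 0) (at z)"
      by (auto intro!: tendsto_eq_intros)
    have bound: "norm ((\<kappa> z * (sgn (z $ k) \<bullet> c)) *\<^sub>R sgn (z $ j)) \<le> \<bar>\<kappa> z\<bar> * norm c" for z
    proof -
      have "\<bar>sgn (z $ k) \<bullet> c\<bar> \<le> norm (sgn (z $ k)) * norm c"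
        by (rule Cauchy_Schwarz_ineq2)
      also have "\<dots> \<le> 1 * norm c"
        by (intro mult_right_mono) (auto simp: norm_sgn)
      finally have "\<bar>\<kappa> z\<bar> * \<bar>sgn (z $ k) \<bullet> c\<bar> * norm (sgn (z $ j)) \<le> \<bar>\<kappa> z\<bar> * (1 * norm c) * 1"
        by (intro mult_mono) (auto simp: norm_sgn)
      then show ?thesis
        by (simp add: abs_mult)
    qed
    have "((\<lambda>z. (\<kappa> z * (sgn (z $ k) \<bullet> c)) *\<^sub>R sgn (z $ j)) \<longlongrightarrow> 0) (at z)"
      by (rule Lim_null_comparison[OF always_eventually[OF allI[OF bound]] lim0])
    with True \<kappa>0 show ?thesis by simp
  next
    case False
    then show ?thesis
      by (intro tendsto_intros lim) auto
  qed
qed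

text \<open>The gradient of \<open>\<Phi> z = G (ln \<bar>z\<^sub>1\<bar>, \<dots>, ln \<bar>z\<^sub>n\<bar>)\<close> has the components \<open>A\<^sub>j z\<^sub>j\<close>, and the derivative
  of these is \<open>w \<mapsto> (\<Sum>\<^sub>k K\<^sub>k\<^sub>j (sgn z\<^sub>k \<bullet> w\<^sub>k)) sgn z\<^sub>j + A\<^sub>j w\<^sub>j\<close>. As \<open>K\<^sub>k\<^sub>j\<close> vanishes for \<open>z\<^sub>k = 0\<close> and for
  \<open>z\<^sub>j = 0\<close>, this extends continuously to the coordinate hyperplanes.\<close>

lemma boundary_growth_extension:
  fixes G :: "real^'n::finite \<Rightarrow> real"
  assumes G: "C2_fun G" and growth: "boundary_growth G"
  obtains \<Phi> where "C2_fun \<Phi>" "\<And>z. (G \<longlongrightarrow> \<Phi> z) (boundary_filter (vabs z))"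
proof -
  define H where "H = (\<lambda>k j t. hess G t (axis k 1) (axis j 1))"
  define A where "A = (\<lambda>j t. exp (- 2 * t $ j) * (grad G t $ j))"
  define K where "K = (\<lambda>k j t. exp (- t $ k - t $ j) * H k j t - (if k = j then 2 * A j t else 0))"
  have conv: "boundary_convergent G" "boundary_convergent (A j)" "boundary_convergent (K k j)"
    "\<lbrakk>\<And>i. 0 \<le> p $ i; p $ k = 0 \<or> p $ j = 0\<rbrakk> \<Longrightarrow> (K k j \<longlongrightarrow> 0) (boundary_filter p)" for k j p
    unfolding A_def H_def K_def by (rule boundary_growth_limits[OF G growth]; assumption)+
  define \<Phi> where "\<Phi> z = boundary_ext G (vabs z)" for z :: "complex^'n"
  define \<alpha> where "\<alpha> j z = boundary_ext (A j) (vabs z)" for j and z :: "complex^'n"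
  define \<kappa> where "\<kappa> k j z = boundary_ext (K k j) (vabs z)" for k j and z :: "complex^'n"
  have cont: "continuous_on UNIV \<Phi>" "continuous_on UNIV (\<alpha> j)" "continuous_on UNIV (\<kappa> k j)" for k j
    unfolding \<Phi>_def \<alpha>_def \<kappa>_def
    by (rule continuous_on_boundary_ext_vabs[OF conv(1)] continuous_on_boundary_ext_vabs[OF conv(2)]
        continuous_on_boundary_ext_vabs[OF conv(3)])+
  have \<kappa>0: "\<kappa> k j z = 0" if "z $ k = 0 \<or> z $ j = 0" for k j z
    unfolding \<kappa>_def using that by (intro boundary_ext_eqI conv) auto
  define U where "U = {z :: complex^'n. \<forall>j. z $ j \<noteq> 0}"
  have "U = (\<Inter>j. {z. z $ j \<noteq> 0})"
    by (auto simp: U_def)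
  then have "open U"
    by (auto intro!: open_INT open_Collect_neq continuous_intros)
  define \<tau> where "\<tau> z = vln (vabs z)" for z :: "complex^'n"
  have \<tau>: "vexp (\<tau> z) = vabs z" "exp (\<tau> z $ j) = cmod (z $ j)" if "z \<in> U" for z j
    using that by (auto simp: \<tau>_def U_def intro!: vexp_vln)
  have d\<tau>: "(\<tau> has_derivative (\<lambda>w. \<chi> i. (z $ i \<bullet> w $ i) / (cmod (z $ i))\<^sup>2)) (at z)" if "z \<in> U" for z
  proof -
    have "((\<lambda>z. ln (norm (z $ i))) has_derivative (\<lambda>w. (z $ i \<bullet> w $ i) / (cmod (z $ i))\<^sup>2)) (at z)" for i
    proof -
      have 0: "z $ i \<noteq> 0"
        using that by (simp add: U_def)
      have "((\<lambda>z. norm (z $ i)) has_derivative (\<lambda>w. sgn (z $ i) \<bullet> w $ i)) (at z)"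
        using has_derivative_compose[OF bounded_linear_imp_has_derivative[OF bounded_linear_vec_nth[of i]]
            has_derivative_norm[OF 0]] by (simp add: inner_commute)
        then have "((\<lambda>z. ln (norm (z $ i))) has_derivative
            (\<lambda>w. (sgn (z $ i) \<bullet> w $ i) * inverse (norm (z $ i)))) (at z)"
          using 0 by (intro has_derivative_ln) auto
        moreover have "(sgn (z $ i) \<bullet> w $ i) * inverse (norm (z $ i)) = (z $ i \<bullet> w $ i) / (cmod (z $ i))\<^sup>2" for w
          by (simp add: sgn_div_norm divide_inverse power2_eq_square)
        ultimately show ?thesis
          by (simp only:)
    qed
    then show ?thesis
      unfolding \<tau>_def vln_def by (subst has_derivative_componentwise_within)
        (auto simp: Basis_vec_def inner_axis)
  qed
  have cont_grad: "continuous_on UNIV (\<lambda>t. grad G t $ j)" for j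
    by (intro continuous_on_component C1_map_continuous_on[OF C2_fun_C1_grad[OF G]])
  have cont_t: "isCont G t" "isCont (A j) t" "isCont (K k j) t" for t k j
  proof -
    have 1: "continuous_on UNIV G" by (rule C2_fun_continuous_on[OF G])
    have 2: "continuous_on UNIV (A j)" for j
      unfolding A_def by (intro continuous_intros cont_grad)
    have "continuous_on UNIV (\<lambda>t. (if k = j then 2 * A j t else 0))"
      by (cases "k = j") (auto intro!: continuous_intros 2)
    then have "continuous_on UNIV (K k j)"
      unfolding K_def H_def by (intro continuous_intros C2_fun_continuous_hess[OF G])
    with 1 2[of j] show "isCont G t" "isCont (A j) t" "isCont (K k j) t"
      by (auto simp: continuous_on_eq_continuous_at)
  qed
  have eq: "\<Phi> z = G (\<tau> z)" "\<alpha> j z = A j (\<tau> z)" "\<kappa> k j z = K k j (\<tau> z)" if "z \<in> U" for z k j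
    unfolding \<Phi>_def \<alpha>_def \<kappa>_def \<tau>(1)[OF that, symmetric] by (intro boundary_ext_vexp cont_t)+
  define N where "N j z = \<alpha> j z *\<^sub>R z $ j" for j z
  define D where "D j z w = (\<Sum>k\<in>UNIV. (\<kappa> k j z * (sgn (z $ k) \<bullet> w $ k)) *\<^sub>R sgn (z $ j)) + \<alpha> j z *\<^sub>R w $ j" for j z w
  have contN: "continuous_on UNIV (N j)" for j
    unfolding N_def by (intro continuous_intros cont)
  have N: "C1_map (N j)" for j
  proof (rule C1_mapI)
    show contD: "continuous_on UNIV (\<lambda>z. D j z w)" for w
      unfolding D_def by (intro continuous_intros cont continuous_sgn_product \<kappa>0)
    show "(N j has_derivative D j z) (at z)" for z
    proof (rule has_derivative_across_hyperplanes[OF contN _ _ contD])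
      show "linear (D j z)" for z
        unfolding D_def
        by (intro linearI) (simp_all add: inner_add_right algebra_simps sum.distrib scaleR_sum_right)
      show "(N j has_derivative D j z) (at z)" if z: "\<forall>j. z $ j \<noteq> 0" for z
      proof -
        have zU: "z \<in> U"
          using z by (simp add: U_def)
        let ?t = "\<tau> z"
        \<comment> \<open>The partial derivative of A_j in t_k; differentiating the weight exp (- 2
          t_j) contributes - 2 A_j, and only for k = j.\<close>
        define E where "E k = exp (- 2 * ?t $ j) * H k j ?t - (if k = j then 2 * A j ?t else 0)" for k
        have "(A j has_derivative (\<lambda>h. exp (- 2 * ?t $ j) * (\<Sum>k\<in>UNIV. H k j ?t * h $ k)
            + (exp (- 2 * ?t $ j) * (- 2 * h $ j)) * grad G ?t $ j)) (at ?t)"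
          unfolding A_def H_def
          by (intro has_derivative_mult has_derivative_exp has_derivative_hess_sum[OF G])
             (auto intro!: derivative_eq_intros bounded_linear_imp_has_derivative[OF bounded_linear_vec_nth])
        moreover have "exp (- 2 * ?t $ j) * (\<Sum>k\<in>UNIV. H k j ?t * h $ k)
            + (exp (- 2 * ?t $ j) * (- 2 * h $ j)) * grad G ?t $ j = (\<Sum>k\<in>UNIV. E k * h $ k)" for h
          by (simp add: E_def A_def algebra_simps sum_subtractf sum_distrib_left if_distrib[of "\<lambda>x. x * _"]
              if_distrib[of "\<lambda>x. _ * x"] cong: if_cong)
        ultimately have "(A j has_derivative (\<lambda>h. \<Sum>k\<in>UNIV. E k * h $ k)) (at ?t)"
          by simp
        from has_derivative_compose[OF d\<tau>[OF zU] this]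
        have "((\<lambda>z. A j (\<tau> z)) has_derivative
            (\<lambda>w. \<Sum>k\<in>UNIV. E k * ((z $ k \<bullet> w $ k) / (cmod (z $ k))\<^sup>2))) (at z)"
          by simp
        from has_derivative_scaleR[OF this bounded_linear_imp_has_derivative[OF bounded_linear_vec_nth]]
        have "((\<lambda>z. A j (\<tau> z) *\<^sub>R z $ j) has_derivative (\<lambda>w. A j ?t *\<^sub>R w $ j +
            (\<Sum>k\<in>UNIV. E k * ((z $ k \<bullet> w $ k) / (cmod (z $ k))\<^sup>2)) *\<^sub>R z $ j)) (at z)" .
        moreover have "A j ?t *\<^sub>R w $ j +
            (\<Sum>k\<in>UNIV. E k * ((z $ k \<bullet> w $ k) / (cmod (z $ k))\<^sup>2)) *\<^sub>R z $ j = D j z w" for w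
        proof -
          have "(E k * ((z $ k \<bullet> w $ k) / (cmod (z $ k))\<^sup>2)) *\<^sub>R z $ j =
             (\<kappa> k j z * (sgn (z $ k) \<bullet> w $ k)) *\<^sub>R sgn (z $ j)" for k
          proof -
            \<comment> \<open>Writing z_j = |z_j| sgn z_j and z_k / |z_k|^2 = sgn z_k / |z_k| leaves
              the factor |z_j| / |z_k|, which turns E into K; on the diagonal it is 1.\<close>
            have "K k j ?t = E k * cmod (z $ j) / cmod (z $ k)"
              unfolding K_def E_def \<tau>(2)[OF zU, symmetric]
              by (auto simp: exp_diff exp_minus field_simps simp flip: exp_add)
            moreover have "z $ j \<noteq> 0" "z $ k \<noteq> 0"
              using z by auto
            ultimately show ?thesis
              by (simp add: eq[OF zU] sgn_div_norm power2_eq_square field_simps)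
          qed
          then show ?thesis
            by (simp add: D_def eq[OF zU] scaleR_sum_left)
        qed
        ultimately have "((\<lambda>z. A j (\<tau> z) *\<^sub>R z $ j) has_derivative D j z) (at z)"
          by simp
        then show ?thesis
          by (rule has_derivative_transform_within_open[OF _ \<open>open U\<close> zU]) (simp add: N_def eq)
      qed
    qed
  qed
  have "(\<Phi> has_derivative (\<lambda>w. (\<chi> j. N j z) \<bullet> w)) (at z)" for z
  proof (rule has_derivative_across_hyperplanes[OF cont(1)])
    show "linear (\<lambda>w. (\<chi> j. N j z) \<bullet> w)" for z
      by (intro linearI) (simp_all add: inner_add_right)
    show "continuous_on UNIV (\<lambda>z. (\<chi> j. N j z) \<bullet> w)" for w
      by (intro continuous_intros contN)
    show "(\<Phi> has_derivative (\<lambda>w. (\<chi> j. N j z) \<bullet> w)) (at z)" if z: "\<forall>j. z $ j \<noteq> 0" for z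
    proof -
      have zU: "z \<in> U"
        using z by (simp add: U_def)
      have "((\<lambda>z. G (\<tau> z)) has_derivative
          (\<lambda>w. \<Sum>k\<in>UNIV. grad G (\<tau> z) $ k * ((z $ k \<bullet> w $ k) / (cmod (z $ k))\<^sup>2))) (at z)"
        using has_derivative_compose[OF d\<tau>[OF zU] has_derivative_grad_sum[OF G]] by simp
      moreover have "grad G (\<tau> z) $ k * ((z $ k \<bullet> w $ k) / (cmod (z $ k))\<^sup>2) = N k z \<bullet> w $ k" for k w
        unfolding N_def eq[OF zU] A_def exp_minus2_eq exp_minus \<tau>(2)[OF zU]
        by (simp add: power2_eq_square divide_inverse)
      ultimately have "((\<lambda>z. G (\<tau> z)) has_derivative (\<lambda>w. (\<chi> j. N j z) \<bullet> w)) (at z)"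
        by (simp add: inner_vec_def)
      then show ?thesis
        by (rule has_derivative_transform_within_open[OF _ \<open>open U\<close> zU]) (simp add: eq)
    qed
  qed
  then have "C2_fun \<Phi>"
    unfolding C2_fun_iff using C1_map_vec_lambda[OF N] by (intro exI[of _ "\<lambda>z. \<chi> j. N j z"]) simp
  then show ?thesis
    by (rule that) (auto simp: \<Phi>_def intro!: boundary_ext_tendsto conv)
qed

text \<open>A reflection in r_j changes the sign of F_j, and of F_jk for k different from j; on its
  mirror r_j = 0 these derivatives therefore vanish. The growth conditions follow from the chain
  rule and these zeros.\<close>

lemma boundary_growth_of_even:
  fixes F :: "real^'n::finite \<Rightarrow> real"
  assumes F: "C2_fun F" and even: "\<And>j r. F (r - (2 * r $ j) *\<^sub>R axis j 1) = F r"
  shows "C2_fun (\<lambda>t. F (vexp t))" and "boundary_growth (\<lambda>t. F (vexp t))"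
proof -
  define f where "f j r = grad F r $ j" for j r
  define H where "H k j r = hess F r (axis k 1) (axis j 1)" for k j r
  have contf: "continuous_on UNIV (f j)" for j
    unfolding f_def by (intro continuous_on_component C1_map_continuous_on[OF C2_fun_C1_grad[OF F]])
  have contH: "continuous_on UNIV (H k j)" for k j
    unfolding H_def by (rule C2_fun_continuous_hess[OF F])
  have refl: "linear (\<lambda>r :: real^'n. r - (2 * r $ j) *\<^sub>R axis j 1)" for j
    by (intro linearI) (simp_all add: algebra_simps)
  have refl_axis: "axis k 1 - (2 * axis k 1 $ j) *\<^sub>R axis j 1 = (if k = j then - axis j 1 else (axis k 1 :: real^'n))" for j k
    by (simp add: axis_def vec_eq_iff)
  have f0: "f j r = 0" if "r $ j = 0" for j r
  proof -
    have "grad F r \<bullet> axis j 1 = grad F (r - (2 * r $ j) *\<^sub>R axis j 1) \<bullet> (axis j 1 - (2 * axis j 1 $ j) *\<^sub>R axis j 1)"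
      using grad_compose_linear[OF F refl[of j], of r "axis j 1"] by (simp only: even)
    then have "grad F r \<bullet> axis j 1 = - (grad F r \<bullet> axis j 1)"
      unfolding refl_axis using that by simp
    then show ?thesis
      by (simp add: f_def inner_axis)
  qed
  have H0': "H k j r = 0" if "r $ k = 0" "j \<noteq> k" for j k r
  proof -
    have "H k j r = hess F (r - (2 * r $ k) *\<^sub>R axis k 1)
        (axis k 1 - (2 * axis k 1 $ k) *\<^sub>R axis k 1) (axis j 1 - (2 * axis j 1 $ k) *\<^sub>R axis k 1)"
      using hess_compose_linear[OF F refl[of k], of r "axis k 1" "axis j 1"] unfolding H_def by (simp only: even)
    then have "H k j r = hess F r (- axis k 1) (axis j 1)"
      unfolding refl_axis using that by simp
    also have "\<dots> = - H k j r"
      unfolding H_def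
      using linear_neg[OF has_derivative_linear[OF C2_fun_has_hess[OF F, of "axis j 1"]]] by simp
    finally show ?thesis by simp
  qed
  \<comment> \<open>The reflection argument covers one of the two indices; symmetry of the Hessian
    covers the other.\<close>
  have H0: "H k j r = 0" if "r $ j = 0 \<or> r $ k = 0" "j \<noteq> k" for j k r
    using that H0'[of r k j] H0'[of r j k] hess_commute[OF F] by (auto simp: H_def)
  have dvexp: "(vexp has_derivative (\<lambda>h. \<chi> i. exp (t $ i) * h $ i)) (at t)" for t :: "real^'n"
    unfolding vexp_def
    by (subst has_derivative_componentwise_within)
      (auto simp: Basis_vec_def inner_axis
        intro!: derivative_eq_intros bounded_linear_imp_has_derivative bounded_linear_vec_nth)
  define \<gamma> where "\<gamma> j t = f j (vexp t) * exp (t $ j)" for j t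
  have dG: "((\<lambda>t. F (vexp t)) has_derivative (\<lambda>h. (\<chi> j. \<gamma> j t) \<bullet> h)) (at t)" for t
    using has_derivative_compose[OF dvexp has_derivative_grad_sum[OF F]]
    by (simp add: inner_vec_def \<gamma>_def f_def mult.assoc)
  define D where "D j t h = f j (vexp t) * (exp (t $ j) * h $ j) +
     (\<Sum>k\<in>UNIV. H k j (vexp t) * (exp (t $ k) * h $ k)) * exp (t $ j)" for j t h
  have d\<gamma>: "(\<gamma> j has_derivative D j t) (at t)" for j t
  proof -
    have "((\<lambda>t. f j (vexp t)) has_derivative (\<lambda>h. \<Sum>k\<in>UNIV. H k j (vexp t) * (exp (t $ k) * h $ k))) (at t)"
      using has_derivative_compose[OF dvexp has_derivative_hess_sum[OF F]]
      by (simp add: f_def H_def)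
    moreover have "((\<lambda>t. exp (t $ j)) has_derivative (\<lambda>h. exp (t $ j) * h $ j)) (at t)"
      using has_derivative_exp[OF bounded_linear_imp_has_derivative[OF bounded_linear_vec_nth[of j]]]
      by (simp add: mult.commute)
    ultimately show ?thesis
      unfolding \<gamma>_def D_def by (rule has_derivative_mult)
  qed
  have contvexp: "continuous_on UNIV (vexp :: real^'n \<Rightarrow> real^'n)"
    unfolding vexp_def by (intro continuous_intros)
  have contfv: "continuous_on UNIV (\<lambda>t. f j (vexp t))" and contHv: "continuous_on UNIV (\<lambda>t. H k j (vexp t))" for j k
    by (rule continuous_on_compose2[OF contf contvexp] continuous_on_compose2[OF contH contvexp], simp)+
  have "C1_map (\<gamma> j)" for j
    by (rule C1_mapI[OF d\<gamma>]) (unfold D_def, intro continuous_intros contfv contHv)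
  with dG show C2: "C2_fun (\<lambda>t. F (vexp t))"
    unfolding C2_fun_iff using C1_map_vec_lambda[of \<gamma>] by (intro exI[of _ "\<lambda>t. \<chi> j. \<gamma> j t"]) simp
  have grad: "grad (\<lambda>t. F (vexp t)) t = (\<chi> j. \<gamma> j t)" for t
    by (rule grad_eqI[OF dG])
  have hess: "hess (\<lambda>t. F (vexp t)) t (axis k 1) (axis j 1) =
     exp (t $ k) * exp (t $ j) * H k j (vexp t) + (if k = j then \<gamma> j t else 0)" for k j t
  proof -
    have "hess (\<lambda>t. F (vexp t)) t (axis k 1) (axis j 1) = D j t (axis k 1)"
      by (rule hess_eqI) (simp add: grad inner_axis d\<gamma>)
    also have "(\<Sum>i\<in>UNIV. H i j (vexp t) * (exp (t $ i) * axis k 1 $ i)) = H k j (vexp t) * exp (t $ k)"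
      by (subst sum.remove[of _ k]) (auto simp: axis_def intro!: sum.neutral)
    then have "D j t (axis k 1) = exp (t $ k) * exp (t $ j) * H k j (vexp t) + (if k = j then \<gamma> j t else 0)"
      by (auto simp: D_def \<gamma>_def axis_def)
    finally show ?thesis .
  qed
  have limf: "((\<lambda>t. f j (vexp t)) \<longlongrightarrow> f j p) (boundary_filter p)" for j p
    using continuous_on_tendsto_compose[OF contf tendsto_vexp_boundary, of p] by simp
  have limH: "((\<lambda>t. H k j (vexp t)) \<longlongrightarrow> H k j p) (boundary_filter p)" for k j p
    using continuous_on_tendsto_compose[OF contH tendsto_vexp_boundary, of p] by simp
  \<comment> \<open>F_j / r_j tends to F_jj: as F_j vanishes at r_j = 0, the mean value theorem in
    the variable r_j gives F_jj at an intermediate point, which is squeezed to p.\<close>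
  have quot: "((\<lambda>t. exp (- t $ j) * f j (vexp t)) \<longlongrightarrow> H j j p) (boundary_filter p)" if p: "p $ j = 0" for j p
  proof -
    have "\<exists>s. 0 < s \<and> s < exp (t $ j) \<and> f j (vexp t) = exp (t $ j) * H j j (\<chi> i. if i = j then s else exp (t $ i))" for t
    proof -
      define r where "r s = (\<chi> i. if i = j then s else exp (t $ i))" for s
      have r: "r s = r 0 + s *\<^sub>R axis j 1" for s
        by (simp add: r_def vec_eq_iff axis_def)
      have "((\<lambda>s. f j (r s)) has_real_derivative H j j (r s)) (at s)" for s
      proof -
        have "((\<lambda>s. r 0 + s *\<^sub>R axis j 1) has_derivative (\<lambda>h. h *\<^sub>R axis j 1)) (at s)"
          by (auto intro!: derivative_eq_intros)
        moreover have "(\<lambda>s. r 0 + s *\<^sub>R axis j 1) = r"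
          using r by (intro ext) (rule sym)
        ultimately have "(r has_derivative (\<lambda>h. h *\<^sub>R axis j 1)) (at s)"
          by (simp only:)
        from has_derivative_compose[OF this C2_fun_has_hess[OF F, of "axis j 1"]]
        have "((\<lambda>s. f j (r s)) has_derivative (\<lambda>h. hess F (r s) (h *\<^sub>R axis j 1) (axis j 1))) (at s)"
          by (simp add: f_def inner_axis)
        moreover have "hess F (r s) (h *\<^sub>R axis j 1) (axis j 1) = H j j (r s) * h" for h
          unfolding H_def
          using linear_cmul[OF has_derivative_linear[OF C2_fun_has_hess[OF F, of "axis j 1"]], of "r s" h "axis j 1"]
          by (simp add: mult.commute)
        ultimately show ?thesis
          by (simp add: has_field_derivative_def)
      qed
      then obtain s where "0 < s" "s < exp (t $ j)" "f j (r (exp (t $ j))) - f j (r 0) = (exp (t $ j) - 0) * H j j (r s)"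
        using MVT2[of 0 "exp (t $ j)" "\<lambda>s. f j (r s)" "\<lambda>s. H j j (r s)"] by auto
      moreover have "r (exp (t $ j)) = vexp t"
        by (simp add: r_def vec_eq_iff)
      moreover have "f j (r 0) = 0"
        by (rule f0) (simp add: r_def)
      ultimately show ?thesis
        by (auto simp: r_def)
    qed
    then have "\<forall>t. \<exists>s. 0 < s \<and> s < exp (t $ j) \<and> f j (vexp t) = exp (t $ j) * H j j (\<chi> i. if i = j then s else exp (t $ i))"
      by blast
    from choice[OF this] obtain s where s: "\<And>t. 0 < s t" "\<And>t. s t < exp (t $ j)"
      "\<And>t. f j (vexp t) = exp (t $ j) * H j j (\<chi> i. if i = j then s t else exp (t $ i))"
      by blast
    have "((\<lambda>t. s t) \<longlongrightarrow> 0) (boundary_filter p)"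
    proof (rule tendsto_sandwich[OF _ _ tendsto_const])
      show "((\<lambda>t. exp (t $ j)) \<longlongrightarrow> 0) (boundary_filter p)"
        using tendsto_exp_nth_boundary[of j p] p by simp
    qed (use s(1,2) in \<open>auto intro!: always_eventually less_imp_le\<close>)
    then have "((\<lambda>t. \<chi> i. if i = j then s t else exp (t $ i)) \<longlongrightarrow> p) (boundary_filter p)"
      using tendsto_exp_nth_boundary[of _ p] p
      by (intro vec_tendstoI, case_tac "i = j") simp_all
    from continuous_on_tendsto_compose[OF contH this]
    have "((\<lambda>t. H j j (\<chi> i. if i = j then s t else exp (t $ i))) \<longlongrightarrow> H j j p) (boundary_filter p)"
      by simp
    moreover have "exp (- t $ j) * f j (vexp t) = H j j (\<chi> i. if i = j then s t else exp (t $ i))" for t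
      by (simp add: s(3) exp_minus)
    ultimately show ?thesis by simp
  qed
  have e\<gamma>: "exp (- 2 * t $ j) * \<gamma> j t = exp (- t $ j) * f j (vexp t)" for j t
    by (simp add: \<gamma>_def flip: exp_add)
  have c1: "\<exists>c. ((\<lambda>t. 2 * exp (- 2 * t $ j) * (grad (\<lambda>t. F (vexp t)) t $ j)) \<longlongrightarrow> c) (boundary_filter p) \<and>
           ((\<lambda>t. exp (- 2 * t $ j) * hess (\<lambda>t. F (vexp t)) t (axis j 1) (axis j 1)) \<longlongrightarrow> c) (boundary_filter p)"
    if "p $ j = 0" for j p
  proof (intro exI conjI)
    have "2 * exp (- 2 * t $ j) * (grad (\<lambda>t. F (vexp t)) t $ j) = 2 * (exp (- t $ j) * f j (vexp t))" for t
      unfolding e\<gamma>[symmetric] by (simp add: grad)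
    then show "((\<lambda>t. 2 * exp (- 2 * t $ j) * (grad (\<lambda>t. F (vexp t)) t $ j)) \<longlongrightarrow> 2 * H j j p) (boundary_filter p)"
      by (simp only: tendsto_mult[OF tendsto_const quot[OF that]])
    \<comment> \<open>The two summands are F_jj and F_j / r_j. Both tend to F_jj (p), whence the
      common limit 2 F_jj (p).\<close>
    have "exp (- 2 * t $ j) * hess (\<lambda>t. F (vexp t)) t (axis j 1) (axis j 1) = H j j (vexp t) + exp (- t $ j) * f j (vexp t)" for t
      unfolding e\<gamma>[symmetric] by (simp add: hess distrib_left mult.assoc[symmetric] flip: exp_add)
    then show "((\<lambda>t. exp (- 2 * t $ j) * hess (\<lambda>t. F (vexp t)) t (axis j 1) (axis j 1)) \<longlongrightarrow> 2 * H j j p) (boundary_filter p)"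
      using tendsto_add[OF limH quot[OF that], of j j] by simp
  qed
  have c2: "\<exists>c. ((\<lambda>t. hess (\<lambda>t. F (vexp t)) t (axis j 1) (axis k 1)) \<longlongrightarrow> c) (boundary_filter p)" for j k p
  proof -
    have "((\<lambda>t. if j = k then \<gamma> k t else 0) \<longlongrightarrow> (if j = k then f k p * p $ k else 0)) (boundary_filter p)"
      unfolding \<gamma>_def by (auto intro!: tendsto_intros limf tendsto_exp_nth_boundary)
    then have "((\<lambda>t. hess (\<lambda>t. F (vexp t)) t (axis j 1) (axis k 1)) \<longlongrightarrow>
        p $ j * p $ k * H j k p + (if j = k then f k p * p $ k else 0)) (boundary_filter p)"
      unfolding hess by (intro tendsto_intros limH tendsto_exp_nth_boundary)
    then show ?thesis ..
  qed
  have c3: "((\<lambda>t. exp (- t $ j - t $ k) * hess (\<lambda>t. F (vexp t)) t (axis j 1) (axis k 1)) \<longlongrightarrow> 0) (boundary_filter p)"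
    if "j \<noteq> k" "p $ j = 0 \<or> p $ k = 0" for j k p
  proof -
    have "exp (- t $ j - t $ k) * hess (\<lambda>t. F (vexp t)) t (axis j 1) (axis k 1) = H j k (vexp t)" for t
      using that(1) by (simp add: hess mult.assoc[symmetric] flip: exp_add)
    then show ?thesis
      using limH[of j k p] H0[of p k j] that by auto
  qed
  from c1 c2 c3 show "boundary_growth (\<lambda>t. F (vexp t))"
    unfolding boundary_growth_def by blast
qed

section \<open>Lattice bases and cones\<close>

lemma rvec_nth [simp]: "rvec u $ i = of_int (u $ i)"
  by (simp add: rvec_def)

lemma rvec_add: "rvec (u + w) = rvec u + rvec w"
  and rvec_diff: "rvec (u - w) = rvec u - rvec w"
  and rvec_minus: "rvec (- u) = - rvec u"
  and rvec_0 [simp]: "rvec 0 = 0"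
  and rvec_scale: "rvec (c *s u) = of_int c *\<^sub>R rvec u"
  by (simp_all add: vec_eq_iff)

lemma rvec_sum: "rvec (\<Sum>j\<in>A. f j) = (\<Sum>j\<in>A. rvec (f j))"
  by (induction A rule: infinite_finite_induct) (simp_all add: rvec_add)

lemma rvec_axis: "rvec (axis i 1) = axis i 1"
  by (simp add: vec_eq_iff axis_def)

lemma rvec_eq_iff [simp]: "rvec u = rvec w \<longleftrightarrow> u = w"
  by (simp add: vec_eq_iff)

lemma inner_rvec: "rvec u \<bullet> rvec w = of_int (pairing u w)"
  by (simp add: inner_vec_def pairing_def)

lemma pairing_add_left: "pairing (u + u') w = pairing u w + pairing u' w"
  and pairing_add_right: "pairing u (w + w') = pairing u w + pairing u w'"
  and pairing_diff_left: "pairing (u - u') w = pairing u w - pairing u' w"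
  and pairing_minus_left: "pairing (- u) w = - pairing u w"
  and pairing_scale_left: "pairing (c *s u) w = c * pairing u w"
  and pairing_scale_right: "pairing u (c *s w) = c * pairing u w"
  and pairing_0_left [simp]: "pairing 0 w = 0"
  by (simp_all add: pairing_def algebra_simps sum.distrib sum_subtractf sum_negf sum_distrib_left)

lemma pairing_sum_left: "pairing (\<Sum>j\<in>A. f j) w = (\<Sum>j\<in>A. pairing (f j) w)"
  by (induction A rule: infinite_finite_induct) (simp_all add: pairing_add_left)

lemma pairing_sum_right: "pairing u (\<Sum>j\<in>A. f j) = (\<Sum>j\<in>A. pairing u (f j))"
  by (induction A rule: infinite_finite_induct) (simp_all add: pairing_add_right, simp_all add: pairing_def)

lemma vector_scale_sum_right: "(c :: 'a::comm_ring_1) *s (\<Sum>k\<in>A. f k) = (\<Sum>k\<in>A. c *s f k)"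
  and vector_scale_sum_left: "(\<Sum>k\<in>A. g k :: 'a::comm_ring_1) *s w = (\<Sum>k\<in>A. g k *s w)"
  by (simp_all add: vec_eq_iff sum_distrib_left sum_distrib_right)

lemma pairing_axis [simp]: "pairing u (axis i 1) = u $ i"
  by (simp add: pairing_def axis_def if_distrib cong: if_cong)

text \<open>The dual basis in M of a lattice basis of N.\<close>

definition dual_vector :: "('n \<Rightarrow> int^'n::finite) \<Rightarrow> 'n \<Rightarrow> int^'n" where
  "dual_vector e j = (\<chi> i. (THE c :: 'n \<Rightarrow> int. axis i 1 = (\<Sum>k\<in>UNIV. c k *s e k)) j)"

lemma lattice_basis_expansion:
  assumes "lattice_basis e"
  shows "(\<Sum>j\<in>UNIV. pairing (dual_vector e j) x *s e j) = x"
proof -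
  define c where "c i = (THE c :: 'a \<Rightarrow> int. axis i 1 = (\<Sum>k\<in>UNIV. c k *s e k))" for i
  have "\<exists>!c :: 'a \<Rightarrow> int. axis i 1 = (\<Sum>k\<in>UNIV. c k *s e k)" for i
    using assms by (simp add: lattice_basis_def)
  then have c: "axis i 1 = (\<Sum>k\<in>UNIV. c i k *s e k)" for i
    unfolding c_def by (rule theI')
  have "x = (\<Sum>i\<in>UNIV. x $ i *s axis i 1)"
    by (rule basis_expansion[symmetric])
  also have "\<dots> = (\<Sum>i\<in>UNIV. \<Sum>k\<in>UNIV. (c i k * x $ i) *s e k)"
    by (subst c) (simp add: vector_scale_sum_right mult.commute)
  also have "\<dots> = (\<Sum>k\<in>UNIV. \<Sum>i\<in>UNIV. (c i k * x $ i) *s e k)"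
    by (rule sum.swap)
  also have "\<dots> = (\<Sum>k\<in>UNIV. pairing (dual_vector e k) x *s e k)"
    by (simp add: vector_scale_sum_left pairing_def dual_vector_def c_def)
  finally show ?thesis ..
qed

lemma pairing_dual_vector:
  assumes "lattice_basis e"
  shows "pairing (dual_vector e j) (e k) = (if j = k then 1 else 0)"
proof -
  have 1: "e k = (\<Sum>j\<in>UNIV. pairing (dual_vector e j) (e k) *s e j)"
    by (rule lattice_basis_expansion[OF assms, symmetric])
  have 2: "e k = (\<Sum>j\<in>UNIV. (if j = k then 1 else 0) *s e j)"
    by (simp add: if_distrib[of "\<lambda>c. c *s _"] cong: if_cong)
  have ex1: "\<exists>!c :: 'a \<Rightarrow> int. e k = (\<Sum>j\<in>UNIV. c j *s e j)"
    using assms by (simp add: lattice_basis_def)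
  have "(\<lambda>j. pairing (dual_vector e j) (e k)) = (\<lambda>j. if j = k then 1 else 0)"
    using the1_equality[OF ex1, OF 1] the1_equality[OF ex1, OF 2] by (rule trans[OF sym])
  then show ?thesis
    by (rule fun_cong)
qed

lemma dual_vector_expansion:
  assumes "lattice_basis e"
  shows "(\<Sum>j\<in>UNIV. pairing u (e j) *s dual_vector e j) = u"
proof -
  have "u $ i = (\<Sum>j\<in>UNIV. pairing u (e j) * dual_vector e j $ i)" for i
  proof -
    have "u $ i = pairing u (axis i 1)"
      by simp
    also have "\<dots> = pairing u (\<Sum>j\<in>UNIV. dual_vector e j $ i *s e j)"
      using lattice_basis_expansion[OF assms, of "axis i 1"] by simp
    also have "\<dots> = (\<Sum>j\<in>UNIV. pairing u (e j) * dual_vector e j $ i)"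
      by (simp add: pairing_sum_right pairing_scale_right mult.commute)
    finally show ?thesis .
  qed
  then show ?thesis
    by (simp add: vec_eq_iff)
qed

lemma real_basis_expansion:
  assumes "lattice_basis e"
  shows "(\<Sum>j\<in>UNIV. (rvec (dual_vector e j) \<bullet> x) *\<^sub>R rvec (e j)) = x"
proof -
  have "x = (\<Sum>i\<in>UNIV. x $ i *\<^sub>R rvec (axis i 1))"
    using basis_expansion[of x] by (simp add: rvec_axis scalar_mult_eq_scaleR)
  also have "\<dots> = (\<Sum>i\<in>UNIV. x $ i *\<^sub>R rvec (\<Sum>j\<in>UNIV. dual_vector e j $ i *s e j))"
    using lattice_basis_expansion[OF assms, of "axis _ 1"] by simp
  also have "\<dots> = (\<Sum>i\<in>UNIV. \<Sum>j\<in>UNIV. (dual_vector e j $ i * x $ i) *\<^sub>R rvec (e j))"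
    by (simp add: rvec_sum rvec_scale scaleR_sum_right mult.commute)
  also have "\<dots> = (\<Sum>j\<in>UNIV. \<Sum>i\<in>UNIV. (dual_vector e j $ i * x $ i) *\<^sub>R rvec (e j))"
    by (rule sum.swap)
  also have "\<dots> = (\<Sum>j\<in>UNIV. (rvec (dual_vector e j) \<bullet> x) *\<^sub>R rvec (e j))"
    by (simp add: inner_vec_def scaleR_sum_left)
  finally show ?thesis ..
qed

lemma lattice_basis_permute:
  assumes e: "lattice_basis e" and \<pi>: "bij \<pi>"
  shows "lattice_basis (e \<circ> \<pi>)"
  unfolding lattice_basis_def
proof
  fix x
  have reindex: "(\<Sum>j\<in>UNIV. c j *s (e \<circ> \<pi>) j) = (\<Sum>j\<in>UNIV. (c \<circ> inv \<pi>) j *s e j)" for c :: "'a \<Rightarrow> int"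
    using sum.reindex_bij_betw[OF \<pi>, of "\<lambda>j. (c \<circ> inv \<pi>) j *s e j"] bij_is_inj[OF \<pi>]
    by simp
  obtain c where c: "x = (\<Sum>j\<in>UNIV. c j *s e j)" and uniq: "\<And>c'. x = (\<Sum>j\<in>UNIV. c' j *s e j) \<Longrightarrow> c' = c"
    using e unfolding lattice_basis_def by metis
  show "\<exists>!c. x = (\<Sum>j\<in>UNIV. c j *s (e \<circ> \<pi>) j)"
  proof
    show "x = (\<Sum>j\<in>UNIV. (c \<circ> \<pi>) j *s (e \<circ> \<pi>) j)"
      unfolding reindex using c bij_is_surj[OF \<pi>] by (simp add: surj_f_inv_f)
  next
    fix c' assume "x = (\<Sum>j\<in>UNIV. c' j *s (e \<circ> \<pi>) j)"
    then have "c' \<circ> inv \<pi> = c"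
      unfolding reindex by (rule uniq)
    then show "c' = c \<circ> \<pi>"
      using bij_is_inj[OF \<pi>] by (metis comp_assoc comp_id inv_o_cancel)
  qed
qed

section \<open>Smooth cones and their faces\<close>

lemma convex_cone_lattice_cone: "convex_cone (lattice_cone S)"
  by (simp add: lattice_cone_def convex_cone_convex_cone_hull)

lemma rvec_in_lattice_cone: "u \<in> S \<Longrightarrow> rvec u \<in> lattice_cone S"
  by (auto simp: lattice_cone_def intro: hull_inc)

lemma lattice_cone_subset:
  assumes "convex_cone C" "\<And>u. u \<in> S \<Longrightarrow> rvec u \<in> C"
  shows "lattice_cone S \<subseteq> C"
  unfolding lattice_cone_def using assms by (intro hull_minimal) auto

text \<open>In dual coordinates a smooth cone is a coordinate orthant, which turns questions about
  membership, rays and faces into sign conditions.\<close>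

lemma lattice_cone_coordinates:
  assumes "lattice_basis e"
  shows "lattice_cone (e ` J) =
    {x. \<forall>j. 0 \<le> rvec (dual_vector e j) \<bullet> x \<and> (j \<notin> J \<longrightarrow> rvec (dual_vector e j) \<bullet> x = 0)}"
    (is "_ = ?C")
proof
  have "convex_cone ?C"
    unfolding convex_cone_iff by (auto simp: inner_add_right)
  then show "lattice_cone (e ` J) \<subseteq> ?C"
    by (rule lattice_cone_subset) (auto simp: inner_rvec pairing_dual_vector[OF assms])
  show "?C \<subseteq> lattice_cone (e ` J)"
  proof
    fix x assume x: "x \<in> ?C"
    have cc: "convex_cone (lattice_cone (e ` J))"
      by (rule convex_cone_lattice_cone)
    have "(rvec (dual_vector e j) \<bullet> x) *\<^sub>R rvec (e j) \<in> lattice_cone (e ` J)" for j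
    proof (cases "j \<in> J")
      case True
      with x show ?thesis
        by (intro convex_cone_scaleR[OF cc] rvec_in_lattice_cone) auto
    next
      case False
      with x show ?thesis
        using convex_cone_contains_0[OF cc] by simp
    qed
    then have "(\<Sum>j\<in>A. (rvec (dual_vector e j) \<bullet> x) *\<^sub>R rvec (e j)) \<in> lattice_cone (e ` J)" for A
      by (induction A rule: infinite_finite_induct)
        (simp_all add: convex_cone_add[OF cc] convex_cone_contains_0[OF cc])
    from this[of UNIV] show "x \<in> lattice_cone (e ` J)"
      by (simp add: real_basis_expansion[OF assms])
  qed
qed

lemma rvec_basis_in_lattice_cone_iff:
  assumes "lattice_basis e"
  shows "rvec (e j) \<in> lattice_cone (e ` J) \<longleftrightarrow> j \<in> J"
  by (auto simp: lattice_cone_coordinates[OF assms] inner_rvec pairing_dual_vector[OF assms])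

text \<open>If a proper convex combination of two nonnegative coordinates vanishes, both coordinates
  vanish.\<close>

lemma lattice_cone_face_of:
  assumes "lattice_basis e" "I \<subseteq> J"
  shows "lattice_cone (e ` I) face_of lattice_cone (e ` J)"
  unfolding face_of_def
proof (intro conjI ballI impI)
  show "lattice_cone (e ` I) \<subseteq> lattice_cone (e ` J)"
    using assms(2) by (auto simp: lattice_cone_coordinates[OF assms(1)])
  show "convex (lattice_cone (e ` I))"
    using convex_cone_lattice_cone by (auto simp: convex_cone_def)
  fix x y z assume x: "x \<in> lattice_cone (e ` J)" and y: "y \<in> lattice_cone (e ` J)"
    and z: "z \<in> lattice_cone (e ` I)" and "z \<in> open_segment x y"
  then obtain u where u: "0 < u" "u < 1" "z = (1 - u) *\<^sub>R x + u *\<^sub>R y"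
    by (auto simp: in_segment)
  have "rvec (dual_vector e j) \<bullet> x = 0 \<and> rvec (dual_vector e j) \<bullet> y = 0" if "j \<notin> I" for j
  proof -
    have "(1 - u) * (rvec (dual_vector e j) \<bullet> x) + u * (rvec (dual_vector e j) \<bullet> y) = 0"
      using z that unfolding u(3) by (auto simp: lattice_cone_coordinates[OF assms(1)] inner_add_right)
    moreover have "0 \<le> (1 - u) * (rvec (dual_vector e j) \<bullet> x)" "0 \<le> u * (rvec (dual_vector e j) \<bullet> y)"
      using x y u by (auto simp: lattice_cone_coordinates[OF assms(1)])
    ultimately have "(1 - u) * (rvec (dual_vector e j) \<bullet> x) = 0" "u * (rvec (dual_vector e j) \<bullet> y) = 0"
      by linarith+
    with u show ?thesis by auto
  qed
  with x y show "x \<in> lattice_cone (e ` I)" "y \<in> lattice_cone (e ` I)"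
    by (auto simp: lattice_cone_coordinates[OF assms(1)])
qed

text \<open>The face property concerns open segments, so x + y is read as the midpoint of 2 x and 2
  y. For x = y there is no open segment, and the claim is the hypothesis.\<close>

lemma face_of_cone_summand:
  assumes "\<tau> face_of \<sigma>" "convex_cone \<sigma>" "x + y \<in> \<tau>" "x \<in> \<sigma>" "y \<in> \<sigma>"
  shows "2 *\<^sub>R x \<in> \<tau>"
proof (cases "x = y")
  case True
  with assms(3) show ?thesis
    by (simp add: scaleR_2)
next
  case False
  have "x + y = (1 - 1/2) *\<^sub>R (2 *\<^sub>R x) + (1/2) *\<^sub>R (2 *\<^sub>R y)"
    by simp
  then have "x + y \<in> open_segment (2 *\<^sub>R x) (2 *\<^sub>R y)"
    using False unfolding in_segment by (intro conjI exI[of _ "1/2"]) auto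
  moreover have "2 *\<^sub>R x \<in> \<sigma>" "2 *\<^sub>R y \<in> \<sigma>"
    by (intro convex_cone_scaleR assms; simp)+
  ultimately show ?thesis
    using face_ofD[OF assms(1)] assms(3) by blast
qed

lemma convex_cone_face_of:
  assumes "\<tau> face_of \<sigma>" "convex_cone \<sigma>" "\<tau> \<noteq> {}"
  shows "convex_cone \<tau>"
proof -
  have sub: "\<tau> \<subseteq> \<sigma>" and conv: "convex \<tau>"
    using assms(1) by (auto simp: face_of_def)
  have scale: "c *\<^sub>R x \<in> \<tau>" if x: "x \<in> \<tau>" and c: "0 \<le> c" for c x
  proof (cases "x = 0 \<or> c = 1")
    case True
    with x show ?thesis by auto
  next
    case False
    \<comment> \<open>d lies on the other side of 1 from c, so that x is strictly between c x and d
      x.\<close>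
    define d where "d = (if c < 1 then 2 else 0 :: real)"
    have d: "c \<noteq> d" "0 \<le> d" "(c < 1 \<and> 1 < d) \<or> (d < 1 \<and> 1 < c)"
      using False c by (auto simp: d_def)
    define u where "u = (1 - c) / (d - c)"
    have u: "0 < u" "u < 1" "c + u * (d - c) = 1"
      using d by (auto simp: u_def divide_simps split: if_splits)
    have "(1 - u) *\<^sub>R (c *\<^sub>R x) + u *\<^sub>R (d *\<^sub>R x) = (c + u * (d - c)) *\<^sub>R x"
      by (simp add: algebra_simps)
    then have "x \<in> open_segment (c *\<^sub>R x) (d *\<^sub>R x)"
      using u d False unfolding in_segment by (intro conjI exI[of _ u]) auto
    moreover have "c *\<^sub>R x \<in> \<sigma>" "d *\<^sub>R x \<in> \<sigma>"
      using sub x c d by (auto intro!: convex_cone_scaleR[OF assms(2)])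
    ultimately show ?thesis
      using face_ofD[OF assms(1)] x by blast
  qed
  have "x + y \<in> \<tau>" if "x \<in> \<tau>" "y \<in> \<tau>" for x y
  proof -
    have "(1/2) *\<^sub>R x + (1/2) *\<^sub>R y \<in> \<tau>"
      using conv that by (intro convexD) auto
    from scale[OF this, of 2] show ?thesis
      by (simp add: scaleR_add_right)
  qed
  with scale assms(3) show ?thesis
    unfolding convex_cone_iff by (metis all_not_in_conv scale_zero_left order_refl)
qed

text \<open>If x in the face has a positive coordinate c at e_j, then x - c e_j is still in the
  cone, so the summand c e_j, and with it e_j, belongs to the face.\<close>

lemma face_of_lattice_cone_eq:
  assumes e: "lattice_basis e" and \<tau>: "\<tau> face_of lattice_cone (range e)" "\<tau> \<noteq> {}"
  shows "\<tau> = lattice_cone (e ` {j. rvec (e j) \<in> \<tau>})"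
proof
  have cc: "convex_cone \<tau>"
    by (rule convex_cone_face_of[OF \<tau>(1) convex_cone_lattice_cone \<tau>(2)])
  then show "lattice_cone (e ` {j. rvec (e j) \<in> \<tau>}) \<subseteq> \<tau>"
    by (rule lattice_cone_subset) auto
  show "\<tau> \<subseteq> lattice_cone (e ` {j. rvec (e j) \<in> \<tau>})"
  proof
    fix x assume x: "x \<in> \<tau>"
    then have xc: "x \<in> lattice_cone (range e)"
      using \<tau>(1) by (auto simp: face_of_def)
    have "rvec (e j) \<in> \<tau>" if "rvec (dual_vector e j) \<bullet> x \<noteq> 0" for j
    proof -
      define c where "c = rvec (dual_vector e j) \<bullet> x"
      have c: "0 < c"
        using xc that by (auto simp: c_def lattice_cone_coordinates[OF e] order_less_le)
      have "c *\<^sub>R rvec (e j) \<in> lattice_cone (range e)"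
        using c by (intro convex_cone_scaleR[OF convex_cone_lattice_cone] rvec_in_lattice_cone) auto
      moreover have "x - c *\<^sub>R rvec (e j) \<in> lattice_cone (range e)"
        using xc by (auto simp: lattice_cone_coordinates[OF e] inner_diff_right inner_rvec
            pairing_dual_vector[OF e] c_def)
      ultimately have "2 *\<^sub>R c *\<^sub>R rvec (e j) \<in> \<tau>"
        using x by (intro face_of_cone_summand[OF \<tau>(1) convex_cone_lattice_cone, of _ "x - c *\<^sub>R rvec (e j)"]) auto
      from convex_cone_scaleR[OF cc _ this, of "1 / (2 * c)"] c show ?thesis
        by simp
    qed
    with xc show "x \<in> lattice_cone (e ` {j. rvec (e j) \<in> \<tau>})"
      by (auto simp: lattice_cone_coordinates[OF e])
  qed
qed

lemma perp_lattice_cone: "perp (lattice_cone S) = {u. \<forall>w\<in>S. pairing u w = 0}"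
proof -
  have "u \<in> perp (lattice_cone S)" if "\<forall>w\<in>S. pairing u w = 0" for u
  proof -
    have "convex_cone {x. rvec u \<bullet> x = 0}"
      unfolding convex_cone_iff by (auto simp: inner_add_right)
    then have "lattice_cone S \<subseteq> {x. rvec u \<bullet> x = 0}"
      by (rule lattice_cone_subset) (use that in \<open>auto simp: inner_rvec\<close>)
    then show ?thesis
      by (auto simp: perp_def)
  qed
  moreover have "pairing u w = 0" if "u \<in> perp (lattice_cone S)" "w \<in> S" for u w
    using that rvec_in_lattice_cone[of w S] inner_rvec[of u w] by (auto simp: perp_def)
  ultimately show ?thesis by auto
qed

section \<open>Maximal cones of a smooth complete fan\<close>

lemma smooth_fan_cone:
  assumes "smooth_fan \<Sigma>" "\<sigma> \<in> \<Sigma>"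
  shows "\<exists>e J. lattice_basis e \<and> \<sigma> = lattice_cone (e ` J)"
  using assms by (simp add: smooth_fan_def)

text \<open>A missing basis vector would confine the cone to a hyperplane.\<close>

lemma smooth_fan_max_cone:
  assumes "smooth_fan \<Sigma>" "\<sigma> \<in> \<Sigma>" "dim \<sigma> = CARD('n)"
  obtains e :: "'n::finite \<Rightarrow> int^'n" where "lattice_basis e" "\<sigma> = lattice_cone (range e)"
proof -
  obtain e J where e: "lattice_basis e" "\<sigma> = lattice_cone (e ` J)"
    using smooth_fan_cone[OF assms(1,2)] by blast
  have "j \<in> J" for j
  proof (rule ccontr)
    assume "j \<notin> J"
    then have "\<sigma> \<subseteq> {x. rvec (dual_vector e j) \<bullet> x = 0}"
      unfolding e(2) by (auto simp: lattice_cone_coordinates[OF e(1)])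
    then have "dim \<sigma> \<le> dim {x. rvec (dual_vector e j) \<bullet> x = 0}"
      by (rule dim_subset)
    moreover have "rvec (dual_vector e j) \<noteq> 0"
      using pairing_dual_vector[OF e(1), of j j] inner_rvec[of "dual_vector e j" "e j"] by auto
    from dim_hyperplane[OF this] have "dim {x. rvec (dual_vector e j) \<bullet> x = 0} = CARD('n) - 1"
      by simp
    ultimately show False
      using assms(3) zero_less_card_finite[where 'a='n] by linarith
  qed
  then have "J = UNIV" by auto
  with e show ?thesis
    using that by blast
qed

lemma primitive_basis_vector:
  assumes "lattice_basis e"
  shows "primitive (e j)"
  unfolding primitive_def
proof (intro allI impI)
  fix k w assume "e j = k *s w"
  then have "k * pairing (dual_vector e j) w = 1"
    using pairing_dual_vector[OF assms, of j j] by (simp add: pairing_scale_right)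
  then show "\<bar>k\<bar> = 1"
    by (metis abs_zmult_eq_1 zmult_eq_1_iff abs_1 abs_minus_cancel)
qed

text \<open>Each e_j spans a face of the cone and hence a ray of the fan. Conversely, a ray of the
  fan inside the cone is a face of it, so it contains some e_j, and primitivity identifies the
  generators.\<close>

lemma ray_generators_in_max_cone:
  assumes "smooth_fan \<Sigma>" "ray_generators \<Sigma> v" "lattice_basis e" "lattice_cone (range e) \<in> \<Sigma>"
  shows "v ` {i. rvec (v i) \<in> lattice_cone (range e)} = range e"
proof -
  let ?\<sigma> = "lattice_cone (range e)"
  have fan: "fan \<Sigma>"
    using assms(1) by (simp add: smooth_fan_def)
  have v: "range v = {u. primitive u \<and> lattice_cone {u} \<in> \<Sigma>}"
    using assms(2) by (simp add: ray_generators_def bij_betw_def)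
  show ?thesis
  proof
    show "range e \<subseteq> v ` {i. rvec (v i) \<in> ?\<sigma>}"
    proof
      fix u assume "u \<in> range e"
      then obtain j where j: "u = e j" by blast
      have "lattice_cone (e ` {j}) face_of ?\<sigma>"
        by (rule lattice_cone_face_of[OF assms(3)]) simp
      moreover have "lattice_cone (e ` {j}) \<noteq> {}"
        using rvec_in_lattice_cone by blast
      ultimately have "lattice_cone {e j} \<in> \<Sigma>"
        using fan assms(4) unfolding fan_def by auto
      then have "e j \<in> range v"
        using primitive_basis_vector[OF assms(3)] v by simp
      moreover have "rvec (e j) \<in> ?\<sigma>"
        by (rule rvec_in_lattice_cone) simp
      ultimately show "u \<in> v ` {i. rvec (v i) \<in> ?\<sigma>}"
        unfolding j by auto
    qed
    show "v ` {i. rvec (v i) \<in> ?\<sigma>} \<subseteq> range e"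
    proof clarify
      fix i assume i: "rvec (v i) \<in> ?\<sigma>"
      have prim: "primitive (v i)" and "lattice_cone {v i} \<in> \<Sigma>"
        using v by auto
      moreover have sub: "lattice_cone {v i} \<subseteq> ?\<sigma>"
        using i by (intro lattice_cone_subset convex_cone_lattice_cone) auto
      \<comment> \<open>The ray is its own intersection with the cone, and the fan axiom makes
        intersections faces.\<close>
      ultimately have face: "lattice_cone {v i} face_of ?\<sigma>"
        using fan assms(4) unfolding fan_def by (metis inf.absorb1)
      have ne: "lattice_cone {v i} \<noteq> {}"
        using rvec_in_lattice_cone by blast
      have "v i \<noteq> 0"
      proof
        assume "v i = 0"
        then have "v i = 0 *s 0" by simp
        with prim have "\<bar>0 :: int\<bar> = 1"
          unfolding primitive_def by blast
        then show False by simp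
      qed
      have "\<exists>j. rvec (e j) \<in> lattice_cone {v i}"
      proof (rule ccontr)
        assume "\<nexists>j. rvec (e j) \<in> lattice_cone {v i}"
        then have "lattice_cone {v i} = {0}"
          using face_of_lattice_cone_eq[OF assms(3) face ne] by (simp add: lattice_cone_def)
        then show False
          using rvec_in_lattice_cone[of "v i" "{v i}"] \<open>v i \<noteq> 0\<close> rvec_eq_iff[of "v i" 0] by simp
      qed
      then obtain j where j: "rvec (e j) \<in> lattice_cone {v i}" ..
      have "convex_cone {c *\<^sub>R rvec (v i) |c. 0 \<le> c}"
        unfolding convex_cone_iff
      proof (intro conjI ballI allI impI)
        show "0 \<in> {c *\<^sub>R rvec (v i) |c. 0 \<le> c}"
          by (auto intro: exI[of _ 0])
      next
        fix x y assume "x \<in> {c *\<^sub>R rvec (v i) |c. 0 \<le> c}" "y \<in> {c *\<^sub>R rvec (v i) |c. 0 \<le> c}"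
        then obtain c c' where "x = c *\<^sub>R rvec (v i)" "y = c' *\<^sub>R rvec (v i)" "0 \<le> c" "0 \<le> c'"
          by auto
        then show "x + y \<in> {c *\<^sub>R rvec (v i) |c. 0 \<le> c}"
          by (auto intro!: exI[of _ "c + c'"] simp: scaleR_left_distrib)
      next
        fix x and a :: real assume "x \<in> {c *\<^sub>R rvec (v i) |c. 0 \<le> c}" "0 \<le> a"
        then obtain c where "x = c *\<^sub>R rvec (v i)" "0 \<le> c"
          by auto
        then show "a *\<^sub>R x \<in> {c *\<^sub>R rvec (v i) |c. 0 \<le> c}"
          using \<open>0 \<le> a\<close> by (auto intro!: exI[of _ "a * c"])
      qed
      then have "lattice_cone {v i} \<subseteq> {c *\<^sub>R rvec (v i) |c. 0 \<le> c}"
        by (rule lattice_cone_subset) (auto intro: exI[of _ 1])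
      with j obtain c where c: "rvec (e j) = c *\<^sub>R rvec (v i)" "0 \<le> c" by auto
      have "c * of_int (pairing (dual_vector e k) (v i)) = (if k = j then 1 else 0)" for k
      proof -
        have "rvec (dual_vector e k) \<bullet> rvec (e j) = c * (rvec (dual_vector e k) \<bullet> rvec (v i))"
          unfolding c(1) by simp
        then show ?thesis
          unfolding inner_rvec by (auto simp: pairing_dual_vector[OF assms(3)] split: if_splits)
      qed
      note cj = this
      have "c \<noteq> 0" using cj[of j] by auto
      \<comment> \<open>Comparing coordinates gives v i = k e_j with c k = 1; since c is
        nonnegative, k is positive, and primitivity leaves k = 1.\<close>
      define k where "k = pairing (dual_vector e j) (v i)"
      have "pairing (dual_vector e l) (v i) = 0" if "l \<noteq> j" for l
        using cj[of l] that \<open>c \<noteq> 0\<close> by simp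
      then have "v i = k *s e j"
        using lattice_basis_expansion[OF assms(3), of "v i"] sum.remove[of UNIV j "\<lambda>l. pairing (dual_vector e l) (v i) *s e l"]
        by (simp add: k_def)
      moreover have "0 < k"
        using cj[of j] c(2) \<open>c \<noteq> 0\<close> unfolding k_def[symmetric]
        by (metis mult_less_0_iff not_less_iff_gr_or_eq of_int_0_less_iff of_int_0_eq_iff mult_zero_right
            order_less_le zero_less_mult_iff zero_less_one of_int_less_0_iff zero_neq_one)
      moreover have "\<bar>k\<bar> = 1"
        using prim calculation(1) unfolding primitive_def by blast
      ultimately show "v i \<in> range e" by simp
    qed
  qed
qed

text \<open>The generators listed by b and the basis vectors of the cone form the same set, so the
  two lists differ by a permutation.\<close>

lemma ordered_max_coneD:
  assumes "smooth_fan \<Sigma>" "ray_generators \<Sigma> v" "ordered_max_cone \<Sigma> v b"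
  shows "lattice_basis (\<lambda>j. v (b j))"
    and "lattice_cone (range (\<lambda>j. v (b j))) \<in> \<Sigma>"
    and "rvec (v i) \<in> lattice_cone (range (\<lambda>j. v (b j))) \<Longrightarrow> i \<in> range b"
    and "inj b"
proof -
  obtain \<sigma> where \<sigma>: "\<sigma> \<in> \<Sigma>" "dim \<sigma> = CARD('a)" and b: "bij_betw b UNIV {i. rvec (v i) \<in> \<sigma>}"
    using assms(3) unfolding ordered_max_cone_def by blast
  obtain e :: "'a \<Rightarrow> int^'a" where e: "lattice_basis e" "\<sigma> = lattice_cone (range e)"
    using smooth_fan_max_cone[OF assms(1) \<sigma>] by blast
  have "inj v"
    using assms(2) by (simp add: ray_generators_def bij_betw_def)
  have ran: "range (\<lambda>j. v (b j)) = range e"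
  proof -
    have "range (\<lambda>j. v (b j)) = v ` {i. rvec (v i) \<in> \<sigma>}"
      using b by (simp add: bij_betw_def image_image[symmetric, of v b])
    also have "\<dots> = range e"
      using ray_generators_in_max_cone[OF assms(1,2) e(1)] \<sigma>(1) e(2) by simp
    finally show ?thesis .
  qed
  have "inj e"
    by (rule injI) (metis pairing_dual_vector[OF e(1)] zero_neq_one)
  define \<pi> where "\<pi> j = inv e (v (b j))" for j
  have e\<pi>: "e (\<pi> j) = v (b j)" for j
    unfolding \<pi>_def using ran by (intro f_inv_into_f) auto
  show "inj b"
    using b by (simp add: bij_betw_def)
  then have "inj \<pi>"
    using e\<pi> \<open>inj v\<close> by (metis injD injI)
  then have "bij \<pi>"
    by (simp add: bij_def finite_UNIV_inj_surj)
  then show "lattice_basis (\<lambda>j. v (b j))"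
    using lattice_basis_permute[OF e(1)] by (simp add: comp_def flip: e\<pi>)
  show "lattice_cone (range (\<lambda>j. v (b j))) \<in> \<Sigma>"
    unfolding ran using e(2) \<sigma>(1) by simp
  show "i \<in> range b" if "rvec (v i) \<in> lattice_cone (range (\<lambda>j. v (b j)))"
    using that b unfolding ran by (auto simp: bij_betw_def e(2))
qed

text \<open>Cones of lower dimension are null sets. The complement of the finitely many closed
  maximal cones is open and contained in a null set, hence empty.\<close>

lemma complete_fan_max_cones_cover:
  fixes \<Sigma> :: "(real^'n::finite) set set"
  assumes "smooth_fan \<Sigma>" "complete_fan \<Sigma>"
  shows "\<Union>{\<sigma> \<in> \<Sigma>. dim \<sigma> = CARD('n)} = UNIV"
proof -
  have fin: "finite \<Sigma>"
    using assms(1) by (simp add: smooth_fan_def fan_def)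
  have closed: "closed \<sigma>" if \<sigma>: "\<sigma> \<in> \<Sigma>" for \<sigma>
  proof -
    obtain e :: "'n \<Rightarrow> int^'n" and J where "lattice_basis e" "\<sigma> = lattice_cone (e ` J)"
      using smooth_fan_cone[OF assms(1) \<sigma>] by blast
    then show ?thesis
      unfolding lattice_cone_def by (auto intro: closed_convex_cone_hull)
  qed
  have neg: "negligible \<sigma>" if "\<sigma> \<in> \<Sigma>" "dim \<sigma> \<noteq> CARD('n)" for \<sigma>
    using that(2) dim_subset_UNIV[of \<sigma>] by (intro negligible_lowdim) simp
  define F where "F = \<Union>{\<sigma> \<in> \<Sigma>. dim \<sigma> = CARD('n)}"
  define E where "E = \<Union>{\<sigma> \<in> \<Sigma>. dim \<sigma> \<noteq> CARD('n)}"
  have "negligible E"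
    unfolding E_def using fin neg by (intro negligible_Union) auto
  moreover have "- F \<subseteq> E"
  proof
    fix x assume "x \<in> - F"
    moreover have "x \<in> \<Union>\<Sigma>"
      using assms(2) by (simp add: complete_fan_def)
    ultimately show "x \<in> E"
      by (auto simp: F_def E_def)
  qed
  ultimately have "negligible (- F)"
    using negligible_subset by blast
  moreover have "open (- F)"
    unfolding F_def using fin closed by (intro open_Compl closed_Union) auto
  ultimately have "- F = {}"
    using open_not_negligible by blast
  then show ?thesis
    by (auto simp: F_def)
qed

text \<open>The sum x of the generators of \<open>\<tau>\<close> lies in some maximal cone
  \<open>\<sigma>\<close>. The intersection of the two cones is a face of \<open>\<tau>\<close>
  containing x, so it contains every summand of x; thus \<open>\<tau>\<close> lies in
  \<open>\<sigma>\<close> and is a face of it.\<close>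

lemma face_of_max_cone:
  fixes \<Sigma> :: "(real^'n::finite) set set" and v :: "'d::finite \<Rightarrow> int^'n"
  assumes \<Sigma>: "smooth_fan \<Sigma>" "complete_fan \<Sigma>" "ray_generators \<Sigma> v" and \<tau>: "\<tau> \<in> \<Sigma>"
  obtains b J where "ordered_max_cone \<Sigma> v b" "\<tau> = lattice_cone ((\<lambda>j. v (b j)) ` J)"
proof -
  obtain f I where f: "lattice_basis f" "\<tau> = lattice_cone (f ` I)"
    using smooth_fan_cone[OF \<Sigma>(1) \<tau>] by blast
  define x where "x = (\<Sum>j\<in>I. rvec (f j))"
  obtain \<sigma> where \<sigma>: "\<sigma> \<in> \<Sigma>" "dim \<sigma> = CARD('n)" "x \<in> \<sigma>"
    using complete_fan_max_cones_cover[OF \<Sigma>(1,2)] by blast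
  have cc: "convex_cone \<tau>"
    unfolding f(2) by (rule convex_cone_lattice_cone)
  obtain e :: "'n \<Rightarrow> int^'n" where e: "lattice_basis e" "\<sigma> = lattice_cone (range e)"
    using smooth_fan_max_cone[OF \<Sigma>(1) \<sigma>(1,2)] by blast
  have faces: "(\<tau> \<inter> \<sigma>) face_of \<tau>" "(\<tau> \<inter> \<sigma>) face_of \<sigma>"
    using \<Sigma>(1) \<tau> \<sigma>(1) unfolding smooth_fan_def fan_def by auto
  have sum_in: "(\<Sum>j\<in>A. rvec (f j)) \<in> \<tau>" if "A \<subseteq> I" for A
    using finite_subset[OF that finite] that
    by (induction A rule: finite_induct)
       (auto simp: f(2) intro!: convex_cone_add[OF convex_cone_lattice_cone] rvec_in_lattice_cone
          convex_cone_contains_0[OF convex_cone_lattice_cone])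
  have x: "x \<in> \<tau> \<inter> \<sigma>"
    using \<sigma>(3) sum_in[of I] by (simp add: x_def)
  have cc': "convex_cone (\<tau> \<inter> \<sigma>)"
    using convex_cone_face_of[OF faces(1) cc] x by blast
  have "rvec (f j) \<in> \<tau> \<inter> \<sigma>" if "j \<in> I" for j
  proof -
    have "x = rvec (f j) + (\<Sum>j\<in>I - {j}. rvec (f j))"
      unfolding x_def using that by (simp add: sum.remove)
    then have "2 *\<^sub>R rvec (f j) \<in> \<tau> \<inter> \<sigma>"
      using x that sum_in by (intro face_of_cone_summand[OF faces(1) cc, of _ "\<Sum>j\<in>I - {j}. rvec (f j)"])
        (auto simp: f(2) intro!: rvec_in_lattice_cone)
    from convex_cone_scaleR[OF cc' _ this, of "1/2"] show ?thesis by simp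
  qed
  then have "\<tau> \<subseteq> \<tau> \<inter> \<sigma>"
    unfolding f(2) by (intro lattice_cone_subset) (use cc' f(2) in auto)
  then have "\<tau> \<inter> \<sigma> = \<tau>" by blast
  then have face: "\<tau> face_of lattice_cone (range e)"
    using faces(2) e(2) by simp
  have inj: "inj v"
    using \<Sigma>(3) by (simp add: ray_generators_def bij_betw_def)
  have ran: "v ` {i. rvec (v i) \<in> \<sigma>} = range e"
    using ray_generators_in_max_cone[OF \<Sigma>(1,3) e(1)] \<sigma>(1) e(2) by simp
  define b where "b j = inv v (e j)" for j
  have vb: "v (b j) = e j" for j
    unfolding b_def
  proof (rule f_inv_into_f)
    have "e j \<in> v ` {i. rvec (v i) \<in> \<sigma>}"
      unfolding ran by simp
    then show "e j \<in> range v" by blast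
  qed
  have "inj e"
    by (rule injI) (metis pairing_dual_vector[OF e(1)] zero_neq_one)
  then have "inj b"
    using vb by (metis injD injI)
  moreover have "range b = {i. rvec (v i) \<in> \<sigma>}"
  proof
    show "range b \<subseteq> {i. rvec (v i) \<in> \<sigma>}"
      using vb e(2) by (auto intro: rvec_in_lattice_cone)
    show "{i. rvec (v i) \<in> \<sigma>} \<subseteq> range b"
    proof
      fix i assume "i \<in> {i. rvec (v i) \<in> \<sigma>}"
      then obtain j where "v i = e j"
        using ran by blast
      then have "i = b j"
        using vb inj by (metis injD)
      then show "i \<in> range b" by blast
    qed
  qed
  ultimately have "ordered_max_cone \<Sigma> v b"
    unfolding ordered_max_cone_def bij_betw_def using \<sigma>(1,2) by blast
  moreover have "\<tau> = lattice_cone ((\<lambda>j. v (b j)) ` {j. rvec (e j) \<in> \<tau>})"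
    using face_of_lattice_cone_eq[OF e(1) face] x by (auto simp: vb)
  ultimately show ?thesis
    by (rule that)
qed

section \<open>Points and fibres in coordinate charts\<close>

lemma linear_cone_point: "linear (cone_point v b)"
  unfolding cone_point_def
  by (intro linearI) (simp_all add: scaleR_left_distrib sum.distrib scaleR_sum_right)

lemma cone_point_axis: "cone_point v b (axis j 1) = rvec (v (b j))"
  unfolding cone_point_def axis_def by (simp add: if_distrib[of "\<lambda>c. c *\<^sub>R _"] cong: if_cong)

lemma inner_cone_point: "rvec u \<bullet> cone_point v b t = (\<Sum>j\<in>UNIV. t $ j * of_int (pairing u (v (b j))))"
  by (simp add: cone_point_def inner_sum_right inner_rvec)

definition cexp :: "real^'n \<Rightarrow> real^'n \<Rightarrow> complex^'n::finite" where
  "cexp t \<theta> = (\<chi> j. exp (Complex (t $ j) (\<theta> $ j)))"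

lemma cexp_nth [simp]: "cexp t \<theta> $ j = exp (Complex (t $ j) (\<theta> $ j))"
  by (simp add: cexp_def)

text \<open>The section 1 over the open orbit: as 1 = chi^(-m) chi^m, its coordinate in the frame
  chi^m is the value of chi^(-m). The formula is the same for every divisor.\<close>

definition unit_section :: "'n tpoint \<Rightarrow> int^'n::finite \<Rightarrow> complex" where
  "unit_section x = (\<lambda>m. snd x (- m))"

lemma perp_add: "u \<in> perp \<tau> \<Longrightarrow> u' \<in> perp \<tau> \<Longrightarrow> u + u' \<in> perp \<tau>"
  and perp_scale: "u \<in> perp \<tau> \<Longrightarrow> k *s u \<in> perp \<tau>"
  and perp_0 [simp]: "0 \<in> perp \<tau>"
  by (auto simp: perp_def rvec_add rvec_scale inner_add_left)

lemma perp_origin [simp]: "perp {0} = UNIV"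
  by (simp add: perp_def)

context
  fixes \<tau> :: "(real^'n::finite) set" and \<gamma> :: "int^'n \<Rightarrow> complex"
  assumes orbit: "(\<tau>, \<gamma>) \<in> torus_orbit \<tau>"
begin

lemma orbit_nonzero: "\<gamma> u \<noteq> 0 \<longleftrightarrow> u \<in> perp \<tau>"
  and orbit_add: "u \<in> perp \<tau> \<Longrightarrow> u' \<in> perp \<tau> \<Longrightarrow> \<gamma> (u + u') = \<gamma> u * \<gamma> u'"
  using orbit by (auto simp: torus_orbit_def)

lemma orbit_0: "\<gamma> 0 = 1"
  using orbit_add[of 0 0] orbit_nonzero[of 0] by simp

lemma orbit_scale:
  assumes u: "u \<in> perp \<tau>"
  shows "\<gamma> (k *s u) = \<gamma> u powi k"
proof -
  have nz: "\<gamma> u \<noteq> 0"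
    using u orbit_nonzero by simp
  have nat: "\<gamma> (int n *s u) = \<gamma> u ^ n" for n
  proof (induction n)
    case 0
    have "0 *s u = 0" by (simp add: vec_eq_iff)
    then show ?case by (simp add: orbit_0)
  next
    case (Suc n)
    have "int (Suc n) *s u = u + int n *s u"
      by (simp add: vec_eq_iff algebra_simps)
    then show ?case
      using Suc orbit_add[OF u perp_scale[OF u]] by simp
  qed
  show ?thesis
  proof (cases "k \<ge> 0")
    case True
    then show ?thesis
      using nat[of "nat k"] by (simp add: power_int_def)
  next
    case False
    have "k *s u + int (nat (- k)) *s u = 0"
      using False by (simp add: vec_eq_iff)
    then have "\<gamma> (k *s u) * \<gamma> u ^ nat (- k) = 1"
      using orbit_add[OF perp_scale[OF u, of k] perp_scale[OF u, of "int (nat (- k))"]]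
      unfolding nat by (simp only: orbit_0)
    then show ?thesis
      using False nz by (simp add: power_int_def field_simps)
  qed
qed

lemma orbit_sum:
  assumes "\<And>j. j \<in> A \<Longrightarrow> f j \<in> perp \<tau>" "finite A"
  shows "\<gamma> (\<Sum>j\<in>A. f j) = (\<Prod>j\<in>A. \<gamma> (f j))"
proof -
  have "(\<Sum>j\<in>A. f j) \<in> perp \<tau> \<and> \<gamma> (\<Sum>j\<in>A. f j) = (\<Prod>j\<in>A. \<gamma> (f j))"
    using assms(2,1) by (induction A rule: finite_induct) (auto simp: orbit_0 orbit_add perp_add)
  then show ?thesis ..
qed

end

locale toric_fan =
  fixes \<Sigma> :: "(real^'n::finite) set set" and v :: "'d::finite \<Rightarrow> int^'n"
  assumes smooth: "smooth_fan \<Sigma>" and complete: "complete_fan \<Sigma>" and rays: "ray_generators \<Sigma> v"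
begin

abbreviation chart :: "('n \<Rightarrow> 'd) \<Rightarrow> bool" where
  "chart b \<equiv> ordered_max_cone \<Sigma> v b"

abbreviation gen :: "('n \<Rightarrow> 'd) \<Rightarrow> 'n \<Rightarrow> int^'n" where
  "gen b j \<equiv> v (b j)"

lemmas chart_basis = ordered_max_coneD(1)[OF smooth rays]
  and chart_cone = ordered_max_coneD(2)[OF smooth rays]
  and chart_ray = ordered_max_coneD(3)[OF smooth rays]
  and chart_inj = ordered_max_coneD(4)[OF smooth rays]

lemma chart_exists: obtains b where "chart b"
proof -
  obtain \<tau> where "\<tau> \<in> \<Sigma>"
    using smooth by (auto simp: smooth_fan_def fan_def)
  then show ?thesis
    using face_of_max_cone[OF smooth complete rays] that by metis
qed

lemma chart_face:
  assumes "chart b"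
  shows "lattice_cone (gen b ` J) \<in> \<Sigma>"
proof -
  have "lattice_cone (gen b ` J) face_of lattice_cone (range (gen b))"
    by (rule lattice_cone_face_of[OF chart_basis[OF assms]]) simp
  moreover have "lattice_cone (gen b ` J) \<noteq> {}"
    by (simp add: lattice_cone_def convex_cone_hull_nonempty)
  ultimately show ?thesis
    using smooth chart_cone[OF assms] unfolding smooth_fan_def fan_def by blast
qed

lemma cone_point_inverse:
  assumes "chart b"
  shows "cone_point v b (\<chi> j. rvec (dual_vector (gen b) j) \<bullet> \<xi>) = \<xi>"
  using real_basis_expansion[OF chart_basis[OF assms]] by (simp add: cone_point_def)

lemma cone_point_surj:
  assumes "chart b"
  obtains t where "\<xi> = cone_point v b t"
  using cone_point_inverse[OF assms] by metis

lemma fst_chart_point: "fst (chart_point v b z) = lattice_cone (gen b ` {j. z $ j = 0})"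
  by (simp add: chart_point_def Let_def setcompr_eq_image)

lemma perp_chart_point:
  "perp (fst (chart_point v b z)) = {u. \<forall>j. z $ j = 0 \<longrightarrow> pairing u (gen b j) = 0}"
  by (auto simp: fst_chart_point perp_lattice_cone)

lemma snd_chart_point:
  "snd (chart_point v b z) u =
    (if u \<in> perp (fst (chart_point v b z)) then \<Prod>j\<in>UNIV. (z $ j) powi (pairing u (gen b j)) else 0)"
  by (simp add: chart_point_def Let_def)

lemma chart_point_in_orbit:
  assumes "chart b"
  shows "chart_point v b z \<in> torus_orbit (fst (chart_point v b z))"
proof -
  have "(\<Prod>j\<in>UNIV. (z $ j) powi (pairing u (gen b j))) \<noteq> 0" if "u \<in> perp (fst (chart_point v b z))" for u
    using that unfolding perp_chart_point by (auto simp: power_int_not_zero)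
  moreover have "(\<Prod>j\<in>UNIV. (z $ j) powi (pairing (u + u') (gen b j))) =
      (\<Prod>j\<in>UNIV. (z $ j) powi (pairing u (gen b j))) * (\<Prod>j\<in>UNIV. (z $ j) powi (pairing u' (gen b j)))"
    if "u \<in> perp (fst (chart_point v b z))" "u' \<in> perp (fst (chart_point v b z))" for u u'
    unfolding prod.distrib[symmetric]
  proof (rule prod.cong[OF refl])
    fix j
    show "z $ j powi pairing (u + u') (gen b j) = z $ j powi pairing u (gen b j) * z $ j powi pairing u' (gen b j)"
      \<comment> \<open>If z_j = 0, the exponents vanish because u and u' lie in
        \<open>perp\<close>, and \<open>0 powi 0 = 1\<close>.\<close>
      using that unfolding perp_chart_point pairing_add_left
      by (cases "z $ j = 0") (auto simp: power_int_add)
  qed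
  ultimately show ?thesis
    unfolding torus_orbit_def mem_Times_iff by (auto simp: snd_chart_point perp_add)
qed

lemma chart_point_in_toric_variety:
  assumes "chart b"
  shows "chart_point v b z \<in> toric_variety \<Sigma>"
  using chart_point_in_orbit[OF assms] chart_face[OF assms]
  unfolding toric_variety_def by (metis UN_I fst_chart_point)

text \<open>The cone of x is a face of a maximal cone. Its rays get the coordinate 0, and each other
  coordinate is the value of \<open>\<gamma>\<close> at the dual basis vector, which lies in
  \<open>perp\<close>; elements of \<open>perp\<close> expand in these vectors alone, so x is
  recovered.\<close>

lemma toric_variety_covered_by_charts:
  assumes "x \<in> toric_variety \<Sigma>"
  obtains b z where "chart b" "x = chart_point v b z"
proof -
  obtain \<tau> \<gamma> where x: "x = (\<tau>, \<gamma>)" and \<tau>: "\<tau> \<in> \<Sigma>" and orbit: "(\<tau>, \<gamma>) \<in> torus_orbit \<tau>"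
    using assms by (auto simp: toric_variety_def torus_orbit_def)
  obtain b J where b: "chart b" and J: "\<tau> = lattice_cone (gen b ` J)"
    using face_of_max_cone[OF smooth complete rays \<tau>] by blast
  note dual = pairing_dual_vector[OF chart_basis[OF b]]
  define m where "m = dual_vector (gen b)"
  have perp: "perp \<tau> = {u. \<forall>j\<in>J. pairing u (gen b j) = 0}"
    unfolding J by (simp add: perp_lattice_cone)
  have m: "m j \<in> perp \<tau>" if "j \<notin> J" for j
    using that by (auto simp: perp m_def dual)
  define z where "z = (\<chi> j. if j \<in> J then 0 else \<gamma> (m j))"
  have "\<gamma> (m j) \<noteq> 0" if "j \<notin> J" for j
    using orbit_nonzero[OF orbit] m[OF that] by simp
  then have zero: "{j. z $ j = 0} = J"
    by (auto simp: z_def)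
  have fst: "fst (chart_point v b z) = \<tau>"
    by (simp add: fst_chart_point zero J)
  have "snd (chart_point v b z) u = \<gamma> u" for u
  proof (cases "u \<in> perp \<tau>")
    case False
    then show ?thesis
      using orbit_nonzero[OF orbit, of u] by (simp add: snd_chart_point fst)
  next
    case True
    have "u = (\<Sum>j\<in>UNIV. pairing u (gen b j) *s m j)"
      unfolding m_def by (rule dual_vector_expansion[OF chart_basis[OF b], symmetric])
    also have "\<dots> = (\<Sum>j\<in>- J. pairing u (gen b j) *s m j)"
      using True by (intro sum.mono_neutral_right) (auto simp: perp vec_eq_iff)
    finally have "\<gamma> u = \<gamma> (\<Sum>j\<in>- J. pairing u (gen b j) *s m j)"
      by simp
    also have "\<dots> = (\<Prod>j\<in>- J. \<gamma> (m j) powi pairing u (gen b j))"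
      using m by (subst orbit_sum[OF orbit]) (auto intro!: perp_scale prod.cong orbit_scale[OF orbit])
    also have "\<dots> = (\<Prod>j\<in>UNIV. z $ j powi pairing u (gen b j))"
      using True by (intro prod.mono_neutral_cong_left) (auto simp: z_def perp)
    finally show ?thesis
      using True by (simp add: snd_chart_point fst)
  qed
  then have "chart_point v b z = x"
    unfolding x using fst by (auto simp: prod_eq_iff)
  with b show ?thesis
    using that by metis
qed

section \<open>Fibres of the line bundle over a chart\<close>

lemma ray_in_chart_cone_iff:
  assumes "chart b"
  shows "rvec (v i) \<in> fst (chart_point v b z) \<longleftrightarrow> (\<exists>j. i = b j \<and> z $ j = 0)"
proof
  assume i: "rvec (v i) \<in> fst (chart_point v b z)"
  then have "rvec (v i) \<in> lattice_cone (range (gen b))"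
    unfolding fst_chart_point
    using lattice_cone_face_of[OF chart_basis[OF assms], of "{j. z $ j = 0}" UNIV] by (auto simp: face_of_def)
  then obtain j where "i = b j"
    using chart_ray[OF assms] by blast
  with i show "\<exists>j. i = b j \<and> z $ j = 0"
    using rvec_basis_in_lattice_cone_iff[OF chart_basis[OF assms], of j "{j. z $ j = 0}"]
    by (auto simp: fst_chart_point)
next
  assume "\<exists>j. i = b j \<and> z $ j = 0"
  then show "rvec (v i) \<in> fst (chart_point v b z)"
    by (auto simp: fst_chart_point intro!: rvec_in_lattice_cone)
qed

lemma local_generators_chart:
  assumes "chart b"
  shows "local_generators v a (fst (chart_point v b z)) =
    {m. \<forall>j. z $ j = 0 \<longrightarrow> pairing m (gen b j) = - (a $ b j)}"
  using ray_in_chart_cone_iff[OF assms] by (auto simp: local_generators_def)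

lemma local_generators_nonempty:
  assumes "chart b"
  obtains m where "m \<in> local_generators v a (fst (chart_point v b z))"
proof
  \<comment> \<open>The exponent of the chart frame, which is a local generator at every point of
    the chart.\<close>
  show "(\<Sum>j\<in>UNIV. - (a $ b j) *s dual_vector (gen b) j) \<in> local_generators v a (fst (chart_point v b z))"
    unfolding local_generators_chart[OF assms]
    by (auto simp: pairing_sum_left pairing_scale_left pairing_dual_vector[OF chart_basis[OF assms]]
        if_distrib sum_negf cong: if_cong)
qed

lemma chart_frame_nonzero:
  assumes "chart b"
  shows "chart_frame v a b z m \<noteq> 0 \<longleftrightarrow> m \<in> local_generators v a (fst (chart_point v b z))"
  unfolding chart_frame_def local_generators_chart[OF assms]
  by (auto simp: power_int_not_zero)

lemma chart_frame_in_fibre: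
  assumes "chart b"
  shows "chart_frame v a b z \<in> fibre v a (chart_point v b z)"
proof -
  let ?lg = "local_generators v a (fst (chart_point v b z))"
  have "chart_frame v a b z m = snd (chart_point v b z) u * chart_frame v a b z (m + u)"
    if m: "m \<in> ?lg" and u: "u \<in> perp (fst (chart_point v b z))" for m u
  proof -
    have mu: "m + u \<in> ?lg"
      using m u unfolding local_generators_chart[OF assms] perp_chart_point by (auto simp: pairing_add_left)
    have "z $ j powi (- (a $ b j) - pairing m (gen b j)) =
        z $ j powi pairing u (gen b j) * z $ j powi (- (a $ b j) - pairing (m + u) (gen b j))" for j
      using m u unfolding local_generators_chart[OF assms] perp_chart_point pairing_add_left
      by (cases "z $ j = 0") (auto simp: power_int_add[symmetric])
    then show ?thesis
      using m u mu by (simp add: chart_frame_def snd_chart_point prod.distrib[symmetric])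
  qed
  then show ?thesis
    unfolding fibre_def using chart_frame_nonzero[OF assms] by blast
qed

lemma fibre_scale: "e \<in> fibre v a x \<Longrightarrow> (\<lambda>m. c * e m) \<in> fibre v a x"
  by (auto simp: fibre_def mult.left_commute)

lemma fibre_add: "e \<in> fibre v a x \<Longrightarrow> e' \<in> fibre v a x \<Longrightarrow> (\<lambda>m. e m + e' m) \<in> fibre v a x"
  by (auto simp: fibre_def distrib_left)

text \<open>Fibres are lines: two local generators differ by an element of \<open>perp\<close>, so
  one coordinate determines all others through the transition factor.\<close>

lemma fibre_eqI:
  assumes b: "chart b" and e: "e \<in> fibre v a (chart_point v b z)" "e' \<in> fibre v a (chart_point v b z)"
    and m: "m \<in> local_generators v a (fst (chart_point v b z))" "e m = e' m"
  shows "e = e'"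
proof
  fix k
  let ?lg = "local_generators v a (fst (chart_point v b z))"
  show "e k = e' k"
  proof (cases "k \<in> ?lg")
    case True
    then have u: "m - k \<in> perp (fst (chart_point v b z))"
      using m unfolding local_generators_chart[OF b] perp_chart_point by (auto simp: pairing_diff_left)
    then have "e k = snd (chart_point v b z) (m - k) * e m" "e' k = snd (chart_point v b z) (m - k) * e' m"
      using e True unfolding fibre_def by fastforce+
    with m show ?thesis by simp
  next
    case False
    with e show ?thesis
      by (auto simp: fibre_def)
  qed
qed

lemma fibre_chart_frame:
  assumes b: "chart b" and e: "e \<in> fibre v a (chart_point v b z)"
  obtains c where "e = (\<lambda>m. c * chart_frame v a b z m)"
proof -
  obtain m where m: "m \<in> local_generators v a (fst (chart_point v b z))"
    using local_generators_nonempty[OF b] .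
  then have "chart_frame v a b z m \<noteq> 0"
    using chart_frame_nonzero[OF b] by blast
  then have "e = (\<lambda>k. (e m / chart_frame v a b z m) * chart_frame v a b z k)"
    by (intro fibre_eqI[OF b e fibre_scale[OF chart_frame_in_fibre[OF b]] m]) simp
  then show ?thesis
    by (rule that)
qed

subsection \<open>The open orbit\<close>

lemma fst_chart_point_open: "(\<And>j. z $ j \<noteq> 0) \<Longrightarrow> fst (chart_point v b z) = {0}"
  by (simp add: fst_chart_point lattice_cone_def)

lemma exp_Complex_eq: "exp (Complex x y) = complex_of_real (exp x) * cis y"
  by (simp add: exp_eq_polar)

lemma chart_point_cexp:
  "chart_point v b (cexp t \<theta>) = open_orbit_point (cone_point v b t) (cone_point v b \<theta>)"
proof -
  have fst: "fst (chart_point v b (cexp t \<theta>)) = {0}"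
    by (rule fst_chart_point_open) simp
  have "snd (chart_point v b (cexp t \<theta>)) u =
      exp (Complex (rvec u \<bullet> cone_point v b t) (rvec u \<bullet> cone_point v b \<theta>))" for u
  proof -
    have "snd (chart_point v b (cexp t \<theta>)) u = exp (\<Sum>j\<in>UNIV. of_int (pairing u (gen b j)) * Complex (t $ j) (\<theta> $ j))"
      by (simp add: snd_chart_point fst exp_sum exp_power_int)
    also have "(\<Sum>j\<in>UNIV. of_int (pairing u (gen b j)) * Complex (t $ j) (\<theta> $ j)) =
        Complex (rvec u \<bullet> cone_point v b t) (rvec u \<bullet> cone_point v b \<theta>)"
      by (simp add: complex_eq_iff inner_cone_point mult.commute)
    finally show ?thesis .
  qed
  with fst show ?thesis
    by (auto simp: open_orbit_point_def prod_eq_iff)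
qed

lemma nonzero_cexp:
  assumes "\<And>j. z $ j \<noteq> 0"
  obtains t \<theta> where "z = cexp t \<theta>"
proof
  have "Complex (Re (Ln (z $ j))) (Im (Ln (z $ j))) = Ln (z $ j)" for j
    by simp
  then show "z = cexp (\<chi> j. Re (Ln (z $ j))) (\<chi> j. Im (Ln (z $ j)))"
    using assms by (simp add: vec_eq_iff del: Re_Ln)
qed

lemma open_orbit_eq: "torus_orbit {0 :: real^'n} = range (\<lambda>(\<xi>, \<theta>). open_orbit_point \<xi> \<theta>)"
proof
  show "torus_orbit {0 :: real^'n} \<subseteq> range (\<lambda>(\<xi>, \<theta>). open_orbit_point \<xi> \<theta>)"
  proof
    fix x :: "'n tpoint" assume x: "x \<in> torus_orbit {0}"
    obtain b0 where "chart b0" by (rule chart_exists)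
    from chart_face[OF this, of "{}"] have "{0} \<in> \<Sigma>"
      by (simp add: lattice_cone_def)
    with x have "x \<in> toric_variety \<Sigma>"
      by (auto simp: toric_variety_def)
    then obtain b z where b: "chart b" "x = chart_point v b z"
      by (rule toric_variety_covered_by_charts)
    have "z $ j \<noteq> 0" for j
    \<comment> \<open>A vanishing coordinate would put a nonzero generator into the cone
      {0}.\<close>
    proof
      assume "z $ j = 0"
      then have "rvec (gen b j) \<in> {0}"
        using x rvec_in_lattice_cone[of "gen b j" "gen b ` {j. z $ j = 0}"] fst_chart_point[of b z]
        by (auto simp: b(2) torus_orbit_def)
      then show False
        using pairing_dual_vector[OF chart_basis[OF b(1)], of j j] inner_rvec[of "dual_vector (gen b) j" "gen b j"]
        by simp
    qed
    then obtain t \<theta> where "z = cexp t \<theta>"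
      using nonzero_cexp by metis
    then show "x \<in> range (\<lambda>(\<xi>, \<theta>). open_orbit_point \<xi> \<theta>)"
      unfolding b(2) by (auto simp: chart_point_cexp)
  qed
  show "range (\<lambda>(\<xi>, \<theta>). open_orbit_point \<xi> \<theta>) \<subseteq> torus_orbit {0 :: real^'n}"
    by (auto simp: torus_orbit_def open_orbit_point_def rvec_add inner_add_left
        complex_add[symmetric] exp_add[symmetric] simp del: complex_add)
qed

text \<open>For the exponent m of the chart frame, 1 = chi^(-m) chi^m, and chi^(-m) is a monomial in
  the chart coordinates whose exponents are the entries of a.\<close>

lemma unit_section_chart:
  assumes b: "chart b" and z: "\<And>j. z $ j \<noteq> 0"
  shows "unit_section (chart_point v b z) = (\<lambda>m. (\<Prod>j\<in>UNIV. z $ j powi (a $ b j)) * chart_frame v a b z m)"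
proof
  fix m
  have "z $ j powi (pairing (- m) (gen b j)) = z $ j powi (a $ b j) * z $ j powi (- (a $ b j) - pairing m (gen b j))" for j
    using z by (simp add: pairing_minus_left flip: power_int_add)
  then show "unit_section (chart_point v b z) m = (\<Prod>j\<in>UNIV. z $ j powi (a $ b j)) * chart_frame v a b z m"
    using z by (simp add: unit_section_def snd_chart_point perp_chart_point chart_frame_def
        local_generators_chart[OF b] flip: prod.distrib)
qed

end

section \<open>Invariant metrics and their potentials\<close>

lemma prod_cis: "(\<Prod>j\<in>A. cis (f j)) = cis (\<Sum>j\<in>A. f j)"
  by (induction A rule: infinite_finite_induct) (simp_all add: cis_mult)

context toric_fan
begin

text \<open>As the fibres are lines, this function determines a hermitian metric over the chart; see
  \<open>metric_chart\<close>.\<close>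

definition chart_norm :: "'n bundle_metric \<Rightarrow> int^'d \<Rightarrow> ('n \<Rightarrow> 'd) \<Rightarrow> complex^'n \<Rightarrow> real" where
  "chart_norm h a b z = Re (h (chart_point v b z) (chart_frame v a b z) (chart_frame v a b z))"

lemma hermitian_multiples:
  assumes h: "hermitian_metric_C2 \<Sigma> v a h" and x: "x \<in> toric_variety \<Sigma>" and e: "e \<in> fibre v a x"
  shows "h x (\<lambda>m. c * e m) (\<lambda>m. c' * e m) = c * cnj c' * complex_of_real (Re (h x e e))"
proof -
  have scale: "h x (\<lambda>m. c * e1 m) e2 = c * h x e1 e2" and sym: "h x e2 e1 = cnj (h x e1 e2)"
    if "e1 \<in> fibre v a x" "e2 \<in> fibre v a x" for c e1 e2
    using h x that unfolding hermitian_metric_C2_def by blast+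
  have fib: "(\<lambda>m. c * e m) \<in> fibre v a x" for c
    by (rule fibre_scale[OF e])
  have "h x (\<lambda>m. c * e m) (\<lambda>m. c' * e m) = c * cnj (h x (\<lambda>m. c' * e m) e)"
    using scale[OF e fib] sym[OF fib e] by simp
  also have "\<dots> = c * cnj c' * cnj (h x e e)"
    using scale[OF e e] by simp
  also have "cnj (h x e e) = complex_of_real (Re (h x e e))"
    using sym[OF e e] by (simp add: complex_eq_iff)
  finally show ?thesis .
qed

lemma metric_chart:
  assumes "hermitian_metric_C2 \<Sigma> v a h" "chart b"
  shows "h (chart_point v b z) (\<lambda>m. c * chart_frame v a b z m) (\<lambda>m. c' * chart_frame v a b z m) =
    c * cnj c' * complex_of_real (chart_norm h a b z)"
  unfolding chart_norm_def
  by (rule hermitian_multiples[OF assms(1) chart_point_in_toric_variety[OF assms(2)]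
        chart_frame_in_fibre[OF assms(2)]])

lemma chart_norm_pos:
  assumes h: "hermitian_metric_C2 \<Sigma> v a h" and b: "chart b"
  shows "0 < chart_norm h a b z"
proof -
  obtain m where "m \<in> local_generators v a (fst (chart_point v b z))"
    using local_generators_nonempty[OF b] .
  then have "chart_frame v a b z \<noteq> (\<lambda>m. 0)"
    using chart_frame_nonzero[OF b] by metis
  then show ?thesis
    using h chart_point_in_toric_variety[OF b] chart_frame_in_fibre[OF b]
    unfolding chart_norm_def hermitian_metric_C2_def by blast
qed

lemma chart_norm_C2:
  assumes "hermitian_metric_C2 \<Sigma> v a h" "chart b"
  shows "C2_fun (chart_norm h a b)"
  using assms unfolding hermitian_metric_C2_def chart_norm_def[abs_def] by blast

section \<open>The compact torus in chart coordinates\<close>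

definition rotate_coords :: "real^'n \<Rightarrow> complex^'n \<Rightarrow> complex^'n" where
  "rotate_coords \<theta> z = (\<chi> j. cis (\<theta> $ j) * z $ j)"

lemma torus_act_chart_point:
  "torus_act (cone_point v b \<theta>) (chart_point v b z) = chart_point v b (rotate_coords \<theta> z)"
proof -
  have fst: "fst (chart_point v b (rotate_coords \<theta> z)) = fst (chart_point v b z)"
    by (simp add: fst_chart_point rotate_coords_def)
  have "cis (rvec u \<bullet> cone_point v b \<theta>) * snd (chart_point v b z) u = snd (chart_point v b (rotate_coords \<theta> z)) u" for u
    unfolding snd_chart_point fst
    by (simp add: rotate_coords_def power_int_mult_distrib prod.distrib cis_power_int
        prod_cis inner_cone_point mult.commute)
  with fst show ?thesis
    by (auto simp: torus_act_def prod_eq_iff)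
qed

text \<open>A rotation carries the frame to itself up to a phase, the character of the frame's
  exponent. The phase cancels in norms.\<close>

lemma torus_act_chart_frame:
  "torus_act_fibre (cone_point v b \<theta>) (chart_frame v a b z) =
    (\<lambda>m. cis (\<Sum>j\<in>UNIV. of_int (a $ b j) * \<theta> $ j) * chart_frame v a b (rotate_coords \<theta> z) m)"
proof
  fix m
  have "fst (chart_point v b (rotate_coords \<theta> z)) = fst (chart_point v b z)"
    by (simp add: fst_chart_point rotate_coords_def)
  moreover have angle: "- (rvec m \<bullet> cone_point v b \<theta>) = (\<Sum>j\<in>UNIV. of_int (a $ b j) * \<theta> $ j) +
      (\<Sum>j\<in>UNIV. of_int (- (a $ b j) - pairing m (gen b j)) * \<theta> $ j)"
    by (simp add: inner_cone_point algebra_simps flip: sum.distrib sum_negf)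
  moreover have pr: "(\<Prod>j\<in>UNIV. rotate_coords \<theta> z $ j powi (- (a $ b j) - pairing m (gen b j))) =
      cis (\<Sum>j\<in>UNIV. of_int (- (a $ b j) - pairing m (gen b j)) * \<theta> $ j) *
      (\<Prod>j\<in>UNIV. z $ j powi (- (a $ b j) - pairing m (gen b j)))"
    by (simp only: rotate_coords_def vec_lambda_beta power_int_mult_distrib prod.distrib cis_power_int prod_cis)
  ultimately show "torus_act_fibre (cone_point v b \<theta>) (chart_frame v a b z) m =
      cis (\<Sum>j\<in>UNIV. of_int (a $ b j) * \<theta> $ j) * chart_frame v a b (rotate_coords \<theta> z) m"
    by (simp add: torus_act_fibre_def chart_frame_def pr angle cis_mult[symmetric])
qed

lemma chart_norm_rotate:
  assumes h: "hermitian_metric_C2 \<Sigma> v a h" "torus_invariant \<Sigma> v a h" and b: "chart b"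
  shows "chart_norm h a b (rotate_coords \<theta> z) = chart_norm h a b z"
proof -
  let ?\<theta> = "cone_point v b \<theta>" and ?f = "chart_frame v a b z"
  have "h (torus_act ?\<theta> (chart_point v b z)) (torus_act_fibre ?\<theta> ?f) (torus_act_fibre ?\<theta> ?f) =
      h (chart_point v b z) ?f ?f"
    using h(2) chart_point_in_toric_variety[OF b] chart_frame_in_fibre[OF b]
    unfolding torus_invariant_def by blast
  then have "complex_of_real (chart_norm h a b (rotate_coords \<theta> z)) = h (chart_point v b z) ?f ?f"
    unfolding torus_act_chart_point torus_act_chart_frame metric_chart[OF h(1) b] by (simp add: cis_cnj cis_mult)
  then show ?thesis
    by (simp add: chart_norm_def complex_eq_iff)
qed

lemma cexp_rotate: "cexp t \<theta> = rotate_coords \<theta> (cexp t 0)"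
  by (simp add: vec_eq_iff rotate_coords_def exp_eq_polar mult.commute)

text \<open>Charts cover the variety and each fibre is spanned by a chart frame, so it suffices to
  compare frame norms; off the fibres both metrics have the default value 0.\<close>

lemma metric_eqI:
  assumes h: "hermitian_metric_C2 \<Sigma> v a h" and h': "hermitian_metric_C2 \<Sigma> v a h'"
    and eq: "\<And>b z. chart b \<Longrightarrow> chart_norm h' a b z = c * chart_norm h a b z"
  shows "h' = (\<lambda>x e e'. of_real c * h x e e')"
proof (intro ext)
  fix x e e'
  show "h' x e e' = of_real c * h x e e'"
  proof (cases "x \<in> toric_variety \<Sigma> \<and> e \<in> fibre v a x \<and> e' \<in> fibre v a x")
    case False
    then have "h x e e' = 0" "h' x e e' = 0"
      using h h' unfolding hermitian_metric_C2_def by blast+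
    then show ?thesis by simp
  next
    case True
    then obtain b z where b: "chart b" "x = chart_point v b z"
      using toric_variety_covered_by_charts by metis
    obtain d where "e = (\<lambda>m. d * chart_frame v a b z m)"
      using fibre_chart_frame[OF b(1), of e] True b(2) by metis
    moreover obtain d' where "e' = (\<lambda>m. d' * chart_frame v a b z m)"
      using fibre_chart_frame[OF b(1), of e'] True b(2) by metis
    ultimately show ?thesis
      unfolding b(2) by (simp add: metric_chart[OF h b(1)] metric_chart[OF h' b(1)] eq[OF b(1)])
  qed
qed

lemma unit_section_in_fibre:
  assumes "fst x = {0}" "x \<in> torus_orbit {0}"
  shows "unit_section x \<in> fibre v a x"
proof -
  obtain \<gamma> where x: "x = ({0}, \<gamma>)" and orbit: "({0}, \<gamma>) \<in> torus_orbit {0}"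
    using assms by (cases x) auto
  have "rvec (v i) \<noteq> 0" for i
  proof
    assume "rvec (v i) = 0"
    moreover obtain b where "chart b" by (rule chart_exists)
    moreover have "0 \<in> lattice_cone (range (gen b))"
      by (rule convex_cone_contains_0[OF convex_cone_lattice_cone])
    ultimately have "i \<in> range b"
      using chart_ray[of b i] by metis
    then obtain j where "i = b j" ..
    with \<open>rvec (v i) = 0\<close> show False
      using pairing_dual_vector[OF chart_basis[OF \<open>chart b\<close>], of j j]
        inner_rvec[of "dual_vector (gen b) j" "v (b j)"] by simp
  qed
  then have lg: "local_generators v a {0} = UNIV"
    by (auto simp: local_generators_def)
  have "\<gamma> (- m) = \<gamma> u * \<gamma> (- (m + u))" for m u
    using orbit_add[OF orbit, of u "- (m + u)"] by simp
  then show ?thesis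
    by (simp add: fibre_def unit_section_def x lg)
qed

text \<open>The coordinate at m = 0 belongs to the frame 1, and the coordinate at m is obtained from
  it by the value of chi^(-m).\<close>

lemma open_orbit_fibre_eq:
  assumes x: "x \<in> torus_orbit {0}" and e: "e \<in> fibre v a x"
  shows "e = (\<lambda>m. e 0 * unit_section x m)"
proof -
  obtain \<gamma> where x': "x = ({0}, \<gamma>)" and orbit: "({0}, \<gamma>) \<in> torus_orbit {0}"
    using x by (cases x) (auto simp: torus_orbit_def)
  have "fst x = {0}" by (simp add: x')
  then have "unit_section x \<in> fibre v a x"
    using x by (rule unit_section_in_fibre)
  moreover have "unit_section x 0 \<noteq> 0"
    using orbit_nonzero[OF orbit, of 0] by (simp add: unit_section_def x')
  ultimately have lg: "0 \<in> local_generators v a {0}"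
    unfolding fibre_def by (auto simp: x')
  have "e m = e 0 * unit_section x m" for m
  proof (cases "m \<in> local_generators v a {0}")
    case True
    have "\<forall>m\<in>local_generators v a {0}. \<forall>u. e m = \<gamma> u * e (m + u)"
      using e unfolding fibre_def by (simp add: x')
    from this[rule_format, OF True, of "- m"] have "e m = \<gamma> (- m) * e (m + - m)" .
    then show ?thesis
      by (simp add: unit_section_def x' mult.commute)
  next
    case False
    then have "e m = 0" "unit_section x m = 0"
      using e \<open>unit_section x \<in> fibre v a x\<close> unfolding fibre_def by (auto simp: x')
    then show ?thesis by simp
  qed
  then show ?thesis ..
qed

lemma open_orbit_point_in_orbit: "open_orbit_point \<xi> \<theta> \<in> torus_orbit {0 :: real^'n}"
  unfolding open_orbit_eq by auto

lemma torus_act_open_orbit_point: "torus_act \<theta> (open_orbit_point \<xi> 0) = open_orbit_point \<xi> \<theta>"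
  by (auto simp: torus_act_def open_orbit_point_def exp_Complex_eq mult.commute)

text \<open>The exponential is the squared modulus of the monomial that expresses the section 1 in
  the chart frame.\<close>

lemma metric_unit_section:
  fixes t :: "real^'n"
  assumes h: "hermitian_metric_C2 \<Sigma> v a h" and b: "chart b"
  defines "x \<equiv> open_orbit_point (cone_point v b t) 0"
  shows "Re (h x (\<lambda>m. c * unit_section x m) (\<lambda>m. c * unit_section x m)) =
    (cmod c)\<^sup>2 * exp (2 * (\<Sum>j\<in>UNIV. of_int (a $ b j) * t $ j)) * chart_norm h a b (cexp t 0)"
proof -
  have x: "x = chart_point v b (cexp t 0)"
    using chart_point_cexp[of b t 0] by (simp add: x_def cone_point_def)
  define P where "P = exp (\<Sum>j\<in>UNIV. of_int (a $ b j) * t $ j)"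
  have "(\<Prod>j\<in>UNIV. cexp t 0 $ j powi (a $ b j)) = complex_of_real P"
    by (simp add: P_def exp_eq_polar exp_sum exp_power_int flip: of_real_power_int)
  then have unit: "unit_section x = (\<lambda>m. complex_of_real P * chart_frame v a b (cexp t 0) m)"
    unfolding x using unit_section_chart[OF b, of "cexp t 0" a] by simp
  have "h x (\<lambda>m. c * unit_section x m) (\<lambda>m. c * unit_section x m) =
      (c * complex_of_real P) * cnj (c * complex_of_real P) * complex_of_real (chart_norm h a b (cexp t 0))"
    unfolding unit mult.assoc[symmetric] unfolding x by (rule metric_chart[OF h b])
  also have "\<dots> = complex_of_real ((cmod c)\<^sup>2 * P\<^sup>2 * chart_norm h a b (cexp t 0))"
    unfolding of_real_mult complex_norm_square
    by (simp add: power2_eq_square mult_ac)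
  finally show ?thesis
    by (simp add: P_def power2_eq_square flip: exp_add)
qed

section \<open>Potentials of invariant metrics and their growth\<close>

lemma syz_potential_cone_point:
  assumes h: "hermitian_metric_C2 \<Sigma> v a h" and b: "chart b"
  shows "syz_potential h unit_section (cone_point v b t) =
    - (1/2) * ln (chart_norm h a b (cexp t 0)) - (\<Sum>j\<in>UNIV. of_int (a $ b j) * t $ j)"
proof -
  have "Re (h (open_orbit_point (cone_point v b t) 0) (unit_section (open_orbit_point (cone_point v b t) 0))
      (unit_section (open_orbit_point (cone_point v b t) 0))) =
      exp (2 * (\<Sum>j\<in>UNIV. of_int (a $ b j) * t $ j)) * chart_norm h a b (cexp t 0)"
    using metric_unit_section[OF h b, of t 1] by simp
  then show ?thesis
    using chart_norm_pos[OF h b, of "cexp t 0"]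
    by (simp add: syz_potential_def ln_mult algebra_simps)
qed

text \<open>\<open>cone_point\<close> maps the coordinate axes to the generators, and the added
  linear function shifts the gradient by the entries of a while leaving the Hessian
  unchanged.\<close>

lemma growth_condition_iff:
  assumes g: "C2_fun g"
  shows "growth_condition \<Sigma> v a g \<longleftrightarrow>
    (\<forall>b. chart b \<longrightarrow> boundary_growth (\<lambda>t. g (cone_point v b t) + (\<chi> j. of_int (a $ b j)) \<bullet> t))"
proof -
  have "grad (\<lambda>t. g (cone_point v b t) + (\<chi> j. of_int (a $ b j)) \<bullet> t) t $ j =
      grad g (cone_point v b t) \<bullet> rvec (gen b j) + of_int (a $ b j)" for b t j
  proof -
    have "grad (\<lambda>t. g (cone_point v b t)) t \<bullet> axis j 1 = grad g (cone_point v b t) \<bullet> rvec (gen b j)"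
      using grad_compose_linear[OF g linear_cone_point[of v b], of t "axis j 1"] by (simp add: cone_point_axis)
    then show ?thesis
      by (simp add: grad_add_inner[OF C2_fun_compose_linear[OF g linear_cone_point]] inner_axis)
  qed
  moreover have "hess (\<lambda>t. g (cone_point v b t) + (\<chi> j. of_int (a $ b j)) \<bullet> t) t (axis j 1) (axis k 1) =
      hess g (cone_point v b t) (rvec (gen b j)) (rvec (gen b k))" for b t j k
    by (simp add: hess_add_inner[OF C2_fun_compose_linear[OF g linear_cone_point]]
        hess_compose_linear[OF g linear_cone_point] cone_point_axis)
  ultimately show ?thesis
    unfolding growth_condition_def boundary_growth_def Let_def by simp
qed

lemma C2_fun_if_chart:
  assumes b: "chart b" and g: "C2_fun (\<lambda>t. g (cone_point v b t))"
  shows "C2_fun g"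
proof -
  have "linear (\<lambda>\<xi>. \<chi> j. rvec (dual_vector (gen b) j) \<bullet> \<xi>)"
    by (intro linearI) (simp_all add: vec_eq_iff inner_add_right)
  from C2_fun_compose_linear[OF g this] show ?thesis
    by (simp add: cone_point_inverse[OF b])
qed

lemma syz_potential_growth:
  assumes h: "h \<in> invariant_metrics \<Sigma> v a"
  shows "C2_fun (syz_potential h unit_section)"
    and "growth_condition \<Sigma> v a (syz_potential h unit_section)"
proof -
  have herm: "hermitian_metric_C2 \<Sigma> v a h" and inv: "torus_invariant \<Sigma> v a h"
    using h by (auto simp: invariant_metrics_def)
  let ?g = "syz_potential h unit_section"
  have *: "C2_fun (\<lambda>t. ?g (cone_point v b t) + (\<chi> j. of_int (a $ b j)) \<bullet> t) \<and>
      boundary_growth (\<lambda>t. ?g (cone_point v b t) + (\<chi> j. of_int (a $ b j)) \<bullet> t)" if b: "chart b" for b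
  proof -
    define R where "R r = (\<chi> j. complex_of_real (r $ j))" for r :: "real^'n"
    have R: "linear R"
      unfolding R_def by (intro linearI) (simp_all add: vec_eq_iff complex_eq_iff)
    define F where "F r = - (1/2) * ln (chart_norm h a b (R r))" for r
    have F: "C2_fun F"
      unfolding F_def
      by (rule C2_fun_scale[OF C2_fun_ln[OF C2_fun_compose_linear[OF chart_norm_C2[OF herm b] R]
            chart_norm_pos[OF herm b]]])
    \<comment> \<open>Changing the sign of r_j is the rotation of z_j by the angle pi, under which
      the metric is invariant.\<close>
    have even: "F (r - (2 * r $ j) *\<^sub>R axis j 1) = F r" for j r
    proof -
      have "R (r - (2 * r $ j) *\<^sub>R axis j 1) = rotate_coords (\<chi> i. if i = j then pi else 0) (R r)"
        by (simp add: vec_eq_iff R_def rotate_coords_def axis_def)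
      then show ?thesis
        by (simp add: F_def chart_norm_rotate[OF herm inv b])
    qed
    have "R (vexp t) = cexp t 0" for t
      by (simp add: vec_eq_iff R_def exp_eq_polar)
    then have "?g (cone_point v b t) + (\<chi> j. of_int (a $ b j)) \<bullet> t = F (vexp t)" for t
      by (simp add: syz_potential_cone_point[OF herm b] F_def inner_vec_def)
    then show ?thesis
      using boundary_growth_of_even[OF F even] by simp
  qed
  obtain b where b: "chart b" by (rule chart_exists)
  have "C2_fun (\<lambda>t. (?g (cone_point v b t) + (\<chi> j. of_int (a $ b j)) \<bullet> t) + (- (\<chi> j. of_int (a $ b j))) \<bullet> t)"
    by (rule C2_fun_add[OF conjunct1[OF *[OF b]] C2_fun_inner_const])
  then have "C2_fun (\<lambda>t. ?g (cone_point v b t))"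
    by simp
  then show C2: "C2_fun ?g"
    by (rule C2_fun_if_chart[OF b])
  show "growth_condition \<Sigma> v a ?g"
    unfolding growth_condition_iff[OF C2] using * by blast
qed

end

section \<open>Sections of the mirror fibration\<close>

lemma lattice_coset_add_rvec: "lattice_coset (y + rvec u) = lattice_coset y"
proof -
  have "\<exists>w'. y + rvec u + rvec w = y + rvec w'" "\<exists>w'. y + rvec w = y + rvec u + rvec w'" for w
    by (intro exI[of _ "u + w"] exI[of _ "w - u"]; simp add: rvec_add rvec_diff)+
  then show ?thesis
    unfolding lattice_coset_def by auto
qed

lemma lattice_coset_eqD:
  assumes "lattice_coset y = lattice_coset y'"
  obtains u where "y' = y + rvec u"
proof -
  have "y' \<in> lattice_coset y'"
    unfolding lattice_coset_def by (auto intro: exI[of _ 0])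
  with assms that show ?thesis
    unfolding lattice_coset_def by blast
qed

text \<open>On tangent vectors of the graph the symplectic form is the antisymmetric part of the
  Hessian.\<close>

lemma lagrangian_section_grad:
  assumes g: "C2_fun g"
  shows "lagrangian_section (induced_section (grad g))"
proof -
  obtain D where D: "\<And>\<xi>. (grad g has_derivative D \<xi>) (at \<xi>)" "\<And>\<xi> v w. hess g \<xi> v w = D \<xi> v \<bullet> w"
    using C2_fun_grad_has_derivative[OF g] by metis
  have "omega_Y (p, frechet_derivative (grad g) (at \<xi>) p) (q, frechet_derivative (grad g) (at \<xi>) q) = 0" for \<xi> p q
    using hess_commute[OF g, of \<xi> p q] frechet_derivative_at[OF D(1), of \<xi>]
    by (simp add: omega_Y_def D(2) inner_commute)
  then show ?thesis
    unfolding lagrangian_section_def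
    using C2_fun_C1_grad[OF g] by (auto simp: mu_section_def mirror_Y_def mu_Y_def induced_section_def)
qed

section \<open>Equivariant meromorphic sections\<close>

lemma holomorphic_fun_on_const: "holomorphic_fun_on (\<lambda>z. c) S"
  unfolding holomorphic_fun_on_def by (intro ballI exI[of _ "\<lambda>_. 0"]) simp

lemma holomorphic_fun_on_nth: "holomorphic_fun_on (\<lambda>z. z $ j) S"
  unfolding holomorphic_fun_on_def
  by (intro ballI exI[of _ "\<lambda>w. w $ j"])
     (simp add: bounded_linear_imp_has_derivative bounded_linear_vec_nth)

lemma holomorphic_fun_on_mult:
  assumes "holomorphic_fun_on f S" "holomorphic_fun_on g S"
  shows "holomorphic_fun_on (\<lambda>z. f z * g z) S"
  unfolding holomorphic_fun_on_def
proof
  fix z assume "z \<in> S"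
  obtain D where D: "(f has_derivative D) (at z)" "\<And>c w. D (c *s w) = c * D w"
    using assms(1) \<open>z \<in> S\<close> unfolding holomorphic_fun_on_def by blast
  obtain E where E: "(g has_derivative E) (at z)" "\<And>c w. E (c *s w) = c * E w"
    using assms(2) \<open>z \<in> S\<close> unfolding holomorphic_fun_on_def by blast
  have "((\<lambda>z. f z * g z) has_derivative (\<lambda>w. f z * E w + D w * g z)) (at z)"
    by (rule has_derivative_mult[OF D(1) E(1)])
  then show "\<exists>D. ((\<lambda>z. f z * g z) has_derivative D) (at z) \<and> (\<forall>c w. D (c *s w) = c * D w)"
    by (intro exI[of _ "\<lambda>w. f z * E w + D w * g z"]) (simp add: D(2) E(2) algebra_simps)
qed

lemma holomorphic_fun_on_prod_power: "holomorphic_fun_on (\<lambda>z. \<Prod>j\<in>A. z $ j ^ N j) S"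
proof (induction A rule: infinite_finite_induct)
  case (insert j A)
  have "holomorphic_fun_on (\<lambda>z. z $ j ^ k) S" for k
    by (induction k) (simp_all add: holomorphic_fun_on_const holomorphic_fun_on_mult holomorphic_fun_on_nth)
  with insert show ?case
    by (simp add: holomorphic_fun_on_mult)
qed (simp_all add: holomorphic_fun_on_const)

text \<open>A holomorphic function of \<open>\<zeta>\<close> which is invariant under imaginary translations has the
  derivative zero in imaginary directions, and hence, by complex linearity, in all directions.\<close>

lemma holomorphic_imaginary_invariant_constant:
  fixes \<psi> :: "complex^'n::finite \<Rightarrow> complex"
  assumes \<psi>: "holomorphic_fun_on \<psi> UNIV"
    and inv: "\<And>t \<theta>. \<psi> (\<chi> j. Complex (t $ j) (\<theta> $ j)) = \<psi> (\<chi> j. Complex (t $ j) 0)"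
  obtains c where "\<And>t. \<psi> (\<chi> j. Complex (t $ j) 0) = c"
proof -
  define re where "re t = (\<chi> j. Complex (t $ j) 0)" for t :: "real^'n"
  define im where "im t = (\<chi> j. Complex 0 (t $ j))" for t :: "real^'n"
  have "linear re" "linear im"
    unfolding re_def im_def by (intro linearI; simp add: vec_eq_iff complex_eq_iff)+
  then have bl: "bounded_linear re" "bounded_linear im"
    by (simp_all add: linear_conv_bounded_linear)
  have "((\<lambda>t. \<psi> (re t)) has_derivative (\<lambda>h. 0)) (at t within UNIV)" for t
  proof -
    obtain D where D: "(\<psi> has_derivative D) (at (re t))" "\<And>c w. D (c *s w) = c * D w"
      using \<psi> unfolding holomorphic_fun_on_def by blast
    have "((\<lambda>\<theta>. re t + im \<theta>) has_derivative im) (at 0)"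
      using has_derivative_add[OF has_derivative_const bounded_linear_imp_has_derivative[OF bl(2)]] by simp
    moreover have "re t + im 0 = re t"
      by (simp add: vec_eq_iff im_def re_def complex_eq_iff)
    ultimately have "((\<lambda>\<theta>. \<psi> (re t + im \<theta>)) has_derivative (\<lambda>h. D (im h))) (at 0)"
      using has_derivative_compose[of "\<lambda>\<theta>. re t + im \<theta>" im 0 UNIV \<psi> D] D(1) by simp
    moreover have "\<psi> (re t + im \<theta>) = \<psi> (re t)" for \<theta>
    proof -
      have "re t + im \<theta> = (\<chi> j. Complex (t $ j) (\<theta> $ j))"
        by (simp add: vec_eq_iff im_def re_def complex_eq_iff)
      then show ?thesis
        using inv by (simp add: re_def)
    qed
    ultimately have "((\<lambda>\<theta> :: real^'n. \<psi> (re t)) has_derivative (\<lambda>h. D (im h))) (at 0)"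
      by simp
    from has_derivative_unique[OF this has_derivative_const] have im0: "D (im h) = 0" for h
      by (rule fun_cong)
    have "im h = \<i> *s re h" for h
      by (simp add: vec_eq_iff im_def re_def complex_eq_iff)
    with im0 D(2) have "D (re h) = 0" for h
      by (metis complex_i_not_zero mult_eq_0_iff)
    then show ?thesis
      using has_derivative_compose[OF bounded_linear_imp_has_derivative[OF bl(1)] D(1)] by simp
  qed
  then obtain c where "\<And>t. \<psi> (re t) = c"
    using has_derivative_zero_constant[OF convex_UNIV, of "\<lambda>t. \<psi> (re t)"] by blast
  then show ?thesis
    using that unfolding re_def by blast
qed

text \<open>In logarithmic coordinates the pole factors, the chart frame and a character become
  exponentials of linear forms, so the local expression of an equivariant section turns into a
  function of this shape, holomorphic everywhere.\<close>

lemma holomorphic_exp_linear: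
  fixes F :: "complex^'n::finite \<Rightarrow> complex"
  assumes F: "holomorphic_fun_on F UNIV"
  shows "holomorphic_fun_on (\<lambda>\<zeta>. F (\<chi> j. exp (\<zeta> $ j)) * exp (\<Sum>j\<in>UNIV. l j * \<zeta> $ j)) UNIV"
proof (rule holomorphic_fun_on_mult)
  show "holomorphic_fun_on (\<lambda>\<zeta>. F (\<chi> j. exp (\<zeta> $ j))) UNIV"
    unfolding holomorphic_fun_on_def
  proof
    fix \<zeta> :: "complex^'n"
    obtain D where D: "(F has_derivative D) (at (\<chi> j. exp (\<zeta> $ j)))" "\<And>c w. D (c *s w) = c * D w"
      using F unfolding holomorphic_fun_on_def by blast
    have "((\<lambda>\<zeta>. exp (\<zeta> $ j)) has_derivative (\<lambda>w. exp (\<zeta> $ j) * w $ j)) (at \<zeta>)" for j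
      by (rule has_derivative_compose[OF bounded_linear_imp_has_derivative[OF bounded_linear_vec_nth[of j]]
          DERIV_exp[unfolded has_field_derivative_def]])
    then have "((\<lambda>\<zeta>. \<chi> j. exp (\<zeta> $ j)) has_derivative (\<lambda>w. \<chi> j. exp (\<zeta> $ j) * w $ j)) (at \<zeta>)"
      by (subst has_derivative_componentwise_within)
        (auto simp: Basis_vec_def inner_axis intro!: has_derivative_inner_left)
    from has_derivative_compose[OF this D(1)]
    have "((\<lambda>\<zeta>. F (\<chi> j. exp (\<zeta> $ j))) has_derivative (\<lambda>w. D (\<chi> j. exp (\<zeta> $ j) * w $ j))) (at \<zeta>)" .
    moreover have "D (\<chi> j. exp (\<zeta> $ j) * (c *s w) $ j) = c * D (\<chi> j. exp (\<zeta> $ j) * w $ j)" for c w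
      unfolding D(2)[symmetric] by (rule arg_cong[of _ _ D]) (simp add: vec_eq_iff)
    ultimately show "\<exists>D. ((\<lambda>\<zeta>. F (\<chi> j. exp (\<zeta> $ j))) has_derivative D) (at \<zeta>) \<and> (\<forall>c w. D (c *s w) = c * D w)"
      by blast
  qed
  show "holomorphic_fun_on (\<lambda>\<zeta>. exp (\<Sum>j\<in>UNIV. l j * \<zeta> $ j)) UNIV"
    unfolding holomorphic_fun_on_def
  proof
    fix \<zeta> :: "complex^'n"
    have scale: "(\<Sum>j\<in>UNIV. l j * (c *s w) $ j) = c * (\<Sum>j\<in>UNIV. l j * w $ j)" for c w
      by (simp add: sum_distrib_left mult.left_commute)
    have "((\<lambda>\<zeta>. \<Sum>j\<in>UNIV. l j * \<zeta> $ j) has_derivative (\<lambda>w. \<Sum>j\<in>UNIV. l j * w $ j)) (at \<zeta>)"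
      by (intro has_derivative_sum has_derivative_mult_right
          bounded_linear_imp_has_derivative[OF bounded_linear_vec_nth])
    from has_derivative_compose[OF this DERIV_exp[unfolded has_field_derivative_def]]
    have "((\<lambda>\<zeta>. exp (\<Sum>j\<in>UNIV. l j * \<zeta> $ j)) has_derivative
        (\<lambda>w. exp (\<Sum>j\<in>UNIV. l j * \<zeta> $ j) * (\<Sum>j\<in>UNIV. l j * w $ j))) (at \<zeta>)" .
    then show "\<exists>D. ((\<lambda>\<zeta>. exp (\<Sum>j\<in>UNIV. l j * \<zeta> $ j)) has_derivative D) (at \<zeta>) \<and> (\<forall>c w. D (c *s w) = c * D w)"
      by (intro exI[of _ "\<lambda>w. exp (\<Sum>j\<in>UNIV. l j * \<zeta> $ j) * (\<Sum>j\<in>UNIV. l j * w $ j)"])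
        (simp only: scale mult.left_commute simp_thms)
  qed
qed

lemma unit_section_0 [simp]: "unit_section (open_orbit_point \<xi> \<theta>) 0 = 1"
  by (simp add: unit_section_def open_orbit_point_def flip: zero_complex.code)

lemma unit_section_torus_act:
  "unit_section (torus_act \<theta> x) = torus_act_fibre \<theta> (unit_section x)"
  by (auto simp: unit_section_def torus_act_def torus_act_fibre_def rvec_minus)

context toric_fan
begin

lemma equivariant_unit_section: "equivariant_meromorphic_section \<Sigma> v a unit_section"
proof -
  have "\<exists>F k. holomorphic_fun_on F UNIV \<and> (\<forall>z. (\<forall>j. z $ j \<noteq> 0) \<longrightarrow>
      unit_section (chart_point v b z) = (\<lambda>m. F z / (\<Prod>j\<in>UNIV. z $ j) ^ k * chart_frame v a b z m))"
    if b: "chart b" for b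
  proof -
    \<comment> \<open>Large enough that every a_(b j) + k is nonnegative, so that the k-th power of
      the product of all coordinates clears the poles.\<close>
    define k where "k = nat (\<Sum>j\<in>UNIV. \<bar>a $ b j\<bar>)"
    have nonneg: "0 \<le> a $ b j + int k" for j
      using member_le_sum[of j UNIV "\<lambda>j. \<bar>a $ b j\<bar>"] by (simp add: k_def)
    define F where "F z = (\<Prod>j\<in>UNIV. z $ j ^ nat (a $ b j + int k))" for z :: "complex^'n"
    have "F z / (\<Prod>j\<in>UNIV. z $ j) ^ k = (\<Prod>j\<in>UNIV. z $ j powi (a $ b j))" if z: "\<forall>j. z $ j \<noteq> 0" for z
    proof -
      have "z $ j ^ nat (a $ b j + int k) / z $ j ^ k = z $ j powi (a $ b j)" for j
      proof -
        have "z $ j ^ nat (a $ b j + int k) = z $ j powi (a $ b j + int k)"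
          using nonneg[of j] by (simp add: power_int_def)
        then show ?thesis
          using z by (simp add: power_int_add)
      qed
      then show ?thesis
        by (simp add: F_def prod_dividef[symmetric] prod_power_distrib)
    qed
    moreover have "holomorphic_fun_on F UNIV"
      unfolding F_def[abs_def] by (rule holomorphic_fun_on_prod_power)
    ultimately show ?thesis
      using unit_section_chart[OF b] by (intro exI[of _ F] exI[of _ k]) simp
  qed
  moreover have "unit_section x \<in> fibre v a x" if "x \<in> torus_orbit {0}" for x
    using that by (intro unit_section_in_fibre) (auto simp: torus_orbit_def)
  moreover have "unit_section (open_orbit_point 0 0) \<noteq> (\<lambda>m :: int^'n. 0)"
    by (metis unit_section_0 zero_neq_one)
  then have "\<exists>x\<in>torus_orbit {0 :: real^'n}. unit_section x \<noteq> (\<lambda>m. 0)"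
    using open_orbit_point_in_orbit by blast
  moreover have "unit_section (torus_act \<theta> x) = (\<lambda>m. cis (rvec 0 \<bullet> \<theta>) * torus_act_fibre \<theta> (unit_section x) m)" for \<theta> x
    by (simp add: unit_section_torus_act)
  ultimately show ?thesis
    unfolding equivariant_meromorphic_section_def by blast
qed

text \<open>The coordinate at m = 0 turns the section into a scalar function. In logarithmic
  coordinates, divided by the character, it is \<open>\<psi>\<close>; equivariance makes
  \<open>\<psi>\<close> invariant under imaginary translations, hence constant on the real
  points.\<close>

lemma equivariant_section_eq:
  assumes s: "equivariant_meromorphic_section \<Sigma> v a s"
  obtains c u where "c \<noteq> 0" "\<And>\<xi>. s (open_orbit_point \<xi> 0) =
    (\<lambda>m. (c * of_real (exp (rvec u \<bullet> \<xi>))) * unit_section (open_orbit_point \<xi> 0) m)"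
proof -
  have fib: "s x \<in> fibre v a x" if "x \<in> torus_orbit {0}" for x
    using s that unfolding equivariant_meromorphic_section_def by blast
  obtain u where u: "\<And>\<theta> x. x \<in> torus_orbit {0} \<Longrightarrow>
      s (torus_act \<theta> x) = (\<lambda>m. cis (rvec u \<bullet> \<theta>) * torus_act_fibre \<theta> (s x) m)"
    using s unfolding equivariant_meromorphic_section_def by blast
  obtain b where b: "chart b" by (rule chart_exists)
  obtain F k where F: "holomorphic_fun_on F UNIV" and sF: "\<And>z. (\<forall>j. z $ j \<noteq> 0) \<Longrightarrow> s (chart_point v b z) =
      (\<lambda>m. F z / (\<Prod>j\<in>UNIV. z $ j) ^ k * chart_frame v a b z m)"
    using s b unfolding equivariant_meromorphic_section_def by blast
  define \<mu> where "\<mu> j = pairing u (gen b j)" for j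
  \<comment> \<open>The three exponents come from the chart frame at m = 0, from the denominator of
    the local expression, and from division by the character u.\<close>
  define l where "l j = complex_of_int (- (a $ b j) - int k - \<mu> j)" for j
  define \<psi> where "\<psi> \<zeta> = F (\<chi> j. exp (\<zeta> $ j)) * exp (\<Sum>j\<in>UNIV. l j * \<zeta> $ j)" for \<zeta>
  have s\<psi>: "s (open_orbit_point (cone_point v b t) (cone_point v b \<theta>)) 0 =
      \<psi> (\<chi> j. Complex (t $ j) (\<theta> $ j)) * exp (\<Sum>j\<in>UNIV. of_int (\<mu> j) * Complex (t $ j) (\<theta> $ j))" for t \<theta>
  proof -
    let ?\<zeta> = "\<lambda>j. Complex (t $ j) (\<theta> $ j)"
    have lg: "0 \<in> local_generators v a (fst (chart_point v b (cexp t \<theta>)))"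
      unfolding local_generators_chart[OF b] by simp
    have "s (open_orbit_point (cone_point v b t) (cone_point v b \<theta>)) 0 =
        F (cexp t \<theta>) / (\<Prod>j\<in>UNIV. exp (?\<zeta> j)) ^ k * (\<Prod>j\<in>UNIV. exp (?\<zeta> j) powi (- (a $ b j)))"
      unfolding chart_point_cexp[symmetric] using lg by (subst sF) (simp_all add: chart_frame_def)
    also have "\<dots> = F (cexp t \<theta>) * exp (\<Sum>j\<in>UNIV. of_int (- (a $ b j) - int k) * ?\<zeta> j)"
      unfolding exp_power_int exp_sum[OF finite, symmetric] exp_of_nat_mult[symmetric] divide_inverse
        exp_minus[symmetric] mult.assoc exp_add[symmetric]
      by (intro arg_cong2[of _ _ _ _ "(*)"] arg_cong[of _ _ exp])
        (simp_all add: sum_distrib_left left_diff_distrib sum_subtractf sum_negf)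
    also have "\<dots> = \<psi> (\<chi> j. ?\<zeta> j) * exp (\<Sum>j\<in>UNIV. of_int (\<mu> j) * ?\<zeta> j)"
      by (simp add: \<psi>_def l_def cexp_def left_diff_distrib sum_subtractf flip: exp_add)
    finally show ?thesis .
  qed
  have "\<psi> (\<chi> j. Complex (t $ j) (\<theta> $ j)) = \<psi> (\<chi> j. Complex (t $ j) 0)" for t \<theta>
  proof -
    have "s (open_orbit_point (cone_point v b t) (cone_point v b \<theta>)) 0 =
        cis (rvec u \<bullet> cone_point v b \<theta>) * s (open_orbit_point (cone_point v b t) 0) 0"
      using u[OF open_orbit_point_in_orbit, of "cone_point v b \<theta>" "cone_point v b t" 0]
      unfolding torus_act_open_orbit_point by (simp add: torus_act_fibre_def)
    moreover have "cone_point v b 0 = 0"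
      by (simp add: cone_point_def)
    ultimately have "\<psi> (\<chi> j. Complex (t $ j) (\<theta> $ j)) * exp (\<Sum>j\<in>UNIV. of_int (\<mu> j) * Complex (t $ j) (\<theta> $ j)) =
        cis (\<Sum>j\<in>UNIV. of_int (\<mu> j) * \<theta> $ j) *
        (\<psi> (\<chi> j. Complex (t $ j) 0) * exp (\<Sum>j\<in>UNIV. of_int (\<mu> j) * Complex (t $ j) 0))"
      using s\<psi>[of t \<theta>] s\<psi>[of t 0] by (simp add: inner_cone_point \<mu>_def mult.commute)
    moreover have "exp (\<Sum>j\<in>UNIV. of_int (\<mu> j) * Complex (t $ j) (\<theta> $ j)) =
        cis (\<Sum>j\<in>UNIV. of_int (\<mu> j) * \<theta> $ j) * exp (\<Sum>j\<in>UNIV. of_int (\<mu> j) * Complex (t $ j) 0)"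
      by (simp add: cis_conv_exp complex_eq_iff[of "_ + _"] flip: exp_add)
        (rule arg_cong[of _ _ exp], simp add: complex_eq_iff)
    ultimately show ?thesis by simp
  qed
  then obtain c where c: "\<And>t. \<psi> (\<chi> j. Complex (t $ j) 0) = c"
    using holomorphic_imaginary_invariant_constant[OF holomorphic_exp_linear[OF F, of l, folded \<psi>_def[abs_def]]]
    by metis
  have s0: "s (open_orbit_point \<xi> 0) 0 = c * of_real (exp (rvec u \<bullet> \<xi>))" for \<xi>
  proof -
    obtain t where t: "\<xi> = cone_point v b t"
      using cone_point_surj[OF b] .
    have "(\<Sum>j\<in>UNIV. complex_of_int (\<mu> j) * Complex (t $ j) 0) = of_real (rvec u \<bullet> \<xi>)"
      by (simp add: t inner_cone_point \<mu>_def complex_eq_iff mult.commute)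
    moreover have "cone_point v b 0 = 0"
      by (simp add: cone_point_def)
    ultimately show ?thesis
      using s\<psi>[of t 0] c[of t] by (simp add: t exp_of_real)
  qed
  have eq: "s (open_orbit_point \<xi> 0) =
      (\<lambda>m. (c * of_real (exp (rvec u \<bullet> \<xi>))) * unit_section (open_orbit_point \<xi> 0) m)" for \<xi>
    using open_orbit_fibre_eq[OF open_orbit_point_in_orbit fib[OF open_orbit_point_in_orbit], of \<xi> 0]
    by (simp only: s0)
  \<comment> \<open>Otherwise equivariance would spread the vanishing from the real points to the
    whole open orbit.\<close>
  have "c \<noteq> 0"
  proof
    assume "c = 0"
    then have "s (open_orbit_point \<xi> \<theta>) = (\<lambda>m. 0)" for \<xi> \<theta>
      using u[OF open_orbit_point_in_orbit, of \<theta> \<xi> 0]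
      unfolding torus_act_open_orbit_point by (simp add: eq torus_act_fibre_def)
    then have "s x = (\<lambda>m. 0)" if "x \<in> torus_orbit {0}" for x
      using that unfolding open_orbit_eq by auto
    then show False
      using s unfolding equivariant_meromorphic_section_def by blast
  qed
  from that[OF this eq] show ?thesis .
qed

section \<open>The transform and its injectivity\<close>

lemma syz_potential_section:
  assumes h: "hermitian_metric_C2 \<Sigma> v a h" and c: "c \<noteq> 0"
    and s: "\<And>\<xi>. s (open_orbit_point \<xi> 0) =
      (\<lambda>m. (c * of_real (exp (rvec u \<bullet> \<xi>))) * unit_section (open_orbit_point \<xi> 0) m)"
  shows "syz_potential h s \<xi> = syz_potential h unit_section \<xi> + (- rvec u) \<bullet> \<xi> + - ln (cmod c)"
proof -
  obtain b where b: "chart b" by (rule chart_exists)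
  obtain t where \<xi>: "\<xi> = cone_point v b t"
    using cone_point_surj[OF b] .
  define P where "P = exp (2 * (\<Sum>j\<in>UNIV. of_int (a $ b j) * t $ j)) * chart_norm h a b (cexp t 0)"
  have P: "0 < P"
    unfolding P_def using chart_norm_pos[OF h b] by simp
  have "syz_potential h s \<xi> = - (1/2) * ln ((cmod c * exp (rvec u \<bullet> \<xi>))\<^sup>2 * P)"
    unfolding syz_potential_def Let_def s P_def \<xi> metric_unit_section[OF h b]
    by (simp add: norm_mult mult.assoc)
  moreover have "syz_potential h unit_section \<xi> = - (1/2) * ln P"
    using metric_unit_section[OF h b, of t 1] by (simp add: syz_potential_def P_def \<xi>)
  moreover have "ln ((cmod c * exp (rvec u \<bullet> \<xi>))\<^sup>2 * P) = 2 * (ln (cmod c) + rvec u \<bullet> \<xi>) + ln P"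
    using c P by (simp add: ln_mult ln_realpow)
  ultimately show ?thesis
    by (simp add: add_divide_distrib)
qed

lemma induced_section_add_rvec:
  "induced_section (\<lambda>\<xi>. y \<xi> + rvec u) = induced_section y"
  by (simp add: induced_section_def lattice_coset_add_rvec)

text \<open>The description by \<open>THE\<close> is legitimate: another section changes the
  potential by a constant and an integral linear function, so the gradient moves by a lattice
  vector, which is invisible in the cosets.\<close>

lemma syz_transform_eq:
  assumes h: "h \<in> invariant_metrics \<Sigma> v a"
  shows "syz_transform \<Sigma> v a h = induced_section (grad (syz_potential h unit_section))"
  unfolding syz_transform_def
proof (rule the_equality)
  show "\<exists>s. equivariant_meromorphic_section \<Sigma> v a s \<and>
      induced_section (grad (syz_potential h unit_section)) = induced_section (grad (syz_potential h s))"
    using equivariant_unit_section by blast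
next
  fix L assume "\<exists>s. equivariant_meromorphic_section \<Sigma> v a s \<and> L = induced_section (grad (syz_potential h s))"
  then obtain s where s: "equivariant_meromorphic_section \<Sigma> v a s" and L: "L = induced_section (grad (syz_potential h s))"
    by blast
  obtain c u where c: "c \<noteq> 0" and su: "\<And>\<xi>. s (open_orbit_point \<xi> 0) =
      (\<lambda>m. (c * of_real (exp (rvec u \<bullet> \<xi>))) * unit_section (open_orbit_point \<xi> 0) m)"
    using equivariant_section_eq[OF s] by metis
  have herm: "hermitian_metric_C2 \<Sigma> v a h"
    using h by (simp add: invariant_metrics_def)
  have "grad (syz_potential h s) \<xi> = grad (syz_potential h unit_section) \<xi> + rvec (- u)" for \<xi>
  proof (rule grad_eqI)
    have "(syz_potential h unit_section has_derivative (\<lambda>w. grad (syz_potential h unit_section) \<xi> \<bullet> w)) (at \<xi>)"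
      by (rule C2_fun_has_grad[OF syz_potential_growth(1)[OF h]])
    then have "((\<lambda>\<xi>. syz_potential h unit_section \<xi> + (- rvec u) \<bullet> \<xi> + - ln (cmod c)) has_derivative
        (\<lambda>w. grad (syz_potential h unit_section) \<xi> \<bullet> w + (- rvec u) \<bullet> w)) (at \<xi>)"
      by (intro has_derivative_add_const has_derivative_add has_derivative_inner_right has_derivative_ident)
    then show "(syz_potential h s has_derivative (\<lambda>w. (grad (syz_potential h unit_section) \<xi> + rvec (- u)) \<bullet> w)) (at \<xi>)"
      unfolding syz_potential_section[OF herm c su, symmetric, abs_def] rvec_minus inner_add_left .
  qed
  then have "grad (syz_potential h s) = (\<lambda>\<xi>. grad (syz_potential h unit_section) \<xi> + rvec (- u))"
    by (rule ext)
  then show "L = induced_section (grad (syz_potential h unit_section))"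
    unfolding L by (simp only: induced_section_add_rvec)
qed

text \<open>The bracket is a convergent function times a multiple of exp (2 t_j), which tends to 0
  at the origin of the chart.\<close>

lemma growth_gradient_limit:
  assumes "growth_condition \<Sigma> v a g" "chart b"
  shows "((\<lambda>t. grad g (cone_point v b t) \<bullet> rvec (gen b j) + of_int (a $ b j)) \<longlongrightarrow> 0) (boundary_filter 0)"
proof -
  obtain c where c: "((\<lambda>t. 2 * exp (- 2 * t $ j) * (grad g (cone_point v b t) \<bullet> rvec (gen b j) + of_int (a $ b j)))
      \<longlongrightarrow> c) (boundary_filter 0)"
    using assms(1)[unfolded growth_condition_def Let_def, rule_format, OF assms(2), THEN conjunct1,
        rule_format, of 0 j] by auto
  have "((\<lambda>t. 1/2 * (exp (t $ j) * exp (t $ j)) *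
      (2 * exp (- 2 * t $ j) * (grad g (cone_point v b t) \<bullet> rvec (gen b j) + of_int (a $ b j))))
      \<longlongrightarrow> 1/2 * ((0 :: real^'n) $ j * (0 :: real^'n) $ j) * c) (boundary_filter 0)"
    by (intro tendsto_mult tendsto_const tendsto_exp_nth_boundary c)
  moreover have "1/2 * (exp (t $ j) * exp (t $ j)) * (2 * exp (- 2 * t $ j) * y) = y" for t :: "real^'n" and y
    by (simp add: mult.assoc[symmetric] flip: exp_add)
  ultimately show ?thesis
    by (simp only: zero_index mult_zero_left mult_zero_right)
qed

text \<open>The gradients differ by a continuous function with values in the lattice, hence by a constant;
  it vanishes because the growth conditions prescribe the limits of both gradients.\<close>

lemma growth_gradient_unique:
  assumes g: "C2_fun g" "growth_condition \<Sigma> v a g"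
    and g': "C2_fun g'" "growth_condition \<Sigma> v a g'"
    and eq: "induced_section (grad g) = induced_section (grad g')"
  shows "grad g' = grad g"
proof -
  define f where "f \<xi> = grad g' \<xi> - grad g \<xi>" for \<xi>
  have lat: "\<exists>u. f \<xi> = rvec u" for \<xi>
  proof -
    have "lattice_coset (grad g \<xi>) = lattice_coset (grad g' \<xi>)"
      using fun_cong[OF eq, of \<xi>] by (simp add: induced_section_def)
    then obtain u where "grad g' \<xi> = grad g \<xi> + rvec u"
      by (rule lattice_coset_eqD)
    then show ?thesis
      by (auto simp: f_def)
  qed
  have "(\<lambda>\<xi>. f \<xi> $ i) constant_on UNIV" for i
  proof (rule continuous_discrete_range_constant)
    show "continuous_on UNIV (\<lambda>\<xi>. f \<xi> $ i)"
      unfolding f_def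
      by (intro continuous_intros C1_map_continuous_on[OF C2_fun_C1_grad[OF g(1)]]
          C1_map_continuous_on[OF C2_fun_C1_grad[OF g'(1)]])
    fix \<xi>
    have "1 \<le> norm (f \<eta> $ i - f \<xi> $ i)" if ne: "f \<eta> $ i \<noteq> f \<xi> $ i" for \<eta>
    proof -
      obtain u w where uw: "f \<eta> = rvec u" "f \<xi> = rvec w"
        using lat by metis
      with ne have "1 \<le> \<bar>u $ i - w $ i\<bar>"
        by auto
      then show ?thesis
        unfolding uw rvec_nth real_norm_def by (simp flip: of_int_diff of_int_abs)
    qed
    then show "\<exists>e>0. \<forall>\<eta>. \<eta> \<in> UNIV \<and> f \<eta> $ i \<noteq> f \<xi> $ i \<longrightarrow> e \<le> norm (f \<eta> $ i - f \<xi> $ i)"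
      by (intro exI[of _ 1]) auto
  qed (rule connected_UNIV)
  then have "f \<xi> $ i = f 0 $ i" for \<xi> i
    unfolding constant_on_def by (metis UNIV_I)
  then have "f \<xi> = f 0" for \<xi>
    by (simp add: vec_eq_iff)
  then obtain u where u: "\<And>\<xi>. f \<xi> = rvec u"
    using lat by metis
  obtain b where b: "chart b" by (rule chart_exists)
  have "pairing u (gen b j) = 0" for j
  proof -
    have "((\<lambda>t. (grad g' (cone_point v b t) \<bullet> rvec (gen b j) + of_int (a $ b j)) -
        (grad g (cone_point v b t) \<bullet> rvec (gen b j) + of_int (a $ b j))) \<longlongrightarrow> 0 - 0) (boundary_filter 0)"
      by (intro tendsto_diff growth_gradient_limit g g' b)
    moreover have "(grad g' (cone_point v b t) \<bullet> rvec (gen b j) + of_int (a $ b j)) -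
        (grad g (cone_point v b t) \<bullet> rvec (gen b j) + of_int (a $ b j)) = of_int (pairing u (gen b j))" for t
      using u[of "cone_point v b t"] by (simp add: f_def inner_diff_left[symmetric] inner_rvec)
    ultimately have "((\<lambda>t. real_of_int (pairing u (gen b j))) \<longlongrightarrow> 0) (boundary_filter (0 :: real^'n))"
      by simp
    from tendsto_unique[OF boundary_filter_neq_bot tendsto_const this] show ?thesis
      by simp
  qed
  then have "u = 0"
    using dual_vector_expansion[OF chart_basis[OF b], of u] by (simp add: vec_eq_iff)
  with u show ?thesis
    by (auto simp: f_def)
qed

text \<open>Rotations carry the equation from the positive points to all points off the hyperplanes,
  and continuity carries it to the hyperplanes.\<close>

lemma chart_norm_eqI:
  assumes h: "h \<in> invariant_metrics \<Sigma> v a" and h': "h' \<in> invariant_metrics \<Sigma> v a" and b: "chart b"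
    and eq: "\<And>t. chart_norm h' a b (cexp t 0) = c * chart_norm h a b (cexp t 0)"
  shows "chart_norm h' a b z = c * chart_norm h a b z"
proof -
  have herm: "hermitian_metric_C2 \<Sigma> v a h" "torus_invariant \<Sigma> v a h"
    "hermitian_metric_C2 \<Sigma> v a h'" "torus_invariant \<Sigma> v a h'"
    using h h' by (auto simp: invariant_metrics_def)
  have open_eq: "chart_norm h' a b z = c * chart_norm h a b z" if nz: "\<forall>j. z $ j \<noteq> 0" for z
  proof -
    obtain t \<theta> where "z = cexp t \<theta>"
      using nonzero_cexp nz by metis
    then show ?thesis
      using eq by (simp add: cexp_rotate[of t \<theta>] chart_norm_rotate[OF herm(1,2) b] chart_norm_rotate[OF herm(3,4) b])
  qed
  obtain Y :: "real \<Rightarrow> complex^'n" where Y: "(Y \<longlongrightarrow> z) (at_right 0)" and nz: "\<forall>s>0. \<forall>j. Y s $ j \<noteq> 0"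
    using approach_off_hyperplanes[of z] .
  have lim: "((\<lambda>s. chart_norm h a b (Y s)) \<longlongrightarrow> chart_norm h a b z) (at_right 0)"
    "((\<lambda>s. chart_norm h' a b (Y s)) \<longlongrightarrow> chart_norm h' a b z) (at_right 0)"
    using continuous_on_tendsto_compose[OF C2_fun_continuous_on[where S = UNIV, OF chart_norm_C2[OF herm(1) b]] Y]
      continuous_on_tendsto_compose[OF C2_fun_continuous_on[where S = UNIV, OF chart_norm_C2[OF herm(3) b]] Y] by auto
  have "\<forall>\<^sub>F s in at_right (0::real). 0 < s"
    by (simp add: eventually_at_right_less)
  then have "\<forall>\<^sub>F s in at_right 0. chart_norm h' a b (Y s) = c * chart_norm h a b (Y s)"
    by eventually_elim (simp add: open_eq nz)
  then have "((\<lambda>s. chart_norm h' a b (Y s)) \<longlongrightarrow> c * chart_norm h a b z) (at_right 0)"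
    by (subst tendsto_cong) (auto intro!: tendsto_intros lim)
  with lim(2) show ?thesis
    using tendsto_unique trivial_limit_at_right_real by blast
qed

text \<open>Scaling a metric adds a constant to its potential. Conversely, equal mirrors force equal
  gradients, so the potentials differ by a constant on the open orbit, and the frame norms are
  proportional with the same factor in all charts.\<close>

lemma metric_scaling_iff:
  assumes h: "h \<in> invariant_metrics \<Sigma> v a" and h': "h' \<in> invariant_metrics \<Sigma> v a"
  shows "(h, h') \<in> metric_scaling \<Sigma> v a \<longleftrightarrow> syz_transform \<Sigma> v a h = syz_transform \<Sigma> v a h'"
proof
  assume "(h, h') \<in> metric_scaling \<Sigma> v a"
  then obtain c :: real where c: "0 < c" "h' = (\<lambda>x e e'. of_real c * h x e e')"
    by (auto simp: metric_scaling_def)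
  have herm: "hermitian_metric_C2 \<Sigma> v a h"
    using h by (simp add: invariant_metrics_def)
  have scale: "chart_norm h' a b z = c * chart_norm h a b z" for b z
    by (simp add: chart_norm_def c(2))
  have "syz_potential h' unit_section \<xi> = syz_potential h unit_section \<xi> + - (1/2) * ln c" for \<xi>
  proof -
    obtain b where b: "chart b" by (rule chart_exists)
    obtain t where \<xi>: "\<xi> = cone_point v b t"
      using cone_point_surj[OF b] .
    have "hermitian_metric_C2 \<Sigma> v a h'"
      using h' by (simp add: invariant_metrics_def)
    then show ?thesis
      unfolding \<xi> syz_potential_cone_point[OF herm b]
      using chart_norm_pos[OF herm b, of "cexp t 0"] c(1)
      by (simp add: syz_potential_cone_point[OF _ b] scale ln_mult add_divide_distrib)
  qed
  then have eq: "syz_potential h' unit_section = (\<lambda>\<xi>. syz_potential h unit_section \<xi> + - (1/2) * ln c)"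
    by (rule ext)
  have "grad (syz_potential h' unit_section) = grad (syz_potential h unit_section)"
    unfolding eq
    by (intro ext grad_eqI has_derivative_add_const C2_fun_has_grad[OF syz_potential_growth(1)[OF h]])
  then show "syz_transform \<Sigma> v a h = syz_transform \<Sigma> v a h'"
    by (simp add: syz_transform_eq[OF h] syz_transform_eq[OF h'])
next
  assume "syz_transform \<Sigma> v a h = syz_transform \<Sigma> v a h'"
  then have "induced_section (grad (syz_potential h unit_section)) = induced_section (grad (syz_potential h' unit_section))"
    by (simp add: syz_transform_eq[OF h] syz_transform_eq[OF h'])
  then have grad: "grad (syz_potential h' unit_section) = grad (syz_potential h unit_section)"
    by (rule growth_gradient_unique[OF syz_potential_growth[OF h] syz_potential_growth[OF h']])
  have herm: "hermitian_metric_C2 \<Sigma> v a h" "hermitian_metric_C2 \<Sigma> v a h'"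
    using h h' by (auto simp: invariant_metrics_def)
  have "((\<lambda>\<xi>. syz_potential h' unit_section \<xi> - syz_potential h unit_section \<xi>) has_derivative (\<lambda>w. 0)) (at \<xi> within UNIV)" for \<xi>
    using has_derivative_diff[OF C2_fun_has_grad[OF syz_potential_growth(1)[OF h']]
        C2_fun_has_grad[OF syz_potential_growth(1)[OF h]], of \<xi>] by (simp add: grad)
  then obtain \<kappa> where \<kappa>: "\<And>\<xi>. syz_potential h' unit_section \<xi> - syz_potential h unit_section \<xi> = \<kappa>"
    using has_derivative_zero_constant[OF convex_UNIV, of "\<lambda>\<xi>. syz_potential h' unit_section \<xi> - syz_potential h unit_section \<xi>"]
    by blast
  \<comment> \<open>The potential is - 1/2 times the logarithm of the norm, so the difference
    \<open>\<kappa>\<close> of potentials becomes this factor.\<close>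
  define c where "c = exp (- 2 * \<kappa>)"
  have "chart_norm h' a b z = c * chart_norm h a b z" if b: "chart b" for b z
  proof (rule chart_norm_eqI[OF h h' b])
    fix t
    have pos: "0 < chart_norm h a b (cexp t 0)" "0 < chart_norm h' a b (cexp t 0)"
      by (intro chart_norm_pos herm b)+
    have "ln (chart_norm h' a b (cexp t 0)) = - 2 * \<kappa> + ln (chart_norm h a b (cexp t 0))"
      using \<kappa>[of "cone_point v b t"]
      unfolding syz_potential_cone_point[OF herm(1) b] syz_potential_cone_point[OF herm(2) b] by simp
    then have "exp (ln (chart_norm h' a b (cexp t 0))) = c * exp (ln (chart_norm h a b (cexp t 0)))"
      by (simp add: c_def flip: exp_add)
    with pos show "chart_norm h' a b (cexp t 0) = c * chart_norm h a b (cexp t 0)"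
      by simp
  qed
  then have "h' = (\<lambda>x e e'. of_real c * h x e e')"
    by (rule metric_eqI[OF herm])
  moreover have "0 < c"
    by (simp add: c_def)
  ultimately show "(h, h') \<in> metric_scaling \<Sigma> v a"
    unfolding metric_scaling_def using h h' by blast
qed

end

section \<open>The metric of a potential\<close>

context toric_fan
begin

text \<open>For \<open>x\<close> in the orbit of the cone \<open>\<tau>\<close>, the points \<open>log_modulus x + s w\<close>, where \<open>w\<close> is the sum of
  the rays of \<open>\<tau>\<close>, are the logarithms of points of the open orbit which tend to \<open>x\<close> as
  \<open>s \<rightarrow> -\<infinity>\<close>. The limit of \<open>h (\<chi>\<^sup>m, \<chi>\<^sup>m)\<close> along this path does not refer to a chart.\<close>

definition log_modulus :: "'n tpoint \<Rightarrow> real^'n" where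
  "log_modulus x = (SOME \<xi>. \<forall>u\<in>perp (fst x). exp (rvec u \<bullet> \<xi>) = cmod (snd x u))"

definition ray_sum :: "(real^'n) set \<Rightarrow> real^'n" where
  "ray_sum \<tau> = (\<Sum>i | rvec (v i) \<in> \<tau>. rvec (v i))"

definition frame_norm :: "(real^'n \<Rightarrow> real) \<Rightarrow> 'n tpoint \<Rightarrow> int^'n \<Rightarrow> real" where
  "frame_norm g x m = Lim at_bot (\<lambda>s. let \<xi> = log_modulus x + s *\<^sub>R ray_sum (fst x)
     in exp (2 * (rvec m \<bullet> \<xi>) - 2 * g \<xi>))"

text \<open>Under the growth condition every local generator m gives the same value: by
  \<open>frame_norm_chart\<close> the weight \<open>frame_norm\<close> compensates the change of
  frame.\<close>

definition potential_metric :: "int^'d \<Rightarrow> (real^'n \<Rightarrow> real) \<Rightarrow> 'n bundle_metric" where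
  "potential_metric a g x e e' =
    (if x \<in> toric_variety \<Sigma> \<and> e \<in> fibre v a x \<and> e' \<in> fibre v a x
     then let m = (SOME m. m \<in> local_generators v a (fst x))
       in e m * cnj (e' m) * of_real (frame_norm g x m)
     else 0)"

text \<open>The defining equations involve only \<open>perp\<close>, which contains the dual basis
  vectors of the nonzero coordinates; exactly these logarithmic coordinates are prescribed, whatever
  choice \<open>SOME\<close> makes.\<close>

lemma log_modulus_chart:
  assumes b: "chart b" and z: "z $ j \<noteq> 0"
  shows "rvec (dual_vector (gen b) j) \<bullet> log_modulus (chart_point v b z) = ln (cmod (z $ j))"
proof -
  let ?x = "chart_point v b z"
  \<comment> \<open>A witness for the choice. Its entry at z_j = 0 is harmless, since every u in
    \<open>perp\<close> pairs to 0 with that generator.\<close>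
  define \<xi> where "\<xi> = cone_point v b (\<chi> j. ln (cmod (z $ j)))"
  have "exp (rvec u \<bullet> \<xi>) = cmod (snd ?x u)" if u: "u \<in> perp (fst ?x)" for u
  proof -
    have "exp (ln (cmod (z $ j)) * of_int (pairing u (gen b j))) = cmod (z $ j) powi pairing u (gen b j)" for j
    proof (cases "z $ j = 0")
      case True
      with u show ?thesis
        by (simp add: perp_chart_point)
    next
      case False
      then have "cmod (z $ j) powi pairing u (gen b j) = exp (ln (cmod (z $ j))) powi pairing u (gen b j)"
        by simp
      then show ?thesis
        unfolding exp_power_int by (simp add: mult.commute)
    qed
    then show ?thesis
      using u by (simp add: \<xi>_def inner_cone_point exp_sum snd_chart_point prod_norm[symmetric] norm_power_int)
  qed
  then have "\<exists>\<xi>. \<forall>u\<in>perp (fst ?x). exp (rvec u \<bullet> \<xi>) = cmod (snd ?x u)"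
    by blast
  then have *: "\<forall>u\<in>perp (fst ?x). exp (rvec u \<bullet> log_modulus ?x) = cmod (snd ?x u)"
    unfolding log_modulus_def by (rule someI_ex)
  let ?m = "dual_vector (gen b) j"
  note dual = pairing_dual_vector[OF chart_basis[OF b]]
  have "?m \<in> perp (fst ?x)"
    using z by (auto simp: perp_chart_point dual)
  moreover from this have "snd ?x ?m = z $ j"
    by (simp add: snd_chart_point dual if_distrib[of "\<lambda>k. _ powi k"] cong: if_cong)
  ultimately have "exp (rvec ?m \<bullet> log_modulus ?x) = cmod (z $ j)"
    using * by simp
  then show ?thesis
    by (metis ln_exp)
qed

lemma ray_sum_chart:
  assumes b: "chart b"
  shows "ray_sum (fst (chart_point v b z)) = cone_point v b (\<chi> j. if z $ j = 0 then 1 else 0)"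
proof -
  have "{i. rvec (v i) \<in> fst (chart_point v b z)} = b ` {j. z $ j = 0}"
    using ray_in_chart_cone_iff[OF b] by auto
  then have "ray_sum (fst (chart_point v b z)) = (\<Sum>j | z $ j = 0. rvec (gen b j))"
    unfolding ray_sum_def using sum.reindex[of b "{j. z $ j = 0}" "\<lambda>i. rvec (v i)"]
      inj_on_subset[OF chart_inj[OF b]] by simp
  also have "\<dots> = (\<Sum>j\<in>UNIV. if z $ j = 0 then rvec (gen b j) else 0)"
    by (simp add: sum.If_cases)
  also have "\<dots> = cone_point v b (\<chi> j. if z $ j = 0 then 1 else 0)"
    unfolding cone_point_def by (intro sum.cong) auto
  finally show ?thesis .
qed

text \<open>Along the path the chart coordinates t_j are constant where z_j is nonzero and tend to
  minus infinity elsewhere, so the path converges in the boundary filter of |z| and the corrected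
  potential tends to \<open>\<phi>\<close>.\<close>

lemma frame_norm_chart:
  assumes b: "chart b" and m: "m \<in> local_generators v a (fst (chart_point v b z))"
    and \<Phi>: "((\<lambda>t. g (cone_point v b t) + (\<chi> j. of_int (a $ b j)) \<bullet> t) \<longlongrightarrow> \<phi>) (boundary_filter (vabs z))"
  shows "(cmod (chart_frame v a b z m))\<^sup>2 * frame_norm g (chart_point v b z) m = exp (- 2 * \<phi>)"
proof -
  let ?x = "chart_point v b z"
  define t where "t s = (\<chi> j. rvec (dual_vector (gen b) j) \<bullet> log_modulus ?x + (if z $ j = 0 then s else 0))" for s :: real
  have path: "log_modulus ?x + s *\<^sub>R ray_sum (fst ?x) = cone_point v b (t s)" for s
  proof -
    have "t s = (\<chi> j. rvec (dual_vector (gen b) j) \<bullet> log_modulus ?x) + s *\<^sub>R (\<chi> j. if z $ j = 0 then 1 else 0)"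
      by (simp add: t_def vec_eq_iff)
    then show ?thesis
      by (simp add: linear_add[OF linear_cone_point] linear_cmul[OF linear_cone_point]
          cone_point_inverse[OF b] ray_sum_chart[OF b])
  qed
  have "((\<lambda>s. exp (t s $ j)) \<longlongrightarrow> cmod (z $ j)) at_bot" for j
  proof (cases "z $ j = 0")
    case True
    then have "((\<lambda>s. exp (rvec (dual_vector (gen b) j) \<bullet> log_modulus ?x) * exp s) \<longlongrightarrow>
        exp (rvec (dual_vector (gen b) j) \<bullet> log_modulus ?x) * 0) at_bot"
      by (intro tendsto_mult tendsto_const exp_at_bot)
    with True show ?thesis
      by (simp add: t_def exp_add)
  next
    case False
    then show ?thesis
      by (simp add: t_def log_modulus_chart[OF b])
  qed
  then have "((\<lambda>s. vexp (t s)) \<longlongrightarrow> vabs z) at_bot"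
    by (intro vec_tendstoI) simp
  then have "filterlim t (boundary_filter (vabs z)) at_bot"
    by (simp add: boundary_filter_eq filterlim_filtercomap_iff o_def)
  from filterlim_compose[OF \<Phi> this]
  have lim: "((\<lambda>s. g (cone_point v b (t s)) + (\<chi> j. of_int (a $ b j)) \<bullet> t s) \<longlongrightarrow> \<phi>) at_bot" .
  \<comment> \<open>Minus the logarithm of the modulus of the chart frame in the frame chi^m. It is
    constant along the path: where z_j = 0 the integer factor vanishes, because m is a local
    generator.\<close>
  define K where "K = (\<Sum>j\<in>UNIV. ln (cmod (z $ j)) * of_int (a $ b j + pairing m (gen b j)))"
  have K: "2 * (rvec m \<bullet> cone_point v b (t s)) - 2 * g (cone_point v b (t s)) =
      2 * K - 2 * (g (cone_point v b (t s)) + (\<chi> j. of_int (a $ b j)) \<bullet> t s)" for s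
  proof -
    have "t s $ j * of_int (a $ b j + pairing m (gen b j)) = ln (cmod (z $ j)) * of_int (a $ b j + pairing m (gen b j))" for j
      using m by (cases "z $ j = 0") (simp_all add: t_def log_modulus_chart[OF b] local_generators_chart[OF b])
    then have "K = (\<Sum>j\<in>UNIV. t s $ j * of_int (a $ b j + pairing m (gen b j)))"
      by (simp only: K_def)
    moreover have "(\<chi> j. of_int (a $ b j)) \<bullet> t s = (\<Sum>j\<in>UNIV. t s $ j * of_int (a $ b j))"
      by (simp add: inner_vec_def mult.commute)
    ultimately show ?thesis
      by (simp add: inner_cone_point distrib_left sum.distrib)
  qed
  have "((\<lambda>s. exp (2 * K - 2 * (g (cone_point v b (t s)) + (\<chi> j. of_int (a $ b j)) \<bullet> t s))) \<longlongrightarrow> exp (2 * K - 2 * \<phi>)) at_bot"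
    by (intro tendsto_intros lim)
  then have "frame_norm g ?x m = exp (2 * K - 2 * \<phi>)"
    unfolding frame_norm_def path Let_def K by (intro tendsto_Lim) simp_all
  moreover have "cmod (chart_frame v a b z m) = exp (- K)"
  proof -
    have "cmod (z $ j) powi (- (a $ b j) - pairing m (gen b j)) =
        exp (- (ln (cmod (z $ j)) * of_int (a $ b j + pairing m (gen b j))))" for j
    proof (cases "z $ j = 0")
      case True
      with m show ?thesis
        by (simp add: local_generators_chart[OF b])
    next
      case False
      then have "cmod (z $ j) powi (- (a $ b j) - pairing m (gen b j)) =
          exp (ln (cmod (z $ j))) powi (- (a $ b j) - pairing m (gen b j))"
        by simp
      then show ?thesis
        unfolding exp_power_int by (simp add: algebra_simps)
    qed
    then show ?thesis
      using m by (simp add: chart_frame_def prod_norm[symmetric] norm_power_int K_def exp_sum flip: sum_negf)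
  qed
  ultimately show ?thesis
    by (simp add: power2_eq_square flip: exp_add)
qed

section \<open>Invariance and positivity of the constructed metric\<close>

lemma torus_act_toric_variety:
  assumes "x \<in> toric_variety \<Sigma>"
  shows "torus_act \<theta> x \<in> toric_variety \<Sigma>"
proof -
  obtain b z where b: "chart b" "x = chart_point v b z"
    using toric_variety_covered_by_charts[OF assms] .
  obtain \<theta>' where "\<theta> = cone_point v b \<theta>'"
    using cone_point_surj[OF b(1)] .
  then show ?thesis
    by (simp add: b(2) torus_act_chart_point chart_point_in_toric_variety[OF b(1)])
qed

lemma torus_act_fibre:
  assumes "e \<in> fibre v a x"
  shows "torus_act_fibre \<theta> e \<in> fibre v a (torus_act \<theta> x)"
proof -
  have "cis (- (rvec m \<bullet> \<theta>)) = cis (rvec u \<bullet> \<theta>) * cis (- (rvec (m + u) \<bullet> \<theta>))" for m u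
    by (simp add: cis_mult rvec_add inner_add_left)
  moreover have "cis (rvec u \<bullet> \<theta>) * p * (q * r) = (cis (rvec u \<bullet> \<theta>) * q) * (p * r)" for u p q r
    by simp
  ultimately show ?thesis
    using assms by (auto simp: fibre_def torus_act_fibre_def torus_act_def)
qed

text \<open>Rotations preserve the cone and all moduli, so the predicate under \<open>SOME\<close>
  in \<open>log_modulus\<close> is the same and the choice is literally equal.\<close>

lemma frame_norm_torus_act: "frame_norm g (torus_act \<theta> x) m = frame_norm g x m"
proof -
  have "log_modulus (torus_act \<theta> x) = log_modulus x"
    by (simp add: log_modulus_def torus_act_def norm_mult)
  moreover have "fst (torus_act \<theta> x) = fst x"
    by (simp add: torus_act_def)
  ultimately show ?thesis
    by (simp add: frame_norm_def)
qed

context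
  fixes a :: "int^'d" and g :: "real^'n \<Rightarrow> real"
  assumes g: "C2_fun g" and growth: "growth_condition \<Sigma> v a g"
begin

lemma potential_extension:
  assumes "chart b"
  obtains \<Phi> where "C2_fun \<Phi>"
    "\<And>z. ((\<lambda>t. g (cone_point v b t) + (\<chi> j. of_int (a $ b j)) \<bullet> t) \<longlongrightarrow> \<Phi> z) (boundary_filter (vabs z))"
proof (rule boundary_growth_extension)
  show "C2_fun (\<lambda>t. g (cone_point v b t) + (\<chi> j. of_int (a $ b j)) \<bullet> t)"
    by (rule C2_fun_add[OF C2_fun_compose_linear[OF g linear_cone_point] C2_fun_inner_const])
  show "boundary_growth (\<lambda>t. g (cone_point v b t) + (\<chi> j. of_int (a $ b j)) \<bullet> t)"
    using growth assms growth_condition_iff[OF g] by blast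
qed (rule that)

lemma some_local_generator:
  assumes "x \<in> toric_variety \<Sigma>"
  shows "(SOME m. m \<in> local_generators v a (fst x)) \<in> local_generators v a (fst x)"
proof -
  obtain b z where b: "chart b" "x = chart_point v b z"
    using toric_variety_covered_by_charts[OF assms] .
  obtain m where "m \<in> local_generators v a (fst x)"
    using local_generators_nonempty[OF b(1)] b(2) by metis
  then show ?thesis
    by (rule someI)
qed

lemma frame_norm_pos:
  assumes x: "x \<in> toric_variety \<Sigma>" and m: "m \<in> local_generators v a (fst x)"
  shows "0 < frame_norm g x m"
proof -
  obtain b z where b: "chart b" "x = chart_point v b z"
    using toric_variety_covered_by_charts[OF x] .
  obtain \<Phi> where \<Phi>: "\<And>z. ((\<lambda>t. g (cone_point v b t) + (\<chi> j. of_int (a $ b j)) \<bullet> t) \<longlongrightarrow> \<Phi> z) (boundary_filter (vabs z))"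
    using potential_extension[OF b(1)] by metis
  have "(cmod (chart_frame v a b z m))\<^sup>2 * frame_norm g x m = exp (- 2 * \<Phi> z)"
    unfolding b(2) by (rule frame_norm_chart[OF b(1) m[unfolded b(2)] \<Phi>])
  then have "0 < (cmod (chart_frame v a b z m))\<^sup>2 * frame_norm g x m"
    by simp
  then show ?thesis
    by (auto simp: zero_less_mult_iff)
qed

lemma chart_norm_potential_metric:
  assumes b: "chart b"
    and \<Phi>: "((\<lambda>t. g (cone_point v b t) + (\<chi> j. of_int (a $ b j)) \<bullet> t) \<longlongrightarrow> \<phi>) (boundary_filter (vabs z))"
  shows "chart_norm (potential_metric a g) a b z = exp (- 2 * \<phi>)"
proof -
  let ?x = "chart_point v b z"
  define m where "m = (SOME m. m \<in> local_generators v a (fst ?x))"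
  have x: "?x \<in> toric_variety \<Sigma>"
    by (rule chart_point_in_toric_variety[OF b])
  have m: "m \<in> local_generators v a (fst ?x)"
    unfolding m_def by (rule some_local_generator[OF x])
  have "potential_metric a g ?x (chart_frame v a b z) (chart_frame v a b z) =
      chart_frame v a b z m * cnj (chart_frame v a b z m) * of_real (frame_norm g ?x m)"
    unfolding potential_metric_def using x chart_frame_in_fibre[OF b] by (simp add: m_def Let_def)
  also have "\<dots> = of_real ((cmod (chart_frame v a b z m))\<^sup>2 * frame_norm g ?x m)"
    by (simp only: of_real_mult complex_norm_square)
  also have "\<dots> = of_real (exp (- 2 * \<phi>))"
    by (simp only: frame_norm_chart[OF b m \<Phi>])
  finally show ?thesis
    unfolding chart_norm_def by (simp only: Re_complex_of_real)
qed

lemma hermitian_potential_metric: "hermitian_metric_C2 \<Sigma> v a (potential_metric a g)"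
  unfolding hermitian_metric_C2_def
proof (intro conjI ballI allI impI)
  fix x e e'
  assume "\<not> (x \<in> toric_variety \<Sigma> \<and> e \<in> fibre v a x \<and> e' \<in> fibre v a x)"
  then show "potential_metric a g x e e' = 0"
    unfolding potential_metric_def by (simp only: if_False)
next
  fix x e e'
  assume x: "x \<in> toric_variety \<Sigma>" and e: "e \<in> fibre v a x" and e': "e' \<in> fibre v a x"
  define m where "m = (SOME m. m \<in> local_generators v a (fst x))"
  have m: "m \<in> local_generators v a (fst x)"
    unfolding m_def by (rule some_local_generator[OF x])
  have eq: "potential_metric a g x d d' = d m * cnj (d' m) * of_real (frame_norm g x m)"
    if "d \<in> fibre v a x" "d' \<in> fibre v a x" for d d'
    using that x by (simp add: potential_metric_def m_def Let_def)
  show "potential_metric a g x (\<lambda>m. e m + e'' m) e' = potential_metric a g x e e' + potential_metric a g x e'' e'"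
    if "e'' \<in> fibre v a x" for e''
    using that e e' fibre_add[OF e that] by (simp add: eq algebra_simps)
  show "potential_metric a g x (\<lambda>m. c * e m) e' = c * potential_metric a g x e e'" for c
    using e e' fibre_scale[OF e, of c] by (simp add: eq)
  show "potential_metric a g x e' e = cnj (potential_metric a g x e e')"
    using e e' by (simp add: eq)
  assume ne: "e \<noteq> (\<lambda>m. 0)"
  have "e m \<noteq> 0"
  proof
    assume "e m = 0"
    obtain b z where b: "chart b" "x = chart_point v b z"
      using toric_variety_covered_by_charts[OF x] .
    have "(\<lambda>m. 0) \<in> fibre v a x"
      by (simp add: fibre_def)
    with e m \<open>e m = 0\<close> have "e = (\<lambda>m. 0)"
      unfolding b(2) by (intro fibre_eqI[OF b(1)]) auto
    with ne show False ..
  qed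
  moreover have "Re (potential_metric a g x e e) = (cmod (e m))\<^sup>2 * frame_norm g x m"
    using eq[OF e e] by (simp add: complex_norm_square[symmetric] flip: of_real_mult)
  ultimately show "0 < Re (potential_metric a g x e e)"
    using frame_norm_pos[OF x m] by simp
next
  fix b assume b: "chart b"
  obtain \<Phi> where \<Phi>: "C2_fun \<Phi>"
    "\<And>z. ((\<lambda>t. g (cone_point v b t) + (\<chi> j. of_int (a $ b j)) \<bullet> t) \<longlongrightarrow> \<Phi> z) (boundary_filter (vabs z))"
    using potential_extension[OF b] by metis
  have "C2_fun (\<lambda>z. exp (- 2 * \<Phi> z))"
    by (rule C2_fun_exp[OF C2_fun_scale[OF \<Phi>(1)]])
  then show "C2_fun (\<lambda>z. Re (potential_metric a g (chart_point v b z) (chart_frame v a b z) (chart_frame v a b z)))"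
    using chart_norm_potential_metric[OF b \<Phi>(2)] by (simp add: chart_norm_def)
qed

lemma potential_metric_invariant: "potential_metric a g \<in> invariant_metrics \<Sigma> v a"
proof -
  have "potential_metric a g (torus_act \<theta> x) (torus_act_fibre \<theta> e) (torus_act_fibre \<theta> e') = potential_metric a g x e e'"
    if "x \<in> toric_variety \<Sigma>" "e \<in> fibre v a x" "e' \<in> fibre v a x" for \<theta> x e e'
  proof -
    have "fst (torus_act \<theta> x) = fst x"
      by (simp add: torus_act_def)
    moreover have "torus_act_fibre \<theta> e m * cnj (torus_act_fibre \<theta> e' m) = e m * cnj (e' m)" for m
    proof -
      have "cis (- (rvec m \<bullet> \<theta>)) * cnj (cis (- (rvec m \<bullet> \<theta>))) = 1"
        by (simp add: cis_cnj cis_mult)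
      then show ?thesis
        unfolding torus_act_fibre_def complex_cnj_mult
        by (metis (no_types, lifting) mult.assoc mult.left_commute mult_1)
    qed
    ultimately show ?thesis
      using that torus_act_toric_variety[OF that(1), of \<theta>] torus_act_fibre[OF that(2), of \<theta>]
        torus_act_fibre[OF that(3), of \<theta>]
      by (simp add: potential_metric_def frame_norm_torus_act)
  qed
  then show ?thesis
    unfolding invariant_metrics_def torus_invariant_def using hermitian_potential_metric by blast
qed

text \<open>On the open orbit the limit that defines the metric is the value of the corrected
  potential, by continuity. The construction therefore returns g itself, not merely g up to a
  constant.\<close>

lemma syz_potential_potential_metric: "syz_potential (potential_metric a g) unit_section = g"
proof
  fix \<xi>
  obtain b where b: "chart b" by (rule chart_exists)
  obtain t where \<xi>: "\<xi> = cone_point v b t"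
    using cone_point_surj[OF b] .
  define G where "G t = g (cone_point v b t) + (\<chi> j. of_int (a $ b j)) \<bullet> t" for t
  have "C2_fun G"
    unfolding G_def by (rule C2_fun_add[OF C2_fun_compose_linear[OF g linear_cone_point] C2_fun_inner_const])
  then have "isCont G t"
    using C2_fun_continuous_on[of G UNIV] by (simp add: continuous_on_eq_continuous_at)
  then have "(G \<longlongrightarrow> G t) (boundary_filter (vexp t))"
    by (rule isCont_tendsto_boundary)
  moreover have "vexp t = vabs (cexp t 0)"
    by (simp add: vec_eq_iff)
  ultimately have "chart_norm (potential_metric a g) a b (cexp t 0) = exp (- 2 * G t)"
    by (intro chart_norm_potential_metric[OF b]) (simp add: G_def[abs_def])
  then show "syz_potential (potential_metric a g) unit_section \<xi> = g \<xi>"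
    unfolding \<xi> syz_potential_cone_point[OF hermitian_potential_metric b]
    by (simp add: G_def inner_vec_def diff_divide_distrib)
qed

end

section \<open>The correspondence\<close>

lemma equiv_metric_scaling: "equiv (invariant_metrics \<Sigma> v a) (metric_scaling \<Sigma> v a)"
proof (rule equivI)
  show "metric_scaling \<Sigma> v a \<subseteq> invariant_metrics \<Sigma> v a \<times> invariant_metrics \<Sigma> v a"
    by (auto simp: metric_scaling_def)
  show "refl_on (invariant_metrics \<Sigma> v a) (metric_scaling \<Sigma> v a)"
    unfolding refl_on_def by (auto simp: metric_scaling_iff)
  show "sym (metric_scaling \<Sigma> v a)"
    unfolding sym_def by (metis (no_types, lifting) metric_scaling_def case_prodD mem_Collect_eq metric_scaling_iff)
  show "trans (metric_scaling \<Sigma> v a)"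
    unfolding trans_def by (metis (no_types, lifting) metric_scaling_def case_prodD mem_Collect_eq metric_scaling_iff)
qed

lemma syz_transform_image:
  "syz_transform \<Sigma> v a ` invariant_metrics \<Sigma> v a = lagrangian_sections_growth \<Sigma> v a"
proof
  show "syz_transform \<Sigma> v a ` invariant_metrics \<Sigma> v a \<subseteq> lagrangian_sections_growth \<Sigma> v a"
  proof clarify
    fix h assume h: "h \<in> invariant_metrics \<Sigma> v a"
    note g = syz_potential_growth[OF h]
    have "a + iota v 0 = a"
      by (simp add: vec_eq_iff iota_def)
    then have "growth_condition_class \<Sigma> v a (syz_transform \<Sigma> v a h)"
      unfolding growth_condition_class_def using g syz_transform_eq[OF h] by metis
    then show "syz_transform \<Sigma> v a h \<in> lagrangian_sections_growth \<Sigma> v a"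
      using lagrangian_section_grad[OF g(1)] syz_transform_eq[OF h]
      by (simp add: lagrangian_sections_growth_def)
  qed
  show "lagrangian_sections_growth \<Sigma> v a \<subseteq> syz_transform \<Sigma> v a ` invariant_metrics \<Sigma> v a"
  proof
    fix L assume "L \<in> lagrangian_sections_growth \<Sigma> v a"
    then obtain u g where g: "C2_fun g" "growth_condition \<Sigma> v (a + iota v u) g" and L: "L = induced_section (grad g)"
      by (auto simp: lagrangian_sections_growth_def growth_condition_class_def)
    \<comment> \<open>Adding the linear function u trades the representative a + iota u for a and
      moves the gradient by a lattice vector, which the cosets do not see.\<close>
    define g' where "g' \<xi> = g \<xi> + rvec u \<bullet> \<xi>" for \<xi>
    have C2: "C2_fun g'"
      unfolding g'_def by (rule C2_fun_add[OF g(1) C2_fun_inner_const])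
    have "g' (cone_point v b t) + (\<chi> j. of_int (a $ b j)) \<bullet> t =
        g (cone_point v b t) + (\<chi> j. of_int ((a + iota v u) $ b j)) \<bullet> t" for b t
      unfolding g'_def inner_cone_point
      by (simp add: inner_vec_def iota_def algebra_simps sum.distrib)
    then have growth: "growth_condition \<Sigma> v a g'"
      using g(2) unfolding growth_condition_iff[OF C2] growth_condition_iff[OF g(1)] by simp
    have "grad g' = (\<lambda>\<xi>. grad g \<xi> + rvec u)"
      unfolding g'_def by (intro ext grad_add_inner g)
    then have "L = induced_section (grad g')"
      by (simp add: L induced_section_add_rvec)
    then have "L = syz_transform \<Sigma> v a (potential_metric a g')"
      by (simp add: syz_transform_eq potential_metric_invariant[OF C2 growth]
          syz_potential_potential_metric[OF C2 growth])
    with potential_metric_invariant[OF C2 growth]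
    show "L \<in> syz_transform \<Sigma> v a ` invariant_metrics \<Sigma> v a"
      by blast
  qed
qed

end

text \<open>The image of the class of x is the singleton of f x, so \<open>the_elem\<close> extracts
  the induced map; it is injective because R is the kernel of f.\<close>

lemma bij_betw_quotient:
  assumes R: "equiv A R" and f: "\<And>x y. x \<in> A \<Longrightarrow> y \<in> A \<Longrightarrow> (x, y) \<in> R \<longleftrightarrow> f x = f y"
  shows "bij_betw (\<lambda>C. the_elem (f ` C)) (A // R) (f ` A)"
proof -
  have class_image: "f ` (R `` {x}) = {f x}" if x: "x \<in> A" for x
  proof -
    have "x \<in> R `` {x}"
      using equiv_class_self[OF R x] .
    moreover have "f y = f x" if "y \<in> R `` {x}" for y
    proof -
      have "y \<in> A" "(x, y) \<in> R"
        using that R by (auto simp: equiv_def refl_on_def)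
      with x f show ?thesis by metis
    qed
    ultimately show ?thesis
      by blast
  qed
  show ?thesis
    unfolding bij_betw_def
  proof
    show "inj_on (\<lambda>C. the_elem (f ` C)) (A // R)"
    proof (rule inj_onI)
      fix C D assume "C \<in> A // R" "D \<in> A // R" and eq: "the_elem (f ` C) = the_elem (f ` D)"
      then obtain x y where "x \<in> A" "C = R `` {x}" "y \<in> A" "D = R `` {y}"
        by (auto elim!: quotientE)
      with eq f show "C = D"
        by (auto simp: class_image intro!: equiv_class_eq[OF R])
    qed
    have "(\<lambda>C. the_elem (f ` C)) ` (A // R) = (\<lambda>x. the_elem (f ` (R `` {x}))) ` A"
      by (simp add: quotient_def image_UN image_image UNION_singleton_eq_range)
    also have "\<dots> = f ` A"
      by (intro image_cong) (simp_all add: class_image)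
    finally show "(\<lambda>C. the_elem (f ` C)) ` (A // R) = f ` A" .
  qed
qed

theorem theorem1p1:
  fixes \<Sigma> :: "(real^'n::finite) set set"
    and v :: "'d::finite \<Rightarrow> int^'n"
    and a :: "int^'d"
  assumes "smooth_fan \<Sigma>"
    and "complete_fan \<Sigma>"
    and "ray_generators \<Sigma> v"
    and "projective_toric \<Sigma> v"
  shows "syz_transform \<Sigma> v a respects metric_scaling \<Sigma> v a \<and>
    bij_betw (\<lambda>C. the_elem (syz_transform \<Sigma> v a ` C))
      (invariant_metrics \<Sigma> v a // metric_scaling \<Sigma> v a)
      (lagrangian_sections_growth \<Sigma> v a)"
proof
  interpret toric_fan \<Sigma> v
    by standard (rule assms)+
  show "syz_transform \<Sigma> v a respects metric_scaling \<Sigma> v a"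
  proof (rule congruentI)
    fix h h' assume hh': "(h, h') \<in> metric_scaling \<Sigma> v a"
    then have "h \<in> invariant_metrics \<Sigma> v a" "h' \<in> invariant_metrics \<Sigma> v a"
      by (auto simp: metric_scaling_def)
    with hh' show "syz_transform \<Sigma> v a h = syz_transform \<Sigma> v a h'"
      by (simp add: metric_scaling_iff)
  qed
  show "bij_betw (\<lambda>C. the_elem (syz_transform \<Sigma> v a ` C))
      (invariant_metrics \<Sigma> v a // metric_scaling \<Sigma> v a) (lagrangian_sections_growth \<Sigma> v a)"
    using bij_betw_quotient[OF equiv_metric_scaling metric_scaling_iff] by (simp add: syz_transform_image)
qed

end
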